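(* For every $q\in(0,1)$ there is a constant $C>0$ such that for all integers $n\ge 2$, $$C^{-1}n^{-3/4}(\log n)^{-1/2}\ \le\ d_{\mathrm{TV}}(\Delta_{\mathbf x_n},\Delta_{\mathbf y_n})\ \le\ C n^{-3/4},$$ where $\mathbf x_n := (01)^{n-1}\,10\,(01)^n$ and $\mathbf y_n := (01)^n\,10\,(01)^{n-1}$ in $\{0,1\}^{4n}$.
   Context: Here $(b)^m$ denotes the concatenation of $m$ copies of the string $b$, and $\log$ is the natural logarithm. The deletion channel with deletion probability $q$ takes an input string $\mathbf x$, deletes each bit independently with probability $q$, and outputs the concatenation, in order, of the retained bits (the trace). $\Delta_{\mathbf x}$ denotes the law of the trace of $\mathbf x$, a probability measure on the countable set $\mathcal S=\bigcup_{k\ge0}\{0,1\}^k$. The total variation distance is $d_{\mathrm{TV}}(\mu,\nu)=\frac12\sum_{x\in\mathcal S}|\mu(x)-\nu(x)|$. *)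

theory Defs
  imports "HOL-Probability.Probability"
begin

text \<open>Bits are booleans, with 0 as \<^const>\<open>False\<close> and 1 as \<^const>\<open>True\<close>, so that the
  set of all finite bit strings is the whole type \<^typ>\<open>bool list\<close>.\<close>

text \<open>Here \<open>del i\<close> means that the bit at position \<open>i\<close> is deleted. The argument \<^const>\<open>False\<close> of
  \<^const>\<open>Pi_pmf\<close> is the value at indices outside the string, which \<^const>\<open>nths\<close> ignores.\<close>

definition trace_law :: "real \<Rightarrow> bool list \<Rightarrow> bool list pmf" where
  "trace_law q x =
     map_pmf (\<lambda>del. nths x {i. \<not> del i})
       (Pi_pmf {..<length x} False (\<lambda>_. bernoulli_pmf q))"

text \<open>The family summed here is always summable, as it is dominated by the sum of two
  probability mass functions.\<close>

definition tv_dist :: "'a pmf \<Rightarrow> 'a pmf \<Rightarrow> real" where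
  "tv_dist \<mu> \<nu> = (1 / 2) * (\<Sum>\<^sub>\<infinity>s. \<bar>pmf \<mu> s - pmf \<nu> s\<bar>)"

definition str_power :: "'a list \<Rightarrow> nat \<Rightarrow> 'a list" where
  "str_power b m = concat (replicate m b)"

definition x_str :: "nat \<Rightarrow> bool list" where
  "x_str n = str_power [False, True] (n - 1) @ [True, False] @ str_power [False, True] n"

definition y_str :: "nat \<Rightarrow> bool list" where
  "y_str n = str_power [False, True] n @ [True, False] @ str_power [False, True] (n - 1)"

lemma length_str_power: "length (str_power b m) = m * length b"
  by (induction m) (simp_all add: str_power_def)

lemma length_x_str: "n \<ge> 1 \<Longrightarrow> length (x_str n) = 4 * n"
  by (simp add: x_str_def length_str_power)

lemma length_y_str: "n \<ge> 1 \<Longrightarrow> length (y_str n) = 4 * n"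
  by (simp add: y_str_def length_str_power)

end

theory Submission
  imports Defs "HOL-Analysis.Weierstrass_Theorems"
begin

text \<open>Let \<open>M\<close> be the block 01, viewed as its own trace law in the convolution algebra of strings. Since
  the defect 10 differs from 01 only by \<open>c = (1 - q)\<^sup>2 (10 - 01)\<close>, the two laws differ by
  \<open>M\<^bsup>n-1\<^esup> c M\<^bsup>n\<^esup> - M\<^bsup>n\<^esup> c M\<^bsup>n-1\<^esup>\<close>. The law of \<open>M\<^bsup>m\<^esup>\<close> at a string \<open>t\<close> with \<open>r\<close> adjacent
  pairs 01 is a Markovian weight of \<open>t\<close> times the binomial probability of \<open>length t\<close> successes in
  \<open>m + r\<close> trials with success probability \<open>1 - q\<^sup>2\<close>. Relative to the Markovian weight, the difference
  is a sum over the position of the defect of local terms which vanish on averaging over the swap of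
  10 and 01, times a smooth function that is a first difference of binomial probabilities. The terms
  are therefore almost orthogonal, and Cauchy-Schwarz yields the upper bound.

  For the lower bound, weight the flips \<open>s\<^sub>j \<noteq> s\<^sub>j\<^sub>-\<^sub>1\<close> by a tent of width of order \<open>sqrt n\<close> that rises
  where the defect is expected. The two expectations of this statistic differ by order \<open>n\<^bsup>-1/2\<^esup>\<close>,
  while it is a sum of independent centred variables of total variance of order \<open>sqrt n\<close> under the
  Markov measure. Bounding the contribution of large values by the fourth moment and the second
  moment estimate of the difference gives a lower bound of order \<open>n\<^bsup>-3/4\<^esup>\<close>, even without the
  logarithm.\<close>

section \<open>Trace laws\<close>

text \<open>Orders of magnitude explain the exponent. Binomial probabilities have order n^(-1/2) and
  each difference in the number of trials gains another n^(-1/2), so the smooth factor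
  \<open>Del\<close> has order n^(-3/2). Each side of the defect has about sqrt n relevant lengths,
  which gives n * n^(-3) = n^(-2) for the diagonal part of the second moment. For distant pairs both
  factors become second differences, of order n^(-2); with order n partners for each position this
  part is n * n * n^(-4) = n^(-2) as well. The weight has bounded mass on each length, hence order
  sqrt n on the relevant lengths, and Cauchy-Schwarz yields sqrt (n^(-2) * n^(1/2)) = n^(-3/4). The
  obstacle is that the weight itself does not single out the relevant lengths, and summing over all
  4 n of them would lose a power of n. An exponential tilt at scale sqrt n is therefore carried by
  every square sum and divided out in Cauchy-Schwarz; exponential moments of length and rises pay
  for it. In the lower bound the signal n^(-1/2) meets a standard deviation n^(1/4), which again
  leaves n^(-3/4).\<close>

lemma trace_law_Nil: "trace_law q [] = return_pmf []"
  by (simp add: trace_law_def)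

lemma trace_law_snoc:
  "trace_law q (xs @ [a]) =
     bind_pmf (trace_law q xs)
       (\<lambda>t. map_pmf (\<lambda>d. if d then t else t @ [a]) (bernoulli_pmf q))"
proof -
  \<comment> \<open>The sets agree off the index \<open>length xs\<close>, which lies outside
    \<open>xs\<close>.\<close>
  have nths_upd: "nths xs {i. i \<noteq> length xs \<longrightarrow> \<not> f i} = nths xs {i. \<not> f i}"
    "nths xs {i. i \<noteq> length xs \<and> \<not> f i} = nths xs {i. \<not> f i}"
    "nths xs {i. i \<noteq> length xs \<and> (i \<noteq> length xs \<longrightarrow> \<not> f i)} = nths xs {i. \<not> f i}" for f
    by (auto simp: nths_def intro!: arg_cong[of _ _ "map fst"] filter_cong dest!: set_zip_rightD)
  have *: "{..<length (xs @ [a])} = insert (length xs) {..<length xs}"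
    by auto
  have "trace_law q (xs @ [a]) =
      bind_pmf (bernoulli_pmf q) (\<lambda>d. bind_pmf (Pi_pmf {..<length xs} False (\<lambda>_. bernoulli_pmf q))
        (\<lambda>f. return_pmf (if d then nths xs {i. \<not> f i} else nths xs {i. \<not> f i} @ [a])))"
    unfolding trace_law_def *
    by (subst Pi_pmf_insert')
      (auto simp: map_bind_pmf nths_append nths_upd cong: if_cong intro!: bind_pmf_cong)
  also have "\<dots> = bind_pmf (trace_law q xs)
       (\<lambda>t. map_pmf (\<lambda>d. if d then t else t @ [a]) (bernoulli_pmf q))"
    unfolding trace_law_def
    by (subst bind_commute_pmf) (simp add: map_pmf_def bind_assoc_pmf bind_return_pmf)
  finally show ?thesis .
qed

lemma finite_set_trace_law: "finite (set_pmf (trace_law q xs))"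
  by (induction xs rule: rev_induct) (auto simp: trace_law_Nil trace_law_snoc)

lemma length_le_of_trace: "t \<in> set_pmf (trace_law q xs) \<Longrightarrow> length t \<le> length xs"
  by (induction xs arbitrary: t rule: rev_induct)
    (fastforce simp: trace_law_Nil trace_law_snoc split: if_splits)+

definition trace_exp :: "real \<Rightarrow> bool list \<Rightarrow> (bool list \<Rightarrow> real) \<Rightarrow> real" where
  "trace_exp q xs F = measure_pmf.expectation (trace_law q xs) F"

lemma integrable_trace_law: "integrable (measure_pmf (trace_law q xs)) (F :: _ \<Rightarrow> real)"
  by (rule integrable_measure_pmf_finite) (rule finite_set_trace_law)

lemma trace_exp_Nil [simp]: "trace_exp q [] F = F []"
  by (simp add: trace_exp_def trace_law_Nil)

lemma trace_exp_snoc: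
  assumes "0 \<le> q" "q \<le> 1"
  shows "trace_exp q (xs @ [a]) F = trace_exp q xs (\<lambda>t. q * F t + (1 - q) * F (t @ [a]))"
proof -
  let ?A = "set_pmf (trace_law q xs)"
  have "trace_exp q (xs @ [a]) F = (\<Sum>t\<in>?A. pmf (trace_law q xs) t *
      measure_pmf.expectation (map_pmf (\<lambda>d. if d then t else t @ [a]) (bernoulli_pmf q)) F)"
    unfolding trace_exp_def trace_law_snoc
    by (subst pmf_expectation_bind[of ?A]) (auto simp: finite_set_trace_law)
  also have "\<dots> = (\<Sum>t\<in>?A. pmf (trace_law q xs) t * (q * F t + (1 - q) * F (t @ [a])))"
    using assms by (simp add: algebra_simps)
  also have "\<dots> = trace_exp q xs (\<lambda>t. q * F t + (1 - q) * F (t @ [a]))"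
    unfolding trace_exp_def
    by (subst integral_measure_pmf[of ?A]) (auto simp: finite_set_trace_law)
  finally show ?thesis .
qed

lemma trace_exp_add: "trace_exp q xs (\<lambda>t. F t + G t) = trace_exp q xs F + trace_exp q xs G"
  unfolding trace_exp_def by (intro Bochner_Integration.integral_add integrable_trace_law)

lemma trace_exp_diff: "trace_exp q xs (\<lambda>t. F t - G t) = trace_exp q xs F - trace_exp q xs G"
  unfolding trace_exp_def by (intro Bochner_Integration.integral_diff integrable_trace_law)

lemma trace_exp_minus: "trace_exp q xs (\<lambda>t. - F t) = - trace_exp q xs F"
  unfolding trace_exp_def by (rule integral_minus)

lemma trace_exp_cmult: "trace_exp q xs (\<lambda>t. c * F t) = c * trace_exp q xs F"
  unfolding trace_exp_def by simp

lemma trace_exp_multc: "trace_exp q xs (\<lambda>t. F t * c) = trace_exp q xs F * c"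
  unfolding trace_exp_def by simp

lemma trace_exp_const: "trace_exp q xs (\<lambda>_. c) = c"
  unfolding trace_exp_def by simp

lemma trace_exp_mono: "(\<And>t. F t \<le> G t) \<Longrightarrow> trace_exp q xs F \<le> trace_exp q xs G"
  unfolding trace_exp_def by (intro integral_mono integrable_trace_law)

lemma trace_exp_append:
  assumes "0 \<le> q" "q \<le> 1"
  shows "trace_exp q (xs @ ys) F = trace_exp q xs (\<lambda>t. trace_exp q ys (\<lambda>u. F (t @ u)))"
proof (induction ys arbitrary: F rule: rev_induct)
  case (snoc a ys)
  have "trace_exp q (xs @ ys @ [a]) F = trace_exp q ((xs @ ys) @ [a]) F"
    by simp
  also have "\<dots> = trace_exp q xs (\<lambda>t. trace_exp q (ys @ [a]) (\<lambda>u. F (t @ u)))"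
    unfolding trace_exp_snoc[OF assms] snoc by simp
  finally show ?case .
qed simp

lemma pmf_trace_law_snoc:
  assumes "0 \<le> q" "q \<le> 1"
  shows "pmf (trace_law q (xs @ [a])) t = q * pmf (trace_law q xs) t +
    (if t \<noteq> [] \<and> last t = a then (1 - q) * pmf (trace_law q xs) (butlast t) else 0)"
proof -
  have ind: "pmf (trace_law q ys) s = trace_exp q ys (indicator {s})" for ys s
    by (simp add: trace_exp_def pmf.rep_eq)
  have snoc_eq: "indicator {t} (s @ [a]) =
      (if t \<noteq> [] \<and> last t = a then indicator {butlast t} s else (0::real))" for s
    by (cases t rule: rev_cases) (auto simp: indicator_def)
  show ?thesis
    unfolding ind trace_exp_snoc[OF assms]
    by (simp add: snoc_eq trace_exp_add trace_exp_cmult trace_exp_const)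
qed

text \<open>A trace as long as the input arises only if every bit is kept. Longer \<open>t\<close>
  confine the supports to \<open>strs_le\<close>; equal length separates the two laws for every
  single \<open>n\<close>.\<close>

lemma pmf_trace_law_full:
  assumes "0 \<le> q" "q \<le> 1" "length xs \<le> length t"
  shows "pmf (trace_law q xs) t = (if t = xs then (1 - q) ^ length xs else 0)"
  using assms(3)
proof (induction xs arbitrary: t rule: rev_induct)
  case (snoc a xs)
  from snoc.prems obtain u b where t: "t = u @ [b]"
    by (cases t rule: rev_cases) auto
  have "pmf (trace_law q xs) t = 0"
    using snoc.prems by (subst snoc.IH) auto
  then show ?case
    using snoc.prems by (auto simp: pmf_trace_law_snoc[OF assms(1,2)] t snoc.IH)
qed (simp add: trace_law_Nil)

text \<open>Deletions are independent, so concatenation of inputs becomes convolution of laws;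
  \<open>j\<close> is the length of the part of the trace that comes from \<open>xs\<close>.\<close>

lemma pmf_trace_law_append:
  assumes "0 \<le> q" "q \<le> 1"
  shows "pmf (trace_law q (xs @ ys)) s =
    (\<Sum>j\<le>length s. pmf (trace_law q xs) (take j s) * pmf (trace_law q ys) (drop j s))"
proof (induction ys arbitrary: s rule: rev_induct)
  case Nil
  have "(\<Sum>j\<le>length s. pmf (trace_law q xs) (take j s) * pmf (trace_law q []) (drop j s)) =
      (\<Sum>j\<in>{length s}. pmf (trace_law q xs) (take j s) * pmf (trace_law q []) (drop j s))"
    by (intro sum.mono_neutral_right) (auto simp: trace_law_Nil)
  then show ?case
    by (simp add: trace_law_Nil)
next
  case (snoc a ys)
  have "pmf (trace_law q (xs @ ys @ [a])) s = q * pmf (trace_law q (xs @ ys)) s +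
    (if s \<noteq> [] \<and> last s = a then (1 - q) * pmf (trace_law q (xs @ ys)) (butlast s) else 0)"
    using pmf_trace_law_snoc[OF assms, of "xs @ ys" a s] by simp
  also have "\<dots> = (\<Sum>j\<le>length s. pmf (trace_law q xs) (take j s) *
      pmf (trace_law q (ys @ [a])) (drop j s))"
  proof (cases s rule: rev_cases)
    case Nil
    then show ?thesis by (simp add: snoc.IH pmf_trace_law_snoc[OF assms])
  next
    case (snoc u b)
    then show ?thesis
      by (simp add: snoc.IH pmf_trace_law_snoc[OF assms] algebra_simps butlast_append sum.distrib
        sum_distrib_left)
  qed
  finally show ?case .
qed

section \<open>Binomial weights and the trace of an alternating string\<close>

fun rises :: "bool list \<Rightarrow> nat" where
  "rises (a # b # s) = (if \<not> a \<and> b then 1 else 0) + rises (b # s)"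
| "rises _ = 0"

lemma rises_append:
  "rises (s @ t) = rises s + rises t +
     (if s \<noteq> [] \<and> t \<noteq> [] \<and> \<not> last s \<and> hd t then 1 else 0)"
proof (induction s rule: rises.induct)
  case ("2_2" a)
  then show ?case by (cases t) auto
qed auto

text \<open>No adjacent pair straddles a nonempty \<open>u\<close>, so the two overlapping halves
  see every rise, and those inside \<open>u\<close> twice.\<close>

lemma rises_glue:
  assumes "u \<noteq> []"
  shows "rises (s @ u @ t) + rises u = rises (s @ u) + rises (u @ t)"
  using assms by (auto simp: rises_append)

lemma rises_le: "2 * rises t \<le> length t"
proof -
  \<comment> \<open>Rises occupy disjoint pairs of positions. A leading 1 belongs to none of them,
    which is the strengthening that carries the induction.\<close>
  have "2 * rises t \<le> length t \<and> (t \<noteq> [] \<and> hd t \<longrightarrow> 2 * rises t + 1 \<le> length t)"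
    by (induction t rule: rises.induct) auto
  then show ?thesis by simp
qed

section \<open>Recursions, differences and the maximum of binomial probabilities\<close>

lemma Bernstein_gt: "N < k \<Longrightarrow> Bernstein N k x = 0"
  by (simp add: Bernstein_def)

lemma Bernstein_Suc_0: "Bernstein (Suc N) 0 x = (1 - x) * Bernstein N 0 x"
  by (simp add: Bernstein_def)

lemma Bernstein_Suc_Suc:
  "Bernstein (Suc N) (Suc k) x = (1 - x) * Bernstein N (Suc k) x + x * Bernstein N k x"
proof (cases "Suc k \<le> N")
  case True
  then have "N - k = Suc (N - Suc k)" by simp
  then show ?thesis by (simp add: Bernstein_def algebra_simps)
next
  case False
  then show ?thesis by (cases "k = N") (simp_all add: Bernstein_def binomial_eq_0)
qed

text \<open>Together with its companion for \<open>Suc k\<close>, this turns differences in the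
  number of trials into a polynomial in the deviation times a single binomial probability.\<close>

lemma Bernstein_down:
  "(real N + 1) * (1 - x) * Bernstein N k x = (real N + 1 - real k) * Bernstein (Suc N) k x"
proof (cases "k \<le> N")
  case True
  have "(Suc N choose k) * (Suc N - k) = Suc N * (N choose k)"
    using binomial_absorb_comp[of "Suc N" k] by (simp add: mult.commute)
  then have "real (Suc N choose k) * (real N + 1 - real k) = (real N + 1) * real (N choose k)"
    using True by (metis Suc_eq_plus1 le_SucI of_nat_Suc of_nat_diff of_nat_mult add.commute)
  then have e: "(real N + 1) * real (N choose k) * y = real (Suc N choose k) * (real N + 1 - real k) * y" for y
    by simp
  have "(real N + 1) * (1 - x) * Bernstein N k x =
      (real N + 1) * real (N choose k) * (x ^ k * (1 - x) ^ (Suc N - k))"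
    using True by (simp add: Bernstein_def Suc_diff_le mult_ac)
  then show ?thesis
    unfolding e Bernstein_def by (simp add: mult_ac)
next
  case False
  then show ?thesis by (cases "k = Suc N") (simp_all add: Bernstein_gt)
qed

lemma Bernstein_down_Suc:
  "(real N + 1) * x * Bernstein N k x = (real k + 1) * Bernstein (Suc N) (Suc k) x"
proof -
  have "(Suc k) * (Suc N choose Suc k) = Suc N * (N choose k)"
    using Suc_times_binomial by blast
  then have "(real k + 1) * real (Suc N choose Suc k) = (real N + 1) * real (N choose k)"
    by (metis of_nat_Suc of_nat_mult add.commute)
  then have e: "(real N + 1) * real (N choose k) * y = (real k + 1) * real (Suc N choose Suc k) * y" for y
    by simp
  have "(real N + 1) * x * Bernstein N k x =
      (real N + 1) * real (N choose k) * (x ^ Suc k * (1 - x) ^ (N - k))"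
    by (simp add: Bernstein_def mult_ac)
  then show ?thesis
    unfolding e Bernstein_def by (simp add: mult_ac)
qed

lemma sum_sqr_Bernstein:
  "(\<Sum>k\<le>N. (real k - real N * x)\<^sup>2 * Bernstein N k x) = real N * x * (1 - x)"
proof -
  have "(real k - real N * x)\<^sup>2 * Bernstein N k x = real k * (real k - 1) * Bernstein N k x
      + (1 - 2 * real N * x) * (real k * Bernstein N k x) + (real N * x)\<^sup>2 * Bernstein N k x" for k
    by (simp add: power2_eq_square algebra_simps)
  then show ?thesis
    by (simp add: sum.distrib sum_distrib_left[symmetric])
      (simp add: power2_eq_square algebra_simps)
qed

lemma sum_abs_Bernstein:
  assumes x: "0 \<le> x" "x \<le> 1"
  shows "(\<Sum>k\<le>N. \<bar>real k - real N * x\<bar> * Bernstein N k x) \<le> sqrt (real N * x * (1 - x))"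
proof -
  have nn: "0 \<le> Bernstein N k x" for k using x by (simp add: Bernstein_nonneg)
  have "(\<Sum>k\<le>N. \<bar>real k - real N * x\<bar> * Bernstein N k x) =
      (\<Sum>k\<le>N. \<bar>\<bar>real k - real N * x\<bar> * sqrt (Bernstein N k x)\<bar> * \<bar>sqrt (Bernstein N k x)\<bar>)"
    using nn by (intro sum.cong) (simp_all add: abs_mult mult.assoc)
  also have "\<dots> \<le> L2_set (\<lambda>k. \<bar>real k - real N * x\<bar> * sqrt (Bernstein N k x)) {..N} *
      L2_set (\<lambda>k. sqrt (Bernstein N k x)) {..N}"
    by (rule L2_set_mult_ineq)
  also have "\<dots> = sqrt (real N * x * (1 - x))"
    using nn by (simp add: L2_set_def power_mult_distrib sum_sqr_Bernstein)
  finally show ?thesis .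
qed

text \<open>The increment at \<open>i\<close> of the binomial distribution with parameter \<open>N\<close> is proportional to
  \<open>x (N + 1) - i\<close> times the distribution with parameter \<open>N + 1\<close>, so that the maximum of the former
  is controlled by the mean deviation of the latter.\<close>

lemma Bernstein_le:
  assumes x: "0 < x" "x < 1"
  shows "Bernstein N k x \<le> 1 / sqrt (x * (1 - x) * (real N + 1))"
proof (cases "k \<le> N")
  case True
  let ?V = "(real N + 1) * x * (1 - x)"
  have V: "?V > 0" using x by simp
  have "?V * Bernstein N k x \<le> (\<Sum>i\<le>k. \<bar>real i - real (Suc N) * x\<bar> * Bernstein (Suc N) i x)"
  proof (induction k)
    case 0
    have "?V * Bernstein N 0 x = (real N + 1) * x * Bernstein (Suc N) 0 x"
      by (simp add: Bernstein_Suc_0)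
    then show ?case
      using x by (simp add: Bernstein_nonneg abs_if add.commute)
  next
    case (Suc k)
    have "?V * (Bernstein N (Suc k) x - Bernstein N k x) =
        (real (Suc N) * x - real (Suc k)) * Bernstein (Suc N) (Suc k) x"
    proof -
      have "?V * (Bernstein N (Suc k) x - Bernstein N k x) =
          x * ((real N + 1) * (1 - x) * Bernstein N (Suc k) x)
          - (1 - x) * ((real N + 1) * x * Bernstein N k x)"
        by (simp add: algebra_simps)
      also have "\<dots> = (real (Suc N) * x - real (Suc k)) * Bernstein (Suc N) (Suc k) x"
        unfolding Bernstein_down Bernstein_down_Suc by (simp add: algebra_simps)
      finally show ?thesis .
    qed
    also have "\<dots> \<le> \<bar>real (Suc k) - real (Suc N) * x\<bar> * Bernstein (Suc N) (Suc k) x"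
      using x by (intro mult_right_mono Bernstein_nonneg) auto
    finally show ?case
      using Suc by (simp add: algebra_simps)
  qed
  also have "\<dots> \<le> (\<Sum>i\<le>Suc N. \<bar>real i - real (Suc N) * x\<bar> * Bernstein (Suc N) i x)"
    using True x by (intro sum_mono2) (auto simp: Bernstein_nonneg)
  also have "\<dots> \<le> sqrt ?V"
    using sum_abs_Bernstein[of x "Suc N"] x by (simp add: add.commute)
  finally have "Bernstein N k x \<le> sqrt ?V / ?V"
    using V by (simp add: field_simps)
  also have "\<dots> = 1 / sqrt ?V"
    using V by (simp add: field_simps)
  finally show ?thesis by (simp add: mult_ac)
next
  case False
  then show ?thesis using x by (simp add: Bernstein_gt)
qed

lemma Bernstein_diff:
  assumes "x < 1"
  shows "Bernstein (Suc N) k x - Bernstein N k x =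
    Bernstein (Suc N) k x * (real k - x * real (Suc N)) / ((1 - x) * real (Suc N))"
proof -
  have "(1 - x) * real (Suc N) \<noteq> 0" using assms by simp
  moreover have "(Bernstein (Suc N) k x - Bernstein N k x) * ((1 - x) * real (Suc N)) =
      Bernstein (Suc N) k x * (real k - x * real (Suc N))"
    using Bernstein_down[of N x k] by (simp add: algebra_simps)
  ultimately show ?thesis by (subst nonzero_eq_divide_eq)
qed

text \<open>The numerator is, up to scaling, the second Krawtchouk polynomial. It has order
  \<open>N\<close> at typical deviations, against \<open>N\<^sup>2\<close> in the
  denominator.\<close>

lemma Bernstein_diff2:
  assumes "x < 1"
  shows "Bernstein (Suc (Suc N)) k x - 2 * Bernstein (Suc N) k x + Bernstein N k x =
    Bernstein (Suc (Suc N)) k x *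
      ((real k - x * real (N + 2))\<^sup>2 + (2 * x - 1) * (real k - x * real (N + 2))
        - x * (1 - x) * real (N + 2)) / ((1 - x)\<^sup>2 * real (N + 2) * real (N + 1))"
proof -
  define B where "B = Bernstein (Suc (Suc N)) k x"
  define B1 where "B1 = Bernstein (Suc N) k x"
  have nz: "(1 - x)\<^sup>2 * real (N + 2) * real (N + 1) \<noteq> 0" using assms by simp
  have 1: "(real N + 2) * (1 - x) * B1 = (real N + 2 - real k) * B"
    using Bernstein_down[of "Suc N" x k] by (simp add: B_def B1_def algebra_simps)
  have 2: "(real N + 1) * (1 - x) * Bernstein N k x = (real N + 1 - real k) * B1"
    using Bernstein_down[of N x k] by (simp add: B1_def)
  have 3: "(real N + 2) * (1 - x) * ((real N + 1) * (1 - x) * Bernstein N k x) =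
      (real N + 1 - real k) * ((real N + 2 - real k) * B)"
    unfolding 2 1[symmetric] by (simp only: mult_ac)
  have "(B - 2 * B1 + Bernstein N k x) * ((1 - x)\<^sup>2 * real (N + 2) * real (N + 1)) =
      B * ((1 - x)\<^sup>2 * real (N + 2) * real (N + 1))
      - 2 * (real N + 1) * (1 - x) * ((real N + 2) * (1 - x) * B1)
      + (real N + 2) * (1 - x) * ((real N + 1) * (1 - x) * Bernstein N k x)"
    by (simp add: power2_eq_square algebra_simps)
  also have "\<dots> = B * ((real k - x * real (N + 2))\<^sup>2 + (2 * x - 1) * (real k - x * real (N + 2))
        - x * (1 - x) * real (N + 2))"
    unfolding 1 3 by (simp add: power2_eq_square algebra_simps)
  finally show ?thesis
    unfolding B_def B1_def by (subst nonzero_eq_divide_eq[OF nz])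
qed

section \<open>The Markovian weight and the exact law of the trace of (01)^m\<close>

locale deletion =
  fixes q :: real
  assumes q_pos: "0 < q" and q_less_1: "q < 1"
begin

lemma q_bounds: "0 \<le> q" "q \<le> 1"
  using q_pos q_less_1 by auto

text \<open>This is what remains of (1 - q)^k q^(2m - k), for k = \<open>length t\<close>, once the
  powers of a binomial distribution with m + \<open>rises t\<close> trials and success probability 1
  - q^2 are split off. It does not depend on m.\<close>

definition wt :: "bool list \<Rightarrow> real" where
  "wt t = (q / (1 + q)) ^ length t / (q\<^sup>2) ^ rises t"

abbreviation bin :: "nat \<Rightarrow> nat \<Rightarrow> real" where
  "bin N k \<equiv> Bernstein N k (1 - q\<^sup>2)"

abbreviation alt :: "nat \<Rightarrow> bool list" where
  "alt m \<equiv> str_power [False, True] m"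

lemma q2: "0 < q\<^sup>2" "q\<^sup>2 < 1"
  using q_pos q_less_1 by (auto simp: power_less_one_iff)

lemma wt_pos: "wt t > 0"
  using q_pos by (simp add: wt_def)

lemma bin_nonneg: "bin N k \<ge> 0"
  using q2 by (simp add: Bernstein_nonneg)

lemma alt_Suc: "alt (Suc m) = (alt m @ [False]) @ [True]"
  by (simp add: str_power_def replicate_append_same[symmetric])

lemma alt_Suc_Cons: "alt (Suc m) = [False, True] @ alt m"
  by (simp add: str_power_def)

lemma wt_snoc: "wt (t @ [b]) =
  wt t * (q / (1 + q)) * (if t \<noteq> [] \<and> \<not> last t \<and> b then 1 / q\<^sup>2 else 1)"
  by (simp add: wt_def rises_append mult_ac)

text \<open>Embeddings of \<open>t\<close> into \<open>(01)\<^sup>m\<close> are counted by the binomial coefficient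
  \<open>(m + rises t) choose (length t)\<close>.\<close>

lemma pmf_alt: "pmf (trace_law q (alt m)) t = wt t * bin (m + rises t) (length t)"
proof (induction m arbitrary: t)
  case 0
  show ?case
  proof (cases "t = []")
    case False
    then have "rises t < length t" using rises_le[of t] by (cases t) auto
    then show ?thesis
      using False by (simp add: str_power_def trace_law_Nil Bernstein_gt)
  qed (simp add: str_power_def trace_law_Nil wt_def Bernstein_def)
next
  case (Suc m)
  have P: "1 - q\<^sup>2 = (1 - q) * (1 + q)" by (simp add: power2_eq_square algebra_simps)
  have c: "(1 - q) * q = q / (1 + q) * (1 - q\<^sup>2)"
    using q_pos by (simp add: P)
  have step: "pmf (trace_law q (alt (Suc m))) t =
    q * (q * pmf (trace_law q (alt m)) t + (if t \<noteq> [] \<and> \<not> last t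
      then (1 - q) * pmf (trace_law q (alt m)) (butlast t) else 0)) +
    (if t \<noteq> [] \<and> last t then (1 - q) * (q * pmf (trace_law q (alt m)) (butlast t) +
       (if butlast t \<noteq> [] \<and> \<not> last (butlast t)
         then (1 - q) * pmf (trace_law q (alt m)) (butlast (butlast t)) else 0)) else 0)" for t
    unfolding alt_Suc pmf_trace_law_snoc[OF q_bounds] by simp
  show ?case
  proof (cases t rule: rev_cases)
    case Nil
    then show ?thesis
      by (simp add: step Suc Bernstein_Suc_0) (simp add: power2_eq_square)
  next
    case t: (snoc u b)
    \<comment> \<open>The last block can supply both of its bits only if \<open>t\<close> ends in
      01, which is also when the last bit adds a rise. Pascal's rule is then applied twice,
      otherwise once.\<close>
    show ?thesis
    proof (cases "b \<and> u \<noteq> [] \<and> \<not> last u")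
      case False
      then have r: "rises t = rises u" and w: "wt t = wt u * (q / (1 + q))"
        by (auto simp: t rises_append wt_snoc)
      have "pmf (trace_law q (alt (Suc m))) t =
        q\<^sup>2 * (wt t * bin (m + rises u) (length t)) + (1 - q) * q * (wt u * bin (m + rises u) (length u))"
      proof -
        have tu: "butlast t = u" "t \<noteq> []" "last t = b" by (simp_all add: t)
        have "pmf (trace_law q (alt (Suc m))) t =
          q * (q * (wt t * bin (m + rises t) (length t))) +
          (1 - q) * (q * (wt u * bin (m + rises u) (length u)))"
          unfolding step Suc tu(1,3) using False tu by (auto simp: distrib_left mult.assoc mult.left_commute)
        then show ?thesis by (simp only: r power2_eq_square mult_ac)
      qed
      also have "\<dots> = wt t * (q\<^sup>2 * bin (m + rises u) (Suc (length u)) + (1 - q\<^sup>2) * bin (m + rises u) (length u))"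
        unfolding c w by (simp add: t algebra_simps)
      also have "\<dots> = wt t * bin (Suc m + rises t) (length t)"
        using Bernstein_Suc_Suc[of "m + rises u" "length u" "1 - q\<^sup>2"] by (simp add: r) (simp add: t)
      finally show ?thesis .
    next
      case True
      then obtain v where u: "u = v @ [False]" and b
        by (cases u rule: rev_cases) auto
      have r: "rises t = Suc (rises v)" "rises u = rises v"
        using \<open>b\<close> by (auto simp: t u rises_append)
      define z where "z = 1 / (1 + q)"
      have z: "z * (1 + q) = 1" using q_pos by (simp add: z_def)
      have w: "wt t = wt v * z\<^sup>2" "wt u = wt v * q * z"
        using \<open>b\<close> q_pos wt_snoc[of "v @ [False]" True] wt_snoc[of v False]
        by (simp_all add: t u power2_eq_square z_def)
      have bl: "butlast t = u" "butlast u = v" "t \<noteq> []" "u \<noteq> []" "last t" "\<not> last u"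
        using \<open>b\<close> by (simp_all only: t u butlast_snoc last_snoc) auto
      have l: "length u = Suc (length v)" "length t = Suc (Suc (length v))" by (simp_all add: t u)
      let ?N = "m + rises v"
      have "pmf (trace_law q (alt (Suc m))) t =
        q * (q * (wt t * bin (m + rises t) (length t))) +
        (1 - q) * (q * (wt u * bin (m + rises u) (length u)) +
          (1 - q) * (wt v * bin (m + rises v) (length v)))"
        unfolding step Suc bl using bl by simp
      also have "\<dots> =
        q\<^sup>2 * (wt t * bin (Suc ?N) (length t)) + (1 - q) * q * (wt u * bin ?N (Suc (length v)))
        + (1 - q)\<^sup>2 * (wt v * bin ?N (length v))"
        unfolding r l power2_eq_square[of "1 - q"] power2_eq_square[of q]
        by (simp only: distrib_left mult.assoc add.assoc add_Suc_right)
      also have "\<dots> = wt t * (q\<^sup>2 * bin (Suc ?N) (length t) +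
          (1 - q\<^sup>2) * (q\<^sup>2 * bin ?N (Suc (length v)) + (1 - q\<^sup>2) * bin ?N (length v)))"
      proof -
        have zz: "z * (1 - q\<^sup>2) = 1 - q"
          using z by (simp add: P mult.left_commute)
        have "(1 - q) * q * wt u = wt t * ((1 - q\<^sup>2) * q\<^sup>2)" "(1 - q)\<^sup>2 * wt v = wt t * (1 - q\<^sup>2)\<^sup>2"
          unfolding w zz[symmetric] by (simp_all only: power2_eq_square mult_ac)
        then have e: "(1 - q) * q * (wt u * y) = wt t * ((1 - q\<^sup>2) * q\<^sup>2) * y"
          "(1 - q)\<^sup>2 * (wt v * y) = wt t * (1 - q\<^sup>2)\<^sup>2 * y" for y
          by (simp_all only: mult.assoc[symmetric])
        show ?thesis
          unfolding e by (simp only: power2_eq_square[of "1 - q\<^sup>2"] distrib_left mult_ac add_ac)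
      qed
      also have "\<dots> = wt t * bin (Suc m + rises t) (length t)"
        using Bernstein_Suc_Suc[of ?N "length v" "1 - q\<^sup>2"]
          Bernstein_Suc_Suc[of "Suc ?N" "Suc (length v)" "1 - q\<^sup>2"]
        by (simp add: r l)
      finally show ?thesis .
    qed
  qed
qed

end

section \<open>Exponential moments\<close>

lemma exp_le_quadratic:
  fixes x :: real
  assumes "\<bar>x\<bar> \<le> 1"
  shows "exp x \<le> 1 + x + x\<^sup>2"
proof (cases "0 \<le> x")
  case True
  then show ?thesis using assms by (intro exp_bound) auto
next
  case False
  define y where "y = - x"
  have y: "0 < y" "y \<le> 1" using False assms by (auto simp: y_def)
  \<comment> \<open>The claim at -y is that exp y times 1 - y + y^2 is at least 1, for which the
    quadratic Taylor polynomial of exp y is large enough.\<close>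
  have "1 \<le> 1 + y\<^sup>2 / 2 + y ^ 3 / 2 + y ^ 4 / 2" using y by simp
  also have "\<dots> = (1 + y + y\<^sup>2 / 2) * (1 - y + y\<^sup>2)"
    by (simp add: power2_eq_square power3_eq_cube power4_eq_xxxx field_simps)
  also have "\<dots> \<le> exp y * (1 - y + y\<^sup>2)"
    using y exp_lower_Taylor_quadratic[of y] by (intro mult_right_mono) auto
  finally have "exp (- y) \<le> 1 - y + y\<^sup>2"
    by (simp add: exp_minus field_simps)
  then show ?thesis by (simp add: y_def)
qed

text \<open>One step of an exponential supermartingale: the linear terms cancel in the mean. The
  four outcomes will be the four deletion patterns of one block 01.\<close>

lemma exp_mean_le:
  fixes w1 w2 w3 w4 :: real
  assumes w: "w1 \<ge> 0" "w2 \<ge> 0" "w3 \<ge> 0" "w4 \<ge> 0" "w1 + w2 + w3 + w4 = 1"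
    and mean: "w1 * x1 + w2 * x2 + w3 * x3 + w4 * x4 = 0"
    and x: "\<bar>x1\<bar> \<le> B" "\<bar>x2\<bar> \<le> B" "\<bar>x3\<bar> \<le> B" "\<bar>x4\<bar> \<le> B" and B: "B \<le> 1"
  shows "w1 * exp (z + x1) + w2 * exp (z + x2) + w3 * exp (z + x3) + w4 * exp (z + x4)
    \<le> exp (z + B\<^sup>2)"
proof -
  have e: "exp y \<le> 1 + y + B\<^sup>2" if "\<bar>y\<bar> \<le> B" for y
  proof -
    have "y\<^sup>2 \<le> B\<^sup>2" using that by (simp add: abs_le_square_iff[symmetric])
    then show ?thesis using exp_le_quadratic[of y] that B by linarith
  qed
  have "w1 * exp x1 + w2 * exp x2 + w3 * exp x3 + w4 * exp x4 \<le>
     w1 * (1 + x1 + B\<^sup>2) + w2 * (1 + x2 + B\<^sup>2) + w3 * (1 + x3 + B\<^sup>2) + w4 * (1 + x4 + B\<^sup>2)"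
    using w x by (intro add_mono mult_left_mono e) auto
  also have "\<dots> = (w1 + w2 + w3 + w4) * (1 + B\<^sup>2) + (w1 * x1 + w2 * x2 + w3 * x3 + w4 * x4)"
    by (simp add: algebra_simps)
  also have "\<dots> \<le> exp (B\<^sup>2)"
    unfolding w mean using exp_ge_add_one_self[of "B\<^sup>2"] by simp
  finally have "exp z * (w1 * exp x1 + w2 * exp x2 + w3 * exp x3 + w4 * exp x4) \<le> exp z * exp (B\<^sup>2)"
    by (intro mult_left_mono) auto
  then show ?thesis
    by (simp add: exp_add algebra_simps)
qed

lemma exp_abs_add_le:
  fixes a b :: real
  shows "exp (\<bar>a\<bar> + \<bar>b\<bar>) \<le> exp (a + b) + exp (a - b) + exp (- a + b) + exp (- a - b)"
proof -
  have "exp (\<bar>a\<bar> + \<bar>b\<bar>) \<in> {exp (a + b), exp (a - b), exp (- a + b), exp (- a - b)}"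
    by (auto simp: abs_if)
  then show ?thesis
    using exp_gt_zero[of "a + b"] exp_gt_zero[of "a - b"] exp_gt_zero[of "- a + b"]
      exp_gt_zero[of "- a - b"] by (auto simp del: exp_gt_zero)
qed

lemma one_plus_sqr_le_exp:
  fixes x :: real
  shows "1 + x\<^sup>2 \<le> 2 * exp \<bar>x\<bar>"
  using exp_lower_Taylor_quadratic[of "\<bar>x\<bar>"] by simp

lemma sum_pmf_le_trace_exp:
  assumes "finite A" "\<And>t. F t \<ge> 0"
  shows "(\<Sum>t\<in>A. pmf (trace_law q xs) t * F t) \<le> trace_exp q xs F"
proof -
  let ?B = "A \<union> set_pmf (trace_law q xs)"
  have "(\<Sum>t\<in>A. pmf (trace_law q xs) t * F t) \<le> (\<Sum>t\<in>?B. pmf (trace_law q xs) t * F t)"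
    using assms by (intro sum_mono2) (auto simp: finite_set_trace_law)
  also have "\<dots> = trace_exp q xs F"
    unfolding trace_exp_def using assms(1)
    by (subst integral_measure_pmf[of ?B]) (auto simp: finite_set_trace_law)
  finally show ?thesis .
qed

section \<open>Exponential moments of length and rises for the trace of (01)^m\<close>

context deletion
begin

lemma trace_exp_alt_Suc:
  "trace_exp q (alt (Suc m)) F = trace_exp q (alt m) (\<lambda>t. q\<^sup>2 * F t + q * (1 - q) * F (t @ [True])
     + q * (1 - q) * F (t @ [False]) + (1 - q)\<^sup>2 * F (t @ [False, True]))"
  unfolding alt_Suc trace_exp_snoc[OF q_bounds]
  by (simp add: power2_eq_square algebra_simps)

text \<open>\<open>q / (1 + q)\<close> is the probability that the next bit retained from further
  blocks 01 is a 1, so that it completes a rise with a final 0.\<close>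

definition rises_adj :: "bool list \<Rightarrow> real" where
  "rises_adj t = rises t + (if t \<noteq> [] \<and> \<not> last t then q / (1 + q) else 0)"

text \<open>The correction for a final zero in \<^const>\<open>rises_adj\<close> makes the mean increment per block
  independent of the last bit.\<close>

lemma trace_exp_alt_exp:
  assumes ab: "2 * \<bar>\<alpha>\<bar> + 2 * \<bar>\<beta>\<bar> \<le> B" and B: "B \<le> 1"
  shows "trace_exp q (alt m) (\<lambda>t. exp (\<alpha> * (length t - 2 * real m * (1 - q)) +
     \<beta> * (rises_adj t - real m * (1 - q) / (1 + q)))) \<le> exp (real m * B\<^sup>2)"
proof (induction m)
  case 0
  then show ?case by (simp add: str_power_def rises_adj_def)
next
  case (Suc m)
  define c where "c = q / (1 + q)"
  define \<mu> where "\<mu> = (1 - q) / (1 + q)"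
  have c: "0 \<le> c" "c \<le> 1" using q_pos by (auto simp: c_def)
  have mu: "0 \<le> \<mu>" "\<mu> \<le> 1" using q_pos q_less_1 by (auto simp: \<mu>_def)
  have cmu: "1 - c = 1 / (1 + q)" "c = q * (1 / (1 + q))" "\<mu> = (1 - q) * (1 / (1 + q))"
    using q_pos by (auto simp: c_def \<mu>_def field_simps)
  \<comment> \<open>\<open>m1\<close> and \<open>m2\<close> evaluate the mean increment of the
    adjusted count when the current last bit is 0 and when it is not; both equal
    \<open>\<mu>\<close>.\<close>
  have m1: "(1 - q) * (1 - c) = \<mu>" unfolding cmu(1,3) ..
  have m2: "q * (1 - q) * c + (1 - q)\<^sup>2 = \<mu>"
  proof -
    define z where "z = 1 / (1 + q)"
    have "z * (1 + q) = 1" using q_pos by (simp add: z_def)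
    then show ?thesis unfolding cmu(2,3) z_def[symmetric] by algebra
  qed
  define Z where "Z m t = \<alpha> * (length t - 2 * real m * (1 - q)) +
     \<beta> * (rises_adj t - real m * (1 - q) / (1 + q))" for m :: nat and t
  have Zmu: "Z m t = \<alpha> * (length t - 2 * real m * (1 - q)) + \<beta> * (rises_adj t - m * \<mu>)" for m t
    by (simp add: Z_def \<mu>_def)
  have bd: "\<bar>\<alpha> * x + \<beta> * y\<bar> \<le> B" if "\<bar>x\<bar> \<le> 2" "\<bar>y\<bar> \<le> 2" for x y
  proof -
    have "\<bar>\<alpha> * x + \<beta> * y\<bar> \<le> \<bar>\<alpha>\<bar> * \<bar>x\<bar> + \<bar>\<beta>\<bar> * \<bar>y\<bar>"
      by (metis abs_mult abs_triangle_ineq)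
    also have "\<dots> \<le> \<bar>\<alpha>\<bar> * 2 + \<bar>\<beta>\<bar> * 2"
      using that by (intro add_mono mult_left_mono) auto
    finally show ?thesis using ab by simp
  qed
  have key: "q\<^sup>2 * exp (Z (Suc m) t) + q * (1 - q) * exp (Z (Suc m) (t @ [True]))
     + q * (1 - q) * exp (Z (Suc m) (t @ [False])) + (1 - q)\<^sup>2 * exp (Z (Suc m) (t @ [False, True]))
     \<le> exp (Z m t + B\<^sup>2)" for t
  proof -
    define e where "e = (if t \<noteq> [] \<and> \<not> last t then 1 else 0 :: real)"
    have z: "Z (Suc m) t = Z m t + (\<alpha> * (- 2 * (1 - q)) + \<beta> * (- \<mu>))"
      "Z (Suc m) (t @ [True]) = Z m t + (\<alpha> * (1 - 2 * (1 - q)) + \<beta> * (e * (1 - c) - \<mu>))"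
      "Z (Suc m) (t @ [False]) = Z m t + (\<alpha> * (1 - 2 * (1 - q)) + \<beta> * ((1 - e) * c - \<mu>))"
      "Z (Suc m) (t @ [False, True]) = Z m t + (\<alpha> * (2 - 2 * (1 - q)) + \<beta> * (1 - e * c - \<mu>))"
      by (auto simp: Zmu rises_adj_def rises_append e_def c_def[symmetric] algebra_simps)
    have e: "e = 0 \<or> e = 1" by (auto simp: e_def)
    have "q\<^sup>2 * (- \<mu>) + q * (1 - q) * (e * (1 - c) - \<mu>) + q * (1 - q) * ((1 - e) * c - \<mu>)
         + (1 - q)\<^sup>2 * (1 - e * c - \<mu>) = 0"
      using e
    proof
      assume "e = 0"
      then show ?thesis using m2 by (simp add: power2_eq_square algebra_simps)
    next
      assume "e = 1"
      then show ?thesis using m1 by (simp add: power2_eq_square algebra_simps)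
    qed
    then have "\<beta> * (q\<^sup>2 * (- \<mu>) + q * (1 - q) * (e * (1 - c) - \<mu>) + q * (1 - q) * ((1 - e) * c - \<mu>)
         + (1 - q)\<^sup>2 * (1 - e * c - \<mu>)) = 0" by simp
    moreover have "q\<^sup>2 * (- 2 * (1 - q)) + q * (1 - q) * (1 - 2 * (1 - q)) + q * (1 - q) * (1 - 2 * (1 - q))
      + (1 - q)\<^sup>2 * (2 - 2 * (1 - q)) = 0" by (simp add: power2_eq_square algebra_simps)
    then have "\<alpha> * (q\<^sup>2 * (- 2 * (1 - q)) + q * (1 - q) * (1 - 2 * (1 - q)) + q * (1 - q) * (1 - 2 * (1 - q))
      + (1 - q)\<^sup>2 * (2 - 2 * (1 - q))) = 0" by simp
    ultimately have mean: "q\<^sup>2 * (\<alpha> * (- 2 * (1 - q)) + \<beta> * (- \<mu>))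
      + q * (1 - q) * (\<alpha> * (1 - 2 * (1 - q)) + \<beta> * (e * (1 - c) - \<mu>))
      + q * (1 - q) * (\<alpha> * (1 - 2 * (1 - q)) + \<beta> * ((1 - e) * c - \<mu>))
      + (1 - q)\<^sup>2 * (\<alpha> * (2 - 2 * (1 - q)) + \<beta> * (1 - e * c - \<mu>)) = 0"
      by (simp only: distrib_left mult.left_commute[of _ \<alpha>] mult.left_commute[of _ \<beta>])
    have "q\<^sup>2 + q * (1 - q) + q * (1 - q) + (1 - q)\<^sup>2 = 1"
      by (simp add: power2_eq_square algebra_simps)
    then show ?thesis
      unfolding z using q_pos q_less_1 c mu e B mean
      by (intro exp_mean_le bd) (auto simp: abs_le_iff)
  qed
  have "trace_exp q (alt (Suc m)) (\<lambda>t. exp (Z (Suc m) t)) \<le> trace_exp q (alt m) (\<lambda>t. exp (Z m t + B\<^sup>2))"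
    unfolding trace_exp_alt_Suc by (intro trace_exp_mono key)
  also have "\<dots> = trace_exp q (alt m) (\<lambda>t. exp (Z m t)) * exp (B\<^sup>2)"
    by (simp add: exp_add trace_exp_multc)
  also have "\<dots> \<le> exp (real m * B\<^sup>2) * exp (B\<^sup>2)"
    using Suc by (intro mult_right_mono) (auto simp: Z_def)
  also have "\<dots> = exp (real (Suc m) * B\<^sup>2)"
    by (simp add: exp_add[symmetric] algebra_simps)
  finally show ?case by (simp only: Z_def)
qed

definition dev :: "nat \<Rightarrow> bool list \<Rightarrow> real" where
  "dev N t = length t - (1 - q\<^sup>2) * real (N + rises t)"

text \<open>The centre is the mean length of the trace of (01)^n and sqrt n is the scale of its
  fluctuations, so the tilt has bounded mean while its reciprocal is summable over lengths with sum
  of order sqrt n.\<close>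

definition tilt :: "nat \<Rightarrow> nat \<Rightarrow> real" where
  "tilt n k = exp (\<bar>real k - 2 * real n * (1 - q)\<bar> / sqrt n)"

text \<open>Up to bounded terms, \<open>dev\<close> and the length are linear in the centred length
  and the centred adjusted rise count. The integrand is thus dominated by exponentials with
  coefficients of order n^(-1/2), whose moments over n + 1 blocks stay bounded.\<close>

lemma trace_exp_alt_dev:
  assumes n: "n \<ge> 100"
  shows "trace_exp q (alt (Suc n)) (\<lambda>t. (1 + (dev (Suc n) t)\<^sup>2 / n)\<^sup>2 * tilt n (length t)) \<le> 16 * exp 204"
proof -
  define s where "s = 1 / sqrt n"
  define P where "P = 1 - q\<^sup>2"
  define U where "U t = length t - 2 * real (Suc n) * (1 - q)" for t :: "bool list"
  define V where "V t = rises_adj t - real (Suc n) * (1 - q) / (1 + q)" for t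
  define E where "E \<alpha> \<beta> t = exp (\<alpha> * U t + \<beta> * V t)" for \<alpha> \<beta> t
  have P: "0 \<le> P" "P \<le> 1" using q2 by (auto simp: P_def)
  have sn: "sqrt n \<ge> 10" using n by (intro real_le_rsqrt) simp
  have s: "0 < s" "s \<le> 1 / 10" using sn n by (auto simp: s_def field_simps)
  have s2: "s\<^sup>2 = 1 / n" using n by (simp add: s_def power_divide)
  \<comment> \<open>One block adds on average as much to the length as to the mean of the binomial
    distribution, so \<open>dev\<close> has no drift.\<close>
  have cen: "P * (1 + (1 - q) / (1 + q)) = 2 * (1 - q)"
    using q_pos unfolding P_def by (simp add: field_simps power2_eq_square)
  have y: "\<bar>dev (Suc n) t\<bar> \<le> \<bar>U t - P * V t\<bar> + 1" for t
  proof -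
    define d where "d = (if t \<noteq> [] \<and> \<not> last t then q / (1 + q) else 0)"
    have "dev (Suc n) t = U t - P * V t + P * d + real (Suc n) * (2 * (1 - q) - P * (1 + (1 - q) / (1 + q)))"
      by (simp add: dev_def U_def V_def rises_adj_def d_def[symmetric] P_def[symmetric] add_divide_distrib)
        (simp add: algebra_simps)
    then have "dev (Suc n) t = U t - P * V t + P * d" by (simp add: cen)
    moreover have "0 \<le> d" "d \<le> 1" using q_pos by (auto simp: d_def)
    then have "0 \<le> P * d" "P * d \<le> 1" using P by (auto intro: mult_le_one)
    ultimately show ?thesis by linarith
  qed
  have u: "\<bar>real k - 2 * real n * (1 - q)\<bar> \<le> \<bar>k - 2 * real (Suc n) * (1 - q)\<bar> + 2" for k :: nat
    using q_pos q_less_1 by (simp add: abs_if algebra_simps)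
  have bd: "(1 + (dev (Suc n) t)\<^sup>2 / n)\<^sup>2 * tilt n (length t) \<le>
      4 * exp 4 * (E (3 * s) (- 2 * s * P) t + E s (- 2 * s * P) t + E (- s) (2 * s * P) t
        + E (- 3 * s) (2 * s * P) t)" for t
  proof -
    define y where "y = dev (Suc n) t"
    define a where "a = 2 * s * (U t - P * V t)"
    define b where "b = s * U t"
    have "1 + y\<^sup>2 / n = 1 + (s * y)\<^sup>2" by (simp add: power_mult_distrib s2)
    also have "\<dots> \<le> 2 * exp \<bar>s * y\<bar>" by (rule one_plus_sqr_le_exp)
    finally have "(1 + y\<^sup>2 / n)\<^sup>2 \<le> (2 * exp \<bar>s * y\<bar>)\<^sup>2"
      by (intro power_mono) auto
    also have "\<dots> = 4 * exp (2 * (s * \<bar>y\<bar>))"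
      using s by (simp add: power_mult_distrib exp_double abs_mult)
    finally have 1: "(1 + y\<^sup>2 / n)\<^sup>2 \<le> 4 * exp (2 * (s * \<bar>y\<bar>))" .
    have "s * \<bar>y\<bar> \<le> s * (\<bar>U t - P * V t\<bar> + 1)"
      using s y[of t] by (intro mult_left_mono) (auto simp: y_def)
    then have 2: "2 * (s * \<bar>y\<bar>) \<le> \<bar>a\<bar> + 2"
    proof -
      have "\<bar>a\<bar> = 2 * (s * \<bar>U t - P * V t\<bar>)" using s by (simp add: a_def abs_mult)
      then show ?thesis using \<open>s * \<bar>y\<bar> \<le> _\<close> s by (simp add: distrib_left)
    qed
    have "s * \<bar>real (length t) - 2 * real n * (1 - q)\<bar> \<le> s * (\<bar>U t\<bar> + 2)"
      using s u[of "length t"] by (intro mult_left_mono) (auto simp: U_def)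
    then have 3: "\<bar>real (length t) - 2 * real n * (1 - q)\<bar> / sqrt n \<le> \<bar>b\<bar> + 2"
    proof -
      have "\<bar>b\<bar> = s * \<bar>U t\<bar>" using s by (simp add: b_def abs_mult)
      moreover have "x / sqrt n = s * x" for x by (simp add: s_def)
      ultimately show ?thesis using \<open>s * \<bar>real (length t) - _\<bar> \<le> _\<close> s by (simp add: distrib_left)
    qed
    have "(1 + y\<^sup>2 / n)\<^sup>2 * tilt n (length t) \<le> 4 * exp (2 * (s * \<bar>y\<bar>)) * exp (\<bar>b\<bar> + 2)"
      unfolding tilt_def using 1 3 by (intro mult_mono) auto
    also have "\<dots> \<le> 4 * exp (\<bar>a\<bar> + 2) * exp (\<bar>b\<bar> + 2)"
      using 2 by (intro mult_mono) auto
    also have "\<dots> = 4 * exp 4 * exp (\<bar>a\<bar> + \<bar>b\<bar>)"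
      by (simp add: mult.assoc exp_add[symmetric] algebra_simps)
    also have "\<dots> \<le> 4 * exp 4 * (exp (a + b) + exp (a - b) + exp (- a + b) + exp (- a - b))"
      by (intro mult_left_mono exp_abs_add_le) auto
    also have "\<dots> = 4 * exp 4 * (E (3 * s) (- 2 * s * P) t + E s (- 2 * s * P) t
        + E (- s) (2 * s * P) t + E (- 3 * s) (2 * s * P) t)"
      by (simp add: E_def a_def b_def algebra_simps)
    finally show ?thesis by (simp add: y_def)
  qed
  \<comment> \<open>Twice the sum of the coefficients is at most \<open>10 * s\<close>, and
    \<open>n \<ge> 100\<close> makes this at most 1 as the moment bound demands; the exponent is 100
    (n + 1) / n, at most 200.\<close>
  have mgf: "trace_exp q (alt (Suc n)) (E \<alpha> \<beta>) \<le> exp 200"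
    if ab: "\<bar>\<alpha>\<bar> \<le> 3 * s" "\<bar>\<beta>\<bar> \<le> 2 * s" for \<alpha> \<beta>
  proof -
    have "trace_exp q (alt (Suc n)) (E \<alpha> \<beta>) \<le> exp (real (Suc n) * (10 * s)\<^sup>2)"
      unfolding E_def U_def V_def using s ab by (intro trace_exp_alt_exp) auto
    also have "real (Suc n) * (10 * s)\<^sup>2 \<le> 200"
      using n by (simp add: power_mult_distrib s2 field_simps)
    finally show ?thesis by simp
  qed
  have sP: "s * P \<le> s" using s P by (simp add: mult_left_le)
  have "trace_exp q (alt (Suc n)) (\<lambda>t. (1 + (dev (Suc n) t)\<^sup>2 / n)\<^sup>2 * tilt n (length t)) \<le>
    trace_exp q (alt (Suc n)) (\<lambda>t. 4 * exp 4 * (E (3 * s) (- 2 * s * P) t + E s (- 2 * s * P) t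
        + E (- s) (2 * s * P) t + E (- 3 * s) (2 * s * P) t))"
    by (intro trace_exp_mono bd)
  also have "\<dots> \<le> 4 * exp 4 * (exp 200 + exp 200 + exp 200 + exp 200)"
    unfolding trace_exp_cmult trace_exp_add using s P sP
    by (intro mult_left_mono add_mono mgf) (auto simp: abs_mult)
  also have "\<dots> = 16 * exp 204"
    by (simp add: exp_add[symmetric])
  finally show ?thesis .
qed

end

section \<open>Square sums of binomial differences\<close>

definition strs :: "nat \<Rightarrow> bool list set" where
  "strs k = {t. length t = k}"

lemma finite_strs [simp]: "finite (strs k)"
  using finite_lists_length_eq[of "UNIV :: bool set" k] by (simp add: strs_def)

lemma length_strs: "t \<in> strs k \<Longrightarrow> length t = k"
  by (simp add: strs_def)

context deletion
begin

text \<open>The factor \<open>4 / q ^ 8\<close> is the square of the one in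
  \<open>bin_bounds\<close>, \<open>16 * exp 204\<close> comes from
  \<open>trace_exp_alt_dev\<close>, and the denominator from the maximum of the binomial
  probabilities.\<close>

definition sqr_const :: real where
  "sqr_const = 4 / q ^ 8 * (16 * exp 204 / (q * sqrt (1 - q\<^sup>2)))"

lemma sqr_const_pos: "sqr_const > 0"
  using q_pos q2 by (simp add: sqr_const_def)

text \<open>Of the two binomial factors in the square of \<open>f\<close>, one is bounded by its
  maximum, of order n^(-1/2); the other combines with \<open>wt\<close> to the trace law of
  (01)^(n+1), under which the remaining moments are bounded.\<close>

lemma sum_wt_sqr_le:
  assumes n: "n \<ge> 100" and T: "finite T"
    and f: "\<And>t. \<bar>f t\<bar> \<le> 2 / q ^ 4 * A * bin (Suc n + rises t) (length t) * (1 + (dev (Suc n) t)\<^sup>2 / n)"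
  shows "(\<Sum>t\<in>T. wt t * tilt n (length t) * (f t)\<^sup>2) \<le> A\<^sup>2 * sqr_const / sqrt n"
proof -
  define A' where "A' = 2 / q ^ 4 * A"
  define D where "D = q * sqrt (1 - q\<^sup>2) * sqrt n"
  have D: "D > 0" using q_pos q2 n by (simp add: D_def)
  have Deq: "D = sqrt ((1 - q\<^sup>2) * q\<^sup>2 * n)"
    using q_pos q2 by (simp add: D_def real_sqrt_mult)
  let ?F = "\<lambda>t. (1 + (dev (Suc n) t)\<^sup>2 / n)\<^sup>2 * tilt n (length t)"
  have "wt t * tilt n (length t) * (f t)\<^sup>2 \<le>
     A'\<^sup>2 / D * (pmf (trace_law q (alt (Suc n))) t * ?F t)" for t
  proof -
    define b where "b = bin (Suc n + rises t) (length t)"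
    have b: "0 \<le> b" by (simp add: b_def bin_nonneg)
    have "b \<le> 1 / sqrt ((1 - q\<^sup>2) * (1 - (1 - q\<^sup>2)) * (real (Suc n + rises t) + 1))"
      unfolding b_def using q2 by (intro Bernstein_le) auto
    also have "\<dots> \<le> 1 / D"
      unfolding Deq using q2 n
      by (intro divide_left_mono real_sqrt_le_mono mult_mono mult_pos_pos) auto
    finally have bD: "b \<le> 1 / D" .
    have "(f t)\<^sup>2 \<le> (A' * b * (1 + (dev (Suc n) t)\<^sup>2 / n))\<^sup>2"
      using power_mono[OF f[of t], of 2] by (simp add: A'_def b_def)
    also have "\<dots> = A'\<^sup>2 * (b * b) * (1 + (dev (Suc n) t)\<^sup>2 / n)\<^sup>2"
      by (simp add: power_mult_distrib power2_eq_square)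
    also have "\<dots> \<le> A'\<^sup>2 * (1 / D * b) * (1 + (dev (Suc n) t)\<^sup>2 / n)\<^sup>2"
      using b bD by (intro mult_right_mono mult_left_mono) auto
    finally have "wt t * tilt n (length t) * (f t)\<^sup>2 \<le> wt t * tilt n (length t) *
        (A'\<^sup>2 * (1 / D * b) * (1 + (dev (Suc n) t)\<^sup>2 / n)\<^sup>2)"
      using wt_pos[of t] by (intro mult_left_mono) (auto simp: tilt_def)
    also have "\<dots> = A'\<^sup>2 / D * (wt t * b * ?F t)"
      by (simp add: mult_ac)
    finally show ?thesis by (simp add: pmf_alt b_def)
  qed
  then have "(\<Sum>t\<in>T. wt t * tilt n (length t) * (f t)\<^sup>2) \<le>
      (\<Sum>t\<in>T. A'\<^sup>2 / D * (pmf (trace_law q (alt (Suc n))) t * ?F t))"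
    by (intro sum_mono)
  also have "\<dots> = A'\<^sup>2 / D * (\<Sum>t\<in>T. pmf (trace_law q (alt (Suc n))) t * ?F t)"
    by (simp add: sum_distrib_left)
  also have "\<dots> \<le> A'\<^sup>2 / D * (16 * exp 204)"
    using D T by (intro mult_left_mono order_trans[OF sum_pmf_le_trace_exp trace_exp_alt_dev[OF n]])
      (auto simp: tilt_def)
  also have "\<dots> = A\<^sup>2 * sqr_const / sqrt n"
    using q_pos by (simp add: A'_def D_def sqr_const_def power_mult_distrib power_divide mult_ac)
  finally show ?thesis .
qed

definition bin1 :: "nat \<Rightarrow> nat \<Rightarrow> real" where
  "bin1 N k = bin (Suc N) k - bin N k"

definition bin2 :: "nat \<Rightarrow> nat \<Rightarrow> real" where
  "bin2 N k = bin1 (Suc N) k - bin1 N k"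

lemma dev_scale:
  fixes y :: real
  assumes "n \<ge> (1::nat)"
  shows "\<bar>y\<bar> + 1 \<le> 2 * sqrt n * (1 + y\<^sup>2 / n)"
proof -
  define s where "s = \<bar>y\<bar> / sqrt n"
  have sn: "1 \<le> sqrt n" using assms by simp
  have s2: "s\<^sup>2 = y\<^sup>2 / n" by (simp add: s_def power_divide)
  have y: "\<bar>y\<bar> = sqrt n * s" using sn by (simp add: s_def)
  have "2 * s \<le> 1 + s\<^sup>2" using sum_squares_bound[of s 1] by simp
  then have "s + 1 \<le> 2 * (1 + s\<^sup>2)" using zero_le_power2[of s] unfolding distrib_left by linarith
  then have "sqrt n * (s + 1) \<le> sqrt n * (2 * (1 + s\<^sup>2))"
    using sn by (intro mult_left_mono) auto
  then show ?thesis using sn unfolding y s2[symmetric] distrib_left by linarith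
qed

text \<open>All quantities are compared with the binomial probability of the largest number of
  trials, at a factor 1/q^2 for a step down. Each difference gains n^(-1/2), and the quadratic
  factor in \<open>M\<close> absorbs the polynomials in the deviation.\<close>

lemma bin_bounds:
  fixes t :: "bool list"
  assumes n: "n = Suc m"
  defines "M \<equiv> bin (Suc n + rises t) (length t) * (1 + (dev (Suc n) t)\<^sup>2 / n)"
  shows "\<bar>bin (Suc m + rises t) (length t)\<bar> \<le> 2 / q ^ 4 * 1 * M"
    and "\<bar>bin1 (m + rises t) (length t)\<bar> \<le> 2 / q ^ 4 * (1 / sqrt n) * M"
    and "\<bar>bin1 (Suc m + rises t) (length t)\<bar> \<le> 2 / q ^ 4 * (1 / sqrt n) * M"
    and "\<bar>bin2 (m + rises t) (length t)\<bar> \<le> 2 / q ^ 4 * (1 / n) * M"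
proof -
  define N where "N = m + rises t"
  define k where "k = length t"
  define y where "y = dev (Suc n) t"
  define b where "b = bin (Suc (Suc N)) k"
  define P where "P = 1 - q\<^sup>2"
  define W where "W = 1 + y\<^sup>2 / n"
  have M: "M = b * W"
    by (simp add: M_def b_def N_def k_def y_def n W_def)
  have y': "y = real k - P * real (N + 2)"
    by (simp add: y_def dev_def n N_def k_def P_def)
  have P: "0 < P" "P < 1" using q2 by (auto simp: P_def)
  have b0: "0 \<le> b" by (simp add: b_def bin_nonneg)
  have W: "1 \<le> W" by (simp add: W_def)
  have n1: "1 \<le> n" by (simp add: n)
  have Nn: "real n \<le> real N + 1" by (simp add: N_def n)
  have q4: "q ^ 4 = q\<^sup>2 * q\<^sup>2" by (simp flip: power_add)
  define c where "c = q\<^sup>2"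
  have c: "0 < c" "c \<le> 1" "q ^ 4 = c * c" using q2 q4 by (simp_all add: c_def)
  have b1: "bin (Suc N) k \<le> b / c"
  proof -
    have "(real (Suc N) + 1) * c * bin (Suc N) k = (real (Suc N) + 1 - real k) * b"
      using Bernstein_down[of "Suc N" "1 - q\<^sup>2" k] by (simp add: b_def c_def)
    also have "\<dots> \<le> (real (Suc N) + 1) * b" using b0 by (intro mult_right_mono) auto
    finally have "(real (Suc N) + 1) * (c * bin (Suc N) k) \<le> (real (Suc N) + 1) * b"
      by (simp add: mult.assoc)
    then have "c * bin (Suc N) k \<le> b" by (rule mult_left_le_imp_le) simp
    then show ?thesis using c by (simp add: pos_le_divide_eq mult.commute)
  qed
  have c1: "1 / c \<le> 1 / (c * c)" using c by (simp add: field_simps)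
  have c0: "b / c \<le> b / (c * c)"
    using mult_left_mono[OF c1 b0] by simp
  have bW: "b \<le> b * W" using b0 W mult_left_mono[of 1 W b] by simp
  have M0: "0 \<le> b * W" using b0 bW by simp
  have "\<bar>bin (Suc N) k\<bar> \<le> b / (c * c)"
    using b1 c0 bin_nonneg[of "Suc N" k] by simp
  also have "\<dots> \<le> 2 * (b * W) / (c * c)"
    using c bW M0 by (intro divide_right_mono) auto
  finally show "\<bar>bin (Suc m + rises t) (length t)\<bar> \<le> 2 / q ^ 4 * 1 * M"
    by (simp add: c M N_def k_def)
  have ys: "(\<bar>y\<bar> + 1) / n \<le> 2 / sqrt n * W"
  proof -
    have "(\<bar>y\<bar> + 1) / n \<le> 2 * sqrt n * W / n"
      using dev_scale[OF n1, of y] by (intro divide_right_mono) (auto simp: W_def)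
    also have "\<dots> = 2 / sqrt n * W"
      using n1 by (simp add: field_simps)
    finally show ?thesis .
  qed
  have d1: "\<bar>bin1 (Suc N) k\<bar> \<le> b / (c * c) * ((\<bar>y\<bar> + 1) / n)"
  proof -
    have "bin1 (Suc N) k = b * y / (c * real (N + 2))"
      using Bernstein_diff[of "1 - q\<^sup>2" "Suc N" k] q2
      by (simp add: bin1_def b_def y' P_def c_def)
    then have "\<bar>bin1 (Suc N) k\<bar> = b / c * (\<bar>y\<bar> / real (N + 2))"
      using b0 c by (simp add: abs_mult)
    also have "\<dots> \<le> b / (c * c) * ((\<bar>y\<bar> + 1) / n)"
      using b0 c Nn n1 c0 by (intro mult_mono frac_le) auto
    finally show ?thesis .
  qed
  also have "\<dots> \<le> b / (c * c) * (2 / sqrt n * W)"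
    using ys b0 c by (intro mult_left_mono) auto
  finally show "\<bar>bin1 (Suc m + rises t) (length t)\<bar> \<le> 2 / q ^ 4 * (1 / sqrt n) * M"
    by (simp add: c M N_def k_def mult_ac)
  have d0: "\<bar>bin1 N k\<bar> \<le> b / (c * c) * ((\<bar>y\<bar> + 1) / n)"
  proof -
    have "bin1 N k = bin (Suc N) k * (y + P) / (c * real (N + 1))"
      using Bernstein_diff[of "1 - q\<^sup>2" N k] q2
      by (simp add: bin1_def y' P_def c_def algebra_simps)
    then have "\<bar>bin1 N k\<bar> = bin (Suc N) k / c * (\<bar>y + P\<bar> / real (N + 1))"
      using bin_nonneg[of "Suc N" k] c by (simp add: abs_mult)
    also have "\<dots> \<le> b / c / c * ((\<bar>y\<bar> + 1) / n)"
      using b0 c Nn n1 b1 P by (intro mult_mono frac_le divide_right_mono) auto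
    finally show ?thesis by simp
  qed
  also have "\<dots> \<le> b / (c * c) * (2 / sqrt n * W)"
    using ys b0 c by (intro mult_left_mono) auto
  finally show "\<bar>bin1 (m + rises t) (length t)\<bar> \<le> 2 / q ^ 4 * (1 / sqrt n) * M"
    by (simp add: c M N_def k_def mult_ac)
  have d2: "\<bar>bin2 N k\<bar> \<le> b / (c * c) * (2 / n * W)"
  proof -
    define Y where "Y = y\<^sup>2 + (2 * P - 1) * y - P * (1 - P) * real (N + 2)"
    have "bin2 N k = b * Y / (c\<^sup>2 * real (N + 2) * real (N + 1))"
      using Bernstein_diff2[of "1 - q\<^sup>2" N k] q2
      by (simp add: bin2_def bin1_def b_def Y_def y' P_def c_def)
    then have e: "\<bar>bin2 N k\<bar> = b / (c * c) * (\<bar>Y\<bar> / (real (N + 2) * real (N + 1)))"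
      using b0 c by (simp add: abs_mult power2_eq_square)
    have aux2: "(a + 2 * z) / (z * w) = a / (z * w) + 2 / w" if "z \<noteq> 0" for a z w :: real
      using that by (simp add: add_divide_distrib)
    have aux: "\<bar>u + v - w\<bar> \<le> 2 * u + 2 * z"
      if "\<bar>v\<bar> \<le> 1 * x" "2 * x \<le> 1 + u" "w \<le> 1 * z" "0 \<le> w" "0 \<le> u" "1 \<le> z" for u v w x z :: real
      using that by linarith
    have "P * (1 - P) \<le> 1" using P by (simp add: mult_le_one)
    moreover have "\<bar>2 * P - 1\<bar> \<le> 1" using P by auto
    then have "\<bar>(2 * P - 1) * y\<bar> \<le> 1 * \<bar>y\<bar>"
      unfolding abs_mult by (rule mult_right_mono) simp
    ultimately have "\<bar>Y\<bar> \<le> 2 * y\<^sup>2 + 2 * real (N + 2)"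
      unfolding Y_def using P sum_squares_bound[of "\<bar>y\<bar>" 1]
      by (intro aux[of _ "\<bar>y\<bar>"]) (auto simp del: mult_1 intro!: mult_right_mono)
    then have "\<bar>Y\<bar> / (real (N + 2) * real (N + 1)) \<le>
        (2 * y\<^sup>2 + 2 * real (N + 2)) / (real (N + 2) * real (N + 1))"
      by (intro divide_right_mono) auto
    also have "\<dots> = 2 * y\<^sup>2 / (real (N + 2) * real (N + 1)) + 2 / real (N + 1)"
      by (rule aux2) simp
    also have "\<dots> \<le> 2 * y\<^sup>2 / (real n * real n) + 2 / real n"
      using n1 Nn by (intro add_mono frac_le mult_mono) auto
    also have "\<dots> = 2 / n * W"
      by (simp add: W_def distrib_left power2_eq_square)
    finally show ?thesis unfolding e using b0 c by (intro mult_left_mono) auto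
  qed
  then show "\<bar>bin2 (m + rises t) (length t)\<bar> \<le> 2 / q ^ 4 * (1 / n) * M"
    by (simp add: c M N_def k_def mult_ac)
qed

lemma sum_bin_sqr:
  assumes n: "n = Suc m" "n \<ge> 100" and T: "finite T"
  shows "(\<Sum>t\<in>T. wt t * tilt n (length t) * (bin (Suc m + rises t) (length t))\<^sup>2) \<le> sqr_const / sqrt n"
    and "(\<Sum>t\<in>T. wt t * tilt n (length t) * (bin1 (m + rises t) (length t))\<^sup>2) \<le> sqr_const / sqrt n / n"
    and "(\<Sum>t\<in>T. wt t * tilt n (length t) * (bin1 (Suc m + rises t) (length t))\<^sup>2) \<le> sqr_const / sqrt n / n"
    and "(\<Sum>t\<in>T. wt t * tilt n (length t) * (bin2 (m + rises t) (length t))\<^sup>2) \<le> sqr_const / sqrt n / n\<^sup>2"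
proof -
  note B = bin_bounds[OF n(1), folded mult.assoc]
  have "(1 / sqrt n)\<^sup>2 = 1 / n" by (simp add: power_divide)
  then show "(\<Sum>t\<in>T. wt t * tilt n (length t) * (bin1 (m + rises t) (length t))\<^sup>2) \<le> sqr_const / sqrt n / n"
    and "(\<Sum>t\<in>T. wt t * tilt n (length t) * (bin1 (Suc m + rises t) (length t))\<^sup>2) \<le> sqr_const / sqrt n / n"
    using sum_wt_sqr_le[OF n(2) T B(2)] sum_wt_sqr_le[OF n(2) T B(3)] by (simp_all add: mult.commute)
  show "(\<Sum>t\<in>T. wt t * tilt n (length t) * (bin (Suc m + rises t) (length t))\<^sup>2) \<le> sqr_const / sqrt n"
    using sum_wt_sqr_le[OF n(2) T B(1)] by simp
  show "(\<Sum>t\<in>T. wt t * tilt n (length t) * (bin2 (m + rises t) (length t))\<^sup>2) \<le> sqr_const / sqrt n / n\<^sup>2"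
    using sum_wt_sqr_le[OF n(2) T B(4)] by (simp add: power_divide mult.commute)
qed

end

section \<open>The difference of the two laws\<close>

lemma sum_strs_append:
  "(\<Sum>s\<in>strs (i + k). F s) = (\<Sum>t\<in>strs i. \<Sum>u\<in>strs k. F (t @ u))"
proof -
  have img: "strs (i + k) = (\<lambda>(t, u). t @ u) ` (strs i \<times> strs k)"
  proof (intro equalityI subsetI)
    fix s assume "s \<in> strs (i + k)"
    then have "(take i s, drop i s) \<in> strs i \<times> strs k" by (simp add: strs_def)
    then show "s \<in> (\<lambda>(t, u). t @ u) ` (strs i \<times> strs k)"
      by (rule rev_image_eqI) simp
  qed (auto simp: strs_def)
  have inj: "inj_on (\<lambda>(t, u). t @ u) (strs i \<times> strs k)"
  proof (rule inj_onI)
    fix x y assume x: "x \<in> strs i \<times> strs k" and y: "y \<in> strs i \<times> strs k"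
      and eq: "(case x of (t, u) \<Rightarrow> t @ u) = (case y of (t, u) \<Rightarrow> t @ u)"
    have "length (fst x) = length (fst y)" using x y by (metis length_strs mem_Times_iff)
    moreover have "fst x @ snd x = fst y @ snd y" using eq by (simp only: case_prod_beta)
    ultimately have "fst x = fst y \<and> snd x = snd y" by (metis append_eq_append_conv)
    then show "x = y" by (simp only: prod_eq_iff)
  qed
  have "(\<Sum>s\<in>strs (i + k). F s) = (\<Sum>x\<in>strs i \<times> strs k. F (case x of (t, u) \<Rightarrow> t @ u))"
    by (simp only: img sum.reindex[OF inj] o_def)
  also have "\<dots> = (\<Sum>(t, u)\<in>strs i \<times> strs k. F (t @ u))"
    by (rule sum.cong) auto
  finally show ?thesis
    by (simp only: sum.cartesian_product)
qed

lemma strs_2: "strs 2 = {[True, True], [True, False], [False, True], [False, False]}"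
  by (auto simp: strs_def numeral_2_eq_2 length_Suc_conv)

lemma sum_strs_2:
  "(\<Sum>c\<in>strs 2. F c) = F [True, True] + F [True, False] + F [False, True] + F [False, False]"
  by (simp add: strs_2 add_ac)

lemma sum_strs_split:
  assumes "j + 2 \<le> K"
  shows "(\<Sum>s\<in>strs K. F s) = (\<Sum>t\<in>strs j. \<Sum>c\<in>strs 2. \<Sum>u\<in>strs (K - 2 - j). F (t @ c @ u))"
proof -
  from assms obtain k where "K = j + 2 + k" using le_Suc_ex by blast
  then have K: "K = j + (2 + k)" "K - 2 - j = k" by simp_all
  show ?thesis unfolding K(2) unfolding K(1) sum_strs_append ..
qed

definition swap_sign :: "bool list \<Rightarrow> real" where
  "swap_sign c = (if c = [True, False] then 1 else if c = [False, True] then - 1 else 0)"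

lemma sum_swap_sign:
  "(\<Sum>c\<in>strs 2. swap_sign c * F c) = F [True, False] - F [False, True]"
  by (simp add: sum_strs_2 swap_sign_def)

lemma swap_sign_eq_0: "length c \<noteq> 2 \<Longrightarrow> swap_sign c = 0"
  by (auto simp: swap_sign_def)

text \<open>Traces of length at most one are equally likely for 10 and 01, so only the full traces
  survive.\<close>

lemma pmf_pair_diff:
  assumes "0 \<le> q" "q \<le> 1"
  shows "pmf (trace_law q [True, False]) v - pmf (trace_law q [False, True]) v = (1 - q)\<^sup>2 * swap_sign v"
proof -
  have 1: "pmf (trace_law q [a]) v =
    q * of_bool (v = []) + (if v \<noteq> [] \<and> last v = a \<and> butlast v = [] then 1 - q else 0)" for a v
    using pmf_trace_law_snoc[OF assms, of "[]" a v] by (auto simp: trace_law_Nil)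
  have 2: "pmf (trace_law q [a, b]) v = q * pmf (trace_law q [a]) v +
    (if v \<noteq> [] \<and> last v = b then (1 - q) * pmf (trace_law q [a]) (butlast v) else 0)" for a b v
    using pmf_trace_law_snoc[OF assms, of "[a]" b v] by simp
  consider "v = []" | a where "v = [a]" | a b where "v = [a, b]" | u a b c where "v = u @ [a, b, c]"
  proof (cases v rule: rev_cases)
    case (snoc u c)
    then show ?thesis
    proof (cases u rule: rev_cases)
      case (snoc w b)
      then show ?thesis using \<open>v = u @ [c]\<close> that by (cases w rule: rev_cases) auto
    qed (use that in auto)
  qed (use that in auto)
  then show ?thesis
    by cases (auto simp: 1 2 swap_sign_def power2_eq_square algebra_simps butlast_append)
qed

lemma pmf_swap_diff:
  assumes q: "0 \<le> q" "q \<le> 1"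
  shows "pmf (trace_law q (xs @ [True, False] @ ys)) s - pmf (trace_law q (xs @ [False, True] @ ys)) s =
    (1 - q)\<^sup>2 * (\<Sum>j<length s - 1. swap_sign (take 2 (drop j s)) *
      pmf (trace_law q xs) (take j s) * pmf (trace_law q ys) (drop (j + 2) s))"
proof -
  have inner: "pmf (trace_law q ([True, False] @ ys)) u - pmf (trace_law q ([False, True] @ ys)) u =
    (1 - q)\<^sup>2 * (if 2 \<le> length u then swap_sign (take 2 u) * pmf (trace_law q ys) (drop 2 u) else 0)" for u
  proof -
    have "pmf (trace_law q ([True, False] @ ys)) u - pmf (trace_law q ([False, True] @ ys)) u =
      (\<Sum>i\<le>length u. (1 - q)\<^sup>2 * swap_sign (take i u) * pmf (trace_law q ys) (drop i u))"
      unfolding pmf_trace_law_append[OF q] sum_subtractf[symmetric] left_diff_distrib[symmetric]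
        pmf_pair_diff[OF q] ..
    also have "\<dots> = (\<Sum>i\<in>{i. i \<le> length u \<and> i = 2}. (1 - q)\<^sup>2 * swap_sign (take i u) * pmf (trace_law q ys) (drop i u))"
    proof (rule sum.mono_neutral_right)
      show "\<forall>i\<in>{..length u} - {i. i \<le> length u \<and> i = 2}.
          (1 - q)\<^sup>2 * swap_sign (take i u) * pmf (trace_law q ys) (drop i u) = 0"
      proof
        fix i assume i: "i \<in> {..length u} - {i. i \<le> length u \<and> i = 2}"
        then have "length (take i u) \<noteq> 2" by auto
        then have "swap_sign (take i u) = 0" by (rule swap_sign_eq_0)
        then show "(1 - q)\<^sup>2 * swap_sign (take i u) * pmf (trace_law q ys) (drop i u) = 0" by simp
      qed
    qed auto
    also have "{i. i \<le> length u \<and> i = 2} = (if 2 \<le> length u then {2} else {})"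
      by auto
    finally show ?thesis by (simp add: mult.assoc split: if_splits)
  qed
  have "pmf (trace_law q (xs @ [True, False] @ ys)) s - pmf (trace_law q (xs @ [False, True] @ ys)) s =
    (\<Sum>j\<le>length s. pmf (trace_law q xs) (take j s) * ((1 - q)\<^sup>2 *
      (if 2 \<le> length (drop j s) then swap_sign (take 2 (drop j s)) * pmf (trace_law q ys) (drop 2 (drop j s)) else 0)))"
    unfolding pmf_trace_law_append[OF q, of xs] sum_subtractf[symmetric] right_diff_distrib[symmetric] inner ..
  \<comment> \<open>The range says that two bits remain from position \<open>j\<close> on; truncated
    subtraction makes it empty for strings shorter than two.\<close>
  also have "\<dots> = (\<Sum>j<length s - 1. pmf (trace_law q xs) (take j s) * ((1 - q)\<^sup>2 *
      (if 2 \<le> length (drop j s) then swap_sign (take 2 (drop j s)) * pmf (trace_law q ys) (drop 2 (drop j s)) else 0)))"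
    by (rule sum.mono_neutral_right) auto
  also have "\<dots> = (1 - q)\<^sup>2 * (\<Sum>j<length s - 1. swap_sign (take 2 (drop j s)) *
      pmf (trace_law q xs) (take j s) * pmf (trace_law q ys) (drop (j + 2) s))"
    unfolding sum_distrib_left by (intro sum.cong) (auto simp: add.commute)
  finally show ?thesis .
qed

context deletion
begin

text \<open>The exponents m and m + 1 of the two sides are exchanged. Writing one binomial
  probability as the other minus \<open>bin1\<close> cancels the leading products and leaves
  \<open>bin\<close> times \<open>bin1\<close> on either side.\<close>

definition Del :: "nat \<Rightarrow> bool list \<Rightarrow> bool list \<Rightarrow> real" where
  "Del m t u = bin (m + rises t) (length t) * bin (Suc m + rises u) (length u)
     - bin (Suc m + rises t) (length t) * bin (m + rises u) (length u)"

definition trm :: "nat \<Rightarrow> bool list \<Rightarrow> nat \<Rightarrow> real" where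
  "trm m s j = swap_sign (take 2 (drop j s)) * (wt (take j s) * wt (drop (j + 2) s) *
     Del m (take j s) (drop (j + 2) s))"

text \<open>Both sides are (01)^(2m+2). Comparing \<open>x_str\<close> and \<open>y_str\<close> with
  this common string makes the undisturbed laws cancel.\<close>

lemma alt_swap: "alt m @ [False, True] @ alt (Suc m) = alt (Suc m) @ [False, True] @ alt m"
proof -
  have "alt m @ [False, True] @ alt (Suc m) = (alt m @ [False, True]) @ [False, True] @ alt m"
    by (simp only: alt_Suc_Cons append_assoc)
  also have "alt m @ [False, True] = alt (Suc m)"
    by (simp only: alt_Suc append_assoc append.simps)
  finally show ?thesis .
qed

lemma pmf_x_y_diff:
  "pmf (trace_law q (x_str (Suc m))) s - pmf (trace_law q (y_str (Suc m))) s =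
     (1 - q)\<^sup>2 * (\<Sum>j<length s - 1. trm m s j)"
proof -
  have "pmf (trace_law q (x_str (Suc m))) s - pmf (trace_law q (y_str (Suc m))) s =
    (pmf (trace_law q (alt m @ [True, False] @ alt (Suc m))) s - pmf (trace_law q (alt m @ [False, True] @ alt (Suc m))) s)
    - (pmf (trace_law q (alt (Suc m) @ [True, False] @ alt m)) s - pmf (trace_law q (alt (Suc m) @ [False, True] @ alt m)) s)"
    by (simp only: x_str_def y_str_def alt_swap diff_Suc_1)
  also have "\<dots> = (1 - q)\<^sup>2 * (\<Sum>j<length s - 1. trm m s j)"
    unfolding pmf_swap_diff[OF q_bounds] pmf_alt right_diff_distrib[symmetric] sum_subtractf[symmetric]
    by (intro arg_cong2[of _ _ _ _ "(*)"] sum.cong refl) (simp add: trm_def Del_def algebra_simps)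
  finally show ?thesis .
qed

lemma wt_append_ge: "wt s * wt t \<le> wt (s @ t)"
proof -
  have "(q\<^sup>2) ^ rises (s @ t) \<le> (q\<^sup>2) ^ (rises s + rises t)"
    using q2 by (intro power_decreasing) (auto simp: rises_append)
  then have "(q / (1 + q)) ^ (length s + length t) / (q\<^sup>2) ^ (rises s + rises t) \<le>
     (q / (1 + q)) ^ (length s + length t) / (q\<^sup>2) ^ rises (s @ t)"
    using q_pos by (intro divide_left_mono) auto
  then show ?thesis by (simp add: wt_def power_add)
qed

lemma wt_ge: "(q / (1 + q)) ^ length t \<le> wt t"
proof -
  have "(q\<^sup>2) ^ rises t \<le> 1" using q_bounds by (intro power_le_one) (auto simp: power_le_one)
  then show ?thesis
    using q_pos by (simp add: wt_def pos_le_divide_eq mult_left_le)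
qed

text \<open>The reciprocal of the least weight of two inserted bits.\<close>

definition \<kappa> :: real where "\<kappa> = ((1 + q) / q)\<^sup>2"

lemma \<kappa>_pos: "\<kappa> > 0"
  using q_pos by (simp add: \<kappa>_def)

lemma wt_insert_ge:
  assumes "length c = 2"
  shows "wt t * wt u \<le> \<kappa> * wt (t @ c @ u)"
proof -
  have "wt t * wt u = \<kappa> * (wt t * ((q / (1 + q)) ^ length c * wt u))"
  proof -
    have "\<kappa> * (q / (1 + q)) ^ length c = 1"
      using q_pos assms by (simp add: \<kappa>_def power_divide)
    then have "wt t * wt u = (\<kappa> * (q / (1 + q)) ^ length c) * (wt t * wt u)" by simp
    then show ?thesis by (simp only: mult_ac)
  qed
  also have "\<dots> \<le> \<kappa> * (wt t * (wt c * wt u))"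
    using \<kappa>_pos wt_pos[of t] wt_pos[of u] by (intro mult_left_mono mult_right_mono wt_ge) auto
  also have "\<dots> \<le> \<kappa> * (wt t * wt (c @ u))"
    using \<kappa>_pos wt_pos[of t] by (intro mult_left_mono wt_append_ge) auto
  also have "\<dots> \<le> \<kappa> * wt (t @ c @ u)"
    using \<kappa>_pos by (intro mult_left_mono wt_append_ge) auto
  finally show ?thesis .
qed

text \<open>Markov property of \<open>wt\<close>: for a fixed nonempty middle part the two ends
  decouple.\<close>

lemma wt_glue:
  assumes "u \<noteq> []"
  shows "wt (s @ u) * wt (u @ t) = wt (s @ u @ t) * wt u"
proof -
  have "wt x * wt y = (q / (1 + q)) ^ (length x + length y) / (q\<^sup>2) ^ (rises x + rises y)" for x y
    by (simp add: wt_def power_add)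
  then show ?thesis
    using rises_glue[OF assms, of s t] by (simp add: add_ac)
qed

end

section \<open>Second moment of the difference\<close>

lemma sum_rearrange:
  fixes f g :: "_ \<Rightarrow> real"
  shows "(\<Sum>c\<in>C. \<Sum>u\<in>U. \<Sum>e\<in>E. \<Sum>v\<in>V. f c * g e * (w u v * (A u e v * B c u v))) =
    (\<Sum>u\<in>U. \<Sum>v\<in>V. w u v * ((\<Sum>e\<in>E. g e * A u e v) * (\<Sum>c\<in>C. f c * B c u v)))"
proof -
  let ?h = "\<lambda>u v e c. f c * g e * (w u v * (A u e v * B c u v))"
  have "(\<Sum>c\<in>C. \<Sum>u\<in>U. \<Sum>e\<in>E. \<Sum>v\<in>V. ?h u v e c) = (\<Sum>u\<in>U. \<Sum>c\<in>C. \<Sum>e\<in>E. \<Sum>v\<in>V. ?h u v e c)"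
    by (rule sum.swap)
  also have "\<dots> = (\<Sum>u\<in>U. \<Sum>c\<in>C. \<Sum>v\<in>V. \<Sum>e\<in>E. ?h u v e c)"
    by (intro sum.cong refl sum.swap)
  also have "\<dots> = (\<Sum>u\<in>U. \<Sum>v\<in>V. \<Sum>c\<in>C. \<Sum>e\<in>E. ?h u v e c)"
    by (intro sum.cong refl sum.swap)
  also have "\<dots> = (\<Sum>u\<in>U. \<Sum>v\<in>V. \<Sum>e\<in>E. \<Sum>c\<in>C. ?h u v e c)"
    by (intro sum.cong refl sum.swap)
  also have "\<dots> = (\<Sum>u\<in>U. \<Sum>v\<in>V. w u v * ((\<Sum>e\<in>E. g e * A u e v) * (\<Sum>c\<in>C. f c * B c u v)))"
    by (simp only: sum_product) (simp only: sum_distrib_left mult_ac)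
  finally show ?thesis .
qed

text \<open>Positions at distance at least 3 leave a bit between the two pairs, as factorising the
  weight requires. Each position has at most five nearer partners, itself included, and these
  products are bounded by squares.\<close>

lemma sqr_sum_le_near_far:
  fixes x :: "nat \<Rightarrow> real"
  shows "(\<Sum>j<L. x j)\<^sup>2 \<le> 5 * (\<Sum>j<L. (x j)\<^sup>2) +
    (\<Sum>i<L. \<Sum>j<L. if i + 3 \<le> j \<or> j + 3 \<le> i then x i * x j else 0)"
proof -
  define near where "near i j \<longleftrightarrow> \<not> (i + 3 \<le> j \<or> j + 3 \<le> i)" for i j :: nat
  define y where "y i j = (if near i j then (x i)\<^sup>2 else 0)" for i j
  have cnt: "(\<Sum>j<L. y i j) \<le> 5 * (x i)\<^sup>2" for i
  proof -
    have "(\<Sum>j<L. y i j) = (\<Sum>j\<in>{j \<in> {..<L}. near i j}. (x i)\<^sup>2)"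
      unfolding y_def by (rule sum.inter_filter[symmetric]) simp
    also have "\<dots> = card {j \<in> {..<L}. near i j} * (x i)\<^sup>2" by simp
    also have "card {j \<in> {..<L}. near i j} \<le> card {i - 2..i + 2}"
      by (rule card_mono) (auto simp: near_def)
    also have "\<dots> \<le> 5" by simp
    finally show ?thesis by (simp add: mult_right_mono)
  qed
  have pw: "x i * x j \<le> (y i j + y j i) / 2 + (if i + 3 \<le> j \<or> j + 3 \<le> i then x i * x j else 0)" for i j
    using sum_squares_bound[of "x i" "x j"] by (auto simp: y_def near_def)
  have "(\<Sum>j<L. x j)\<^sup>2 = (\<Sum>i<L. \<Sum>j<L. x i * x j)"
    by (simp add: power2_eq_square sum_product)
  also have "\<dots> \<le> (\<Sum>i<L. \<Sum>j<L. (y i j + y j i) / 2 + (if i + 3 \<le> j \<or> j + 3 \<le> i then x i * x j else 0))"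
    by (intro sum_mono pw)
  also have "\<dots> = ((\<Sum>i<L. \<Sum>j<L. y i j) + (\<Sum>i<L. \<Sum>j<L. y j i)) / 2 +
      (\<Sum>i<L. \<Sum>j<L. if i + 3 \<le> j \<or> j + 3 \<le> i then x i * x j else 0)"
    by (simp only: sum.distrib sum_divide_distrib[symmetric])
  also have "(\<Sum>i<L. \<Sum>j<L. y j i) = (\<Sum>i<L. \<Sum>j<L. y i j)"
    by (rule sum.swap)
  also have "(\<Sum>i<L. \<Sum>j<L. y i j) \<le> (\<Sum>i<L. 5 * (x i)\<^sup>2)"
    by (intro sum_mono cnt)
  finally show ?thesis by (simp add: sum_distrib_left[symmetric])
qed

context deletion
begin

lemma trm_split:
  assumes "length t = j" "length c = 2"
  shows "trm m (t @ c @ u) j = swap_sign c * (wt t * wt u * Del m t u)"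
  using assms by (simp add: trm_def)

lemma sum_diag:
  assumes "j + 2 \<le> K"
  shows "(\<Sum>s\<in>strs K. (trm m s j)\<^sup>2 / wt s) \<le>
    2 * \<kappa> * (\<Sum>t\<in>strs j. \<Sum>u\<in>strs (K - 2 - j). wt t * wt u * (Del m t u)\<^sup>2)"
proof -
  have "(trm m (t @ c @ u) j)\<^sup>2 / wt (t @ c @ u) \<le> (swap_sign c)\<^sup>2 * (\<kappa> * (wt t * wt u * (Del m t u)\<^sup>2))"
    if t: "t \<in> strs j" and c: "c \<in> strs 2" for t c u
  proof -
    have "wt t * wt u / wt (t @ c @ u) \<le> \<kappa>"
      using wt_insert_ge[of c t u] wt_pos[of "t @ c @ u"] c by (simp add: pos_divide_le_eq length_strs)
    then have "(swap_sign c)\<^sup>2 * (wt t * wt u * (Del m t u)\<^sup>2) * (wt t * wt u / wt (t @ c @ u)) \<le>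
        (swap_sign c)\<^sup>2 * (wt t * wt u * (Del m t u)\<^sup>2) * \<kappa>"
      using wt_pos[of t] wt_pos[of u] by (intro mult_left_mono) auto
    then show ?thesis
      using t c by (simp add: trm_split length_strs power_mult_distrib power2_eq_square mult_ac)
  qed
  then have "(\<Sum>s\<in>strs K. (trm m s j)\<^sup>2 / wt s) \<le>
    (\<Sum>t\<in>strs j. \<Sum>c\<in>strs 2. \<Sum>u\<in>strs (K - 2 - j). (swap_sign c)\<^sup>2 * (\<kappa> * (wt t * wt u * (Del m t u)\<^sup>2)))"
    unfolding sum_strs_split[OF assms] by (intro sum_mono)
  also have "\<dots> = 2 * \<kappa> * (\<Sum>t\<in>strs j. \<Sum>u\<in>strs (K - 2 - j). wt t * wt u * (Del m t u)\<^sup>2)"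
    unfolding sum_strs_2 by (simp add: swap_sign_def sum_distrib_left sum.distrib[symmetric])
      (simp add: mult_ac)
  finally show ?thesis .
qed

text \<open>The squared change of \<open>Del m t\<close> when \<open>rises u\<close> goes up by one
  at fixed length: one more difference than in \<open>Del\<close>, hence smaller by a factor of
  order n in the square.\<close>

definition Psi :: "nat \<Rightarrow> bool list \<Rightarrow> bool list \<Rightarrow> real" where
  "Psi m t u = (bin (Suc m + rises t) (length t) * bin2 (m + rises u) (length u)
     - bin1 (m + rises t) (length t) * bin1 (Suc m + rises u) (length u))\<^sup>2"

lemma Del_commute: "Del m t u = - Del m u t"
  by (simp add: Del_def)

text \<open>The swap keeps the length and changes the rises by at most one. The neighbouring bits
  decide which of the two strings has fewer rises, so both values of \<open>Psi\<close> are
  added.\<close>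

lemma Del_swap_right:
  "(Del m t (u @ [True, False] @ v) - Del m t (u @ [False, True] @ v))\<^sup>2 \<le>
     Psi m t (u @ [True, False] @ v) + Psi m t (u @ [False, True] @ v)"
proof -
  define s1 where "s1 = u @ [True, False] @ v"
  define s2 where "s2 = u @ [False, True] @ v"
  have len: "length s1 = length s2" by (simp add: s1_def s2_def)
  have nn: "0 \<le> Psi m t s1" "0 \<le> Psi m t s2" by (simp_all add: Psi_def)
  have step: "(Del m t a - Del m t b)\<^sup>2 = Psi m t b"
    if "rises a = Suc (rises b)" "length a = length b" for a b
  proof -
    have "Del m t a - Del m t b = bin (Suc m + rises t) (length t) * bin2 (m + rises b) (length b)
      - bin1 (m + rises t) (length t) * bin1 (Suc m + rises b) (length b)"
      by (simp add: Del_def bin1_def bin2_def that algebra_simps)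
    then show ?thesis by (simp add: Psi_def)
  qed
  have eq0: "Del m t s1 = Del m t s2" if "rises s1 = rises s2"
    by (simp add: Del_def that len)
  have "rises s1 = rises s2 \<or> rises s1 = Suc (rises s2) \<or> rises s2 = Suc (rises s1)"
    by (cases v) (auto simp: s1_def s2_def rises_append)
  then show ?thesis
    unfolding s1_def[symmetric] s2_def[symmetric]
    using step[of s1 s2] step[of s2 s1] len nn eq0 by (auto simp: power2_commute)
qed

lemma Del_swap_left:
  "(Del m (t @ [True, False] @ u) v - Del m (t @ [False, True] @ u) v)\<^sup>2 \<le>
     Psi m v (t @ [True, False] @ u) + Psi m v (t @ [False, True] @ u)"
  using Del_swap_right[of m v t u] unfolding Del_commute[of m _ v]
  by (simp add: power2_commute)

text \<open>The swapped pair is absorbed into a string of full length at the cost of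
  \<open>\<kappa>\<close>; the pairs 11 and 00 are added to complete the sum.\<close>

lemma sum_two_le:
  assumes G: "\<And>s. 0 \<le> G s"
  shows "(\<Sum>u\<in>strs b. \<Sum>v\<in>strs d. wt u * wt v * (G (u @ [True, False] @ v) + G (u @ [False, True] @ v)))
    \<le> \<kappa> * (\<Sum>s\<in>strs (b + (2 + d)). wt s * G s)"
proof -
  have "wt u * wt v * (G (u @ [True, False] @ v) + G (u @ [False, True] @ v)) \<le>
    (\<Sum>c\<in>strs 2. \<kappa> * (wt (u @ c @ v) * G (u @ c @ v)))" for u v
  proof -
    have 1: "wt u * wt v * G (u @ c @ v) \<le> \<kappa> * (wt (u @ c @ v) * G (u @ c @ v))" if "length c = 2" for c
      using mult_right_mono[OF wt_insert_ge[OF that, of u v] G[of "u @ c @ v"]] by (simp add: mult.assoc)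
    have 2: "0 \<le> \<kappa> * (wt s * G s)" for s
      using G[of s] wt_pos[of s] \<kappa>_pos by simp
    show ?thesis
      unfolding sum_strs_2
      using 1[of "[True, False]"] 1[of "[False, True]"] 2[of "u @ [True, True] @ v"] 2[of "u @ [False, False] @ v"]
      by (simp add: distrib_left)
  qed
  then have "(\<Sum>u\<in>strs b. \<Sum>v\<in>strs d. wt u * wt v * (G (u @ [True, False] @ v) + G (u @ [False, True] @ v)))
    \<le> (\<Sum>u\<in>strs b. \<Sum>v\<in>strs d. \<Sum>c\<in>strs 2. \<kappa> * (wt (u @ c @ v) * G (u @ c @ v)))"
    by (intro sum_mono)
  also have "\<dots> = (\<Sum>u\<in>strs b. \<Sum>c\<in>strs 2. \<Sum>v\<in>strs d. \<kappa> * (wt (u @ c @ v) * G (u @ c @ v)))"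
    by (intro sum.cong refl sum.swap)
  also have "\<dots> = \<kappa> * (\<Sum>s\<in>strs (b + (2 + d)). wt s * G s)"
    by (simp only: sum_strs_append sum_distrib_left)
  finally show ?thesis .
qed

definition Psi_sum :: "nat \<Rightarrow> nat \<Rightarrow> nat \<Rightarrow> real" where
  "Psi_sum m a b = (\<Sum>t\<in>strs a. \<Sum>u\<in>strs b. wt t * wt u * Psi m t u)"

lemma Psi_sum_nonneg: "0 \<le> Psi_sum m a b"
  unfolding Psi_sum_def Psi_def using wt_pos by (intro sum_nonneg mult_nonneg_nonneg) (auto simp: less_imp_le)

text \<open>Summing over the two swaps factorises the product of two distant terms into
  a difference of the first factor under the second swap and vice versa.\<close>

lemma sum_far:
  assumes ij: "i + 3 \<le> j" "j + 2 \<le> K"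
  shows "\<bar>\<Sum>s\<in>strs K. trm m s i * trm m s j / wt s\<bar> \<le> \<kappa> / 2 * (Psi_sum m i (K - 2 - i) + Psi_sum m (K - 2 - j) j)"
proof -
  obtain b where b: "j = i + (2 + b)" "1 \<le> b"
    using ij(1) le_Suc_ex[of "i + 3" j] by (metis add.assoc add.commute le_add2 numeral_3_eq_3 one_add_one plus_1_eq_Suc add_2_eq_Suc add_Suc_right)
  obtain d where d: "K = j + (2 + d)"
    using ij(2) le_Suc_ex[of "j + 2" K] by (auto simp: add.assoc)
  have K: "K = i + (2 + (b + (2 + d)))" using b d by simp
  have K1: "K - 2 - i = b + (2 + d)" and K2: "K - 2 - j = d" using K d by simp_all
  define X where "X t u v = Del m t (u @ [True, False] @ v) - Del m t (u @ [False, True] @ v)" for t u v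
  define Y where "Y t u v = Del m (t @ [True, False] @ u) v - Del m (t @ [False, True] @ u) v" for t u v
  have tm: "trm m (t @ c @ u @ e @ v) i * trm m (t @ c @ u @ e @ v) j / wt (t @ c @ u @ e @ v) =
      swap_sign c * swap_sign e * (wt t * wt u * wt v * (Del m t (u @ e @ v) * Del m (t @ c @ u) v))"
    if "t \<in> strs i" "c \<in> strs 2" "u \<in> strs b" "e \<in> strs 2" for t c u e v
  proof -
    have l: "length t = i" "length c = 2" "length u = b" "length e = 2"
      using that by (auto simp: strs_def)
    have 1: "trm m (t @ c @ u @ e @ v) i = swap_sign c * (wt t * wt (u @ e @ v) * Del m t (u @ e @ v))"
      using l by (intro trm_split)
    have 2: "trm m ((t @ c @ u) @ e @ v) j = swap_sign e * (wt (t @ c @ u) * wt v * Del m (t @ c @ u) v)"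
      using l b by (intro trm_split) auto
    \<comment> \<open>The gap of three positions leaves a nonempty \<open>u\<close>, at which the
      weight can be cut.\<close>
    have "u \<noteq> []" using l b by auto
    from wt_glue[OF this, of "t @ c" "e @ v"]
    have g: "wt (t @ c @ u) * wt (u @ e @ v) = wt (t @ c @ u @ e @ v) * wt u" by simp
    have "trm m (t @ c @ u @ e @ v) i * trm m (t @ c @ u @ e @ v) j =
      swap_sign c * swap_sign e * (wt t * wt v * (Del m t (u @ e @ v) * Del m (t @ c @ u) v)) *
        (wt (t @ c @ u) * wt (u @ e @ v))"
      using 2 unfolding 1 append_assoc by (simp only: mult_ac)
    then show ?thesis
      unfolding g using wt_pos[of "t @ c @ u @ e @ v"] by simp
  qed
  have "(\<Sum>s\<in>strs K. trm m s i * trm m s j / wt s) =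
    (\<Sum>t\<in>strs i. \<Sum>c\<in>strs 2. \<Sum>u\<in>strs b. \<Sum>e\<in>strs 2. \<Sum>v\<in>strs d.
      swap_sign c * swap_sign e * (wt t * wt u * wt v * (Del m t (u @ e @ v) * Del m (t @ c @ u) v)))"
    unfolding K sum_strs_append by (intro sum.cong refl tm)
  also have "\<dots> = (\<Sum>t\<in>strs i. \<Sum>u\<in>strs b. \<Sum>v\<in>strs d. wt t * wt u * wt v * (X t u v * Y t u v))"
    unfolding sum_rearrange sum_swap_sign X_def Y_def ..
  finally have "\<bar>\<Sum>s\<in>strs K. trm m s i * trm m s j / wt s\<bar> =
      \<bar>\<Sum>t\<in>strs i. \<Sum>u\<in>strs b. \<Sum>v\<in>strs d. wt t * wt u * wt v * (X t u v * Y t u v)\<bar>"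
    by (rule arg_cong)
  also have "\<dots> \<le> (\<Sum>t\<in>strs i. \<Sum>u\<in>strs b. \<Sum>v\<in>strs d. \<bar>wt t * wt u * wt v * (X t u v * Y t u v)\<bar>)"
    by (intro order_trans[OF sum_abs] sum_mono order_refl)
  also have "\<dots> \<le> (\<Sum>t\<in>strs i. \<Sum>u\<in>strs b. \<Sum>v\<in>strs d.
      wt t * (wt u * wt v * (Psi m t (u @ [True, False] @ v) + Psi m t (u @ [False, True] @ v))) / 2 +
      wt v * (wt t * wt u * (Psi m v (t @ [True, False] @ u) + Psi m v (t @ [False, True] @ u))) / 2)"
  proof (intro sum_mono)
    fix t u v
    define w where "w = wt t * wt u * wt v"
    have w: "0 \<le> w" using wt_pos[of t] wt_pos[of u] wt_pos[of v] by (simp add: w_def)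
    \<comment> \<open>Separating the factors lets each square be summed with only one pair cut out:
      \<open>X\<close> sees \<open>u\<close>, the right pair and \<open>v\<close> as one string, and
      \<open>Y\<close> does so with \<open>t\<close>, the left pair and \<open>u\<close>.\<close>
    have "2 * \<bar>X t u v * Y t u v\<bar> \<le> (X t u v)\<^sup>2 + (Y t u v)\<^sup>2"
      using sum_squares_bound[of "\<bar>X t u v\<bar>" "\<bar>Y t u v\<bar>"] by (simp add: abs_mult mult.assoc)
    also have "\<dots> \<le> (Psi m t (u @ [True, False] @ v) + Psi m t (u @ [False, True] @ v)) +
      (Psi m v (t @ [True, False] @ u) + Psi m v (t @ [False, True] @ u))"
      unfolding X_def Y_def by (intro add_mono Del_swap_left Del_swap_right)
    finally have "w * (2 * \<bar>X t u v * Y t u v\<bar>) \<le> w * ((Psi m t (u @ [True, False] @ v) + Psi m t (u @ [False, True] @ v)) +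
      (Psi m v (t @ [True, False] @ u) + Psi m v (t @ [False, True] @ u)))"
      using w by (intro mult_left_mono)
    moreover have "\<bar>wt t * wt u * wt v * (X t u v * Y t u v)\<bar> = w * \<bar>X t u v * Y t u v\<bar>"
      using w unfolding w_def[symmetric] abs_mult[of w] by simp
    ultimately show "\<bar>wt t * wt u * wt v * (X t u v * Y t u v)\<bar> \<le>
      wt t * (wt u * wt v * (Psi m t (u @ [True, False] @ v) + Psi m t (u @ [False, True] @ v))) / 2 +
      wt v * (wt t * wt u * (Psi m v (t @ [True, False] @ u) + Psi m v (t @ [False, True] @ u))) / 2"
      by (simp add: w_def add_divide_distrib algebra_simps)
  qed
  also have "\<dots> = (\<Sum>t\<in>strs i. wt t * (\<Sum>u\<in>strs b. \<Sum>v\<in>strs d.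
        wt u * wt v * (Psi m t (u @ [True, False] @ v) + Psi m t (u @ [False, True] @ v)))) / 2 +
      (\<Sum>v\<in>strs d. wt v * (\<Sum>t\<in>strs i. \<Sum>u\<in>strs b.
        wt t * wt u * (Psi m v (t @ [True, False] @ u) + Psi m v (t @ [False, True] @ u)))) / 2"
  proof -
    have "(\<Sum>t\<in>strs i. \<Sum>u\<in>strs b. \<Sum>v\<in>strs d.
        wt v * (wt t * wt u * (Psi m v (t @ [True, False] @ u) + Psi m v (t @ [False, True] @ u)))) =
      (\<Sum>t\<in>strs i. \<Sum>v\<in>strs d. \<Sum>u\<in>strs b.
        wt v * (wt t * wt u * (Psi m v (t @ [True, False] @ u) + Psi m v (t @ [False, True] @ u))))"
      by (intro sum.cong refl sum.swap)
    also have "\<dots> = (\<Sum>v\<in>strs d. \<Sum>t\<in>strs i. \<Sum>u\<in>strs b.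
        wt v * (wt t * wt u * (Psi m v (t @ [True, False] @ u) + Psi m v (t @ [False, True] @ u))))"
      by (rule sum.swap)
    finally show ?thesis
      by (simp only: sum.distrib sum_divide_distrib[symmetric] sum_distrib_left)
  qed
  also have "\<dots> \<le> (\<Sum>t\<in>strs i. wt t * (\<kappa> * (\<Sum>s\<in>strs (b + (2 + d)). wt s * Psi m t s))) / 2 +
      (\<Sum>v\<in>strs d. wt v * (\<kappa> * (\<Sum>s\<in>strs (i + (2 + b)). wt s * Psi m v s))) / 2"
    using wt_pos by (intro add_mono divide_right_mono sum_mono mult_left_mono sum_two_le)
      (auto simp: Psi_def less_imp_le)
  also have "\<dots> = \<kappa> / 2 * (Psi_sum m i (K - 2 - i) + Psi_sum m (K - 2 - j) j)"
    unfolding K1 K2 unfolding Psi_sum_def b(1) by (simp add: sum_distrib_left sum_divide_distrib algebra_simps)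
  finally show ?thesis .
qed

lemma sum_sqr_strs:
  "(\<Sum>s\<in>strs K. (\<Sum>j<K - 1. trm m s j)\<^sup>2 / wt s) \<le>
     10 * \<kappa> * (\<Sum>j<K - 1. \<Sum>t\<in>strs j. \<Sum>u\<in>strs (K - 2 - j). wt t * wt u * (Del m t u)\<^sup>2) +
     2 * \<kappa> * K * (\<Sum>j<K - 1. Psi_sum m j (K - 2 - j))"
proof -
  define L where "L = K - 1"
  define far where "far i j \<longleftrightarrow> i + 3 \<le> j \<or> j + 3 \<le> i" for i j :: nat
  define z where "z i = Psi_sum m i (K - 2 - i)" for i
  define z' where "z' j = Psi_sum m (K - 2 - j) j" for j
  have z: "0 \<le> z i" "0 \<le> z' i" for i by (simp_all add: z_def z'_def Psi_sum_nonneg)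
  \<comment> \<open>Reflection of the position exchanges the two sides of the defect.\<close>
  have zz': "(\<Sum>j<L. z' j) = (\<Sum>j<L. z j)"
  proof -
    have "(\<Sum>j<L. z' j) = (\<Sum>j<L. z (L - Suc j))"
    proof (intro sum.cong refl)
      fix j assume "j \<in> {..<L}"
      then have "L - Suc j = K - 2 - j" "K - 2 - (K - 2 - j) = j" by (auto simp: L_def)
      then show "z' j = z (L - Suc j)" by (simp add: z_def z'_def)
    qed
    then show ?thesis by (simp add: sum.nat_diff_reindex)
  qed
  \<comment> \<open>The bound is symmetrised in \<open>i\<close> and \<open>j\<close> to cover both
    orders at once.\<close>
  have farb: "(\<Sum>s\<in>strs K. trm m s i * trm m s j / wt s) \<le> \<kappa> / 2 * (z i + z' i + (z j + z' j))"
    if "far i j" "i < L" "j < L" for i j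
  proof (cases "i + 3 \<le> j")
    case True
    have "(\<Sum>s\<in>strs K. trm m s i * trm m s j / wt s) \<le> \<kappa> / 2 * (z i + z' j)"
    proof -
      have "j + 2 \<le> K" using that by (simp add: L_def)
      from sum_far[OF True this, of m] show ?thesis by (simp add: z_def z'_def abs_le_iff)
    qed
    also have "\<dots> \<le> \<kappa> / 2 * (z i + z' i + (z j + z' j))"
      using \<kappa>_pos z by (intro mult_left_mono) (auto simp: add_increasing2 add_increasing)
    finally show ?thesis .
  next
    case False
    then have "j + 3 \<le> i" using that by (simp add: far_def)
    moreover have "i + 2 \<le> K" using that by (simp add: L_def)
    ultimately have "(\<Sum>s\<in>strs K. trm m s j * trm m s i / wt s) \<le> \<kappa> / 2 * (z j + z' i)"
      using sum_far[of j i K m] by (simp add: z_def z'_def abs_le_iff)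
    also have "\<dots> \<le> \<kappa> / 2 * (z i + z' i + (z j + z' j))"
      using \<kappa>_pos z by (intro mult_left_mono) (auto simp: add_increasing2 add_increasing)
    finally show ?thesis by (simp add: mult.commute)
  qed
  have "(\<Sum>s\<in>strs K. (\<Sum>j<L. trm m s j)\<^sup>2 / wt s) \<le>
    (\<Sum>s\<in>strs K. (5 * (\<Sum>j<L. (trm m s j)\<^sup>2) + (\<Sum>i<L. \<Sum>j<L. if far i j then trm m s i * trm m s j else 0)) / wt s)"
    unfolding far_def using wt_pos by (intro sum_mono divide_right_mono sqr_sum_le_near_far) (simp add: less_imp_le)
  also have "\<dots> = 5 * (\<Sum>s\<in>strs K. \<Sum>j<L. (trm m s j)\<^sup>2 / wt s) +
    (\<Sum>s\<in>strs K. \<Sum>i<L. \<Sum>j<L. if far i j then trm m s i * trm m s j / wt s else 0)"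
    by (simp add: add_divide_distrib sum.distrib sum_divide_distrib sum_distrib_left if_distrib[of "\<lambda>x. x / _"]
      cong: if_cong)
  also have "(\<Sum>s\<in>strs K. \<Sum>j<L. (trm m s j)\<^sup>2 / wt s) = (\<Sum>j<L. \<Sum>s\<in>strs K. (trm m s j)\<^sup>2 / wt s)"
    by (rule sum.swap)
  also have "(\<Sum>s\<in>strs K. \<Sum>i<L. \<Sum>j<L. if far i j then trm m s i * trm m s j / wt s else 0) =
      (\<Sum>i<L. \<Sum>s\<in>strs K. \<Sum>j<L. if far i j then trm m s i * trm m s j / wt s else 0)"
    by (rule sum.swap)
  also have "\<dots> = (\<Sum>i<L. \<Sum>j<L. \<Sum>s\<in>strs K. if far i j then trm m s i * trm m s j / wt s else 0)"
    by (intro sum.cong refl sum.swap)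
  also have "\<dots> \<le> (\<Sum>i<L. \<Sum>j<L. \<kappa> / 2 * (z i + z' i + (z j + z' j)))"
  proof (intro sum_mono)
    fix i j assume ij: "i \<in> {..<L}" "j \<in> {..<L}"
    show "(\<Sum>s\<in>strs K. if far i j then trm m s i * trm m s j / wt s else 0) \<le>
        \<kappa> / 2 * (z i + z' i + (z j + z' j))"
      using farb[of i j] ij \<kappa>_pos z by (cases "far i j") simp_all
  qed
  also have "\<dots> = \<kappa> / 2 * (2 * L * ((\<Sum>j<L. z j) + (\<Sum>j<L. z' j)))"
    by (simp only: sum_distrib_left[symmetric] sum.distrib sum_constant card_lessThan)
      (simp add: algebra_simps)
  also have "\<dots> = 2 * \<kappa> * L * (\<Sum>j<L. z j)"
    by (simp add: zz')
  also have "\<dots> \<le> 2 * \<kappa> * K * (\<Sum>j<L. z j)"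
    using \<kappa>_pos z by (intro mult_right_mono mult_left_mono sum_nonneg) (auto simp: L_def)
  also have "(\<Sum>j<L. \<Sum>s\<in>strs K. (trm m s j)\<^sup>2 / wt s) \<le>
     (\<Sum>j<L. 2 * \<kappa> * (\<Sum>t\<in>strs j. \<Sum>u\<in>strs (K - 2 - j). wt t * wt u * (Del m t u)\<^sup>2))"
    by (intro sum_mono sum_diag) (auto simp: L_def)
  finally show ?thesis
    by (simp add: L_def z_def sum_distrib_left mult.assoc)
qed

end

section \<open>Summation over all lengths with the exponential tilt\<close>

definition strs_le :: "nat \<Rightarrow> bool list set" where
  "strs_le N = {t. length t \<le> N}"

lemma finite_strs_le [simp]: "finite (strs_le N)"
proof -
  have "strs_le N = (\<Union>k\<le>N. strs k)" by (auto simp: strs_le_def strs_def)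
  then show ?thesis by simp
qed

lemma sum_strs_le: "(\<Sum>t\<in>strs_le N. f t) = (\<Sum>a\<le>N. \<Sum>t\<in>strs a. f t)"
proof -
  have "(\<Sum>a\<le>N. \<Sum>t\<in>{t \<in> strs_le N. length t = a}. f t) = (\<Sum>t\<in>strs_le N. f t)"
    by (rule sum.group) (simp_all, auto simp: strs_le_def)
  moreover have "{t \<in> strs_le N. length t = a} = strs a" if "a \<le> N" for a
    using that by (auto simp: strs_le_def strs_def)
  ultimately show ?thesis by simp
qed

text \<open>Total length and position are traded for the lengths of the two sides; enlarging the
  triangle to a square makes these independent.\<close>

lemma sum_triangle_le:
  fixes H :: "nat \<Rightarrow> nat \<Rightarrow> real"
  assumes H: "\<And>a b. 0 \<le> H a b"
  shows "(\<Sum>K\<le>N. \<Sum>j<K - 1. H j (K - 2 - j)) \<le> (\<Sum>a\<le>N. \<Sum>b\<le>N. H a b)"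
proof -
  let ?S = "Sigma {..N} (\<lambda>K. {..<K - 1})"
  let ?\<phi> = "\<lambda>(K, j). (j, K - 2 - j)"
  have inj: "inj_on ?\<phi> ?S" by (rule inj_onI) force
  have "(\<Sum>K\<le>N. \<Sum>j<K - 1. H j (K - 2 - j)) = (\<Sum>x\<in>?S. case_prod H (?\<phi> x))"
    by (subst sum.Sigma) (auto intro!: sum.cong)
  also have "\<dots> = (\<Sum>x\<in>?\<phi> ` ?S. case_prod H x)"
    by (simp only: sum.reindex[OF inj] o_def)
  also have "\<dots> \<le> (\<Sum>x\<in>{..N} \<times> {..N}. case_prod H x)"
    using H by (intro sum_mono2) auto
  also have "\<dots> = (\<Sum>a\<le>N. \<Sum>b\<le>N. H a b)"
    by (simp only: sum.cartesian_product)
  finally show ?thesis .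
qed

lemma sum_sqr_diff_prod_le:
  fixes W a b c d :: "'a \<Rightarrow> real"
  assumes W: "\<And>t. 0 \<le> W t"
  shows "(\<Sum>t\<in>T. \<Sum>u\<in>T. W t * W u * (a t * b u - c t * d u)\<^sup>2) \<le>
    2 * ((\<Sum>t\<in>T. W t * (a t)\<^sup>2) * (\<Sum>t\<in>T. W t * (b t)\<^sup>2) +
         (\<Sum>t\<in>T. W t * (c t)\<^sup>2) * (\<Sum>t\<in>T. W t * (d t)\<^sup>2))"
proof -
  have sq: "(x - y)\<^sup>2 \<le> 2 * (x\<^sup>2 + y\<^sup>2)" for x y :: real
    using zero_le_power2[of "x + y"] by (simp add: power2_eq_square algebra_simps)
  have "W t * W u * (a t * b u - c t * d u)\<^sup>2 \<le>
     2 * ((W t * (a t)\<^sup>2) * (W u * (b u)\<^sup>2) + (W t * (c t)\<^sup>2) * (W u * (d u)\<^sup>2))" for t u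
  proof -
    have "W t * W u * (a t * b u - c t * d u)\<^sup>2 \<le> W t * W u * (2 * ((a t * b u)\<^sup>2 + (c t * d u)\<^sup>2))"
      using W by (intro mult_left_mono sq) auto
    then show ?thesis by (simp add: power_mult_distrib algebra_simps)
  qed
  then have "(\<Sum>t\<in>T. \<Sum>u\<in>T. W t * W u * (a t * b u - c t * d u)\<^sup>2) \<le>
     (\<Sum>t\<in>T. \<Sum>u\<in>T. 2 * ((W t * (a t)\<^sup>2) * (W u * (b u)\<^sup>2) + (W t * (c t)\<^sup>2) * (W u * (d u)\<^sup>2)))"
    by (intro sum_mono)
  then show ?thesis
    by (simp only: sum_distrib_left[symmetric] sum_distrib_right[symmetric] sum.distrib)
qed

context deletion
begin

definition tilt2 :: "nat \<Rightarrow> nat \<Rightarrow> real" where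
  "tilt2 n K = exp (\<bar>real K - 4 * real n * (1 - q)\<bar> / sqrt n)"

text \<open>The tilt of the whole is at most the product over the two sides; \<open>exp 2\<close>
  pays for the two bits of the defect.\<close>

lemma tilt2_le:
  assumes n: "n \<ge> 1" and j: "j + 2 \<le> K"
  shows "tilt2 n K \<le> exp 2 * (tilt n j * tilt n (K - 2 - j))"
proof -
  have sn: "1 \<le> sqrt n" using n by simp
  have "real (K - 2 - j) = real K - 2 - real j" using j by simp
  then have "\<bar>real K - 4 * real n * (1 - q)\<bar> \<le>
     2 + (\<bar>real j - 2 * real n * (1 - q)\<bar> + \<bar>real (K - 2 - j) - 2 * real n * (1 - q)\<bar>)"
    by linarith
  then have "\<bar>real K - 4 * real n * (1 - q)\<bar> / sqrt n \<le>
     (2 + (\<bar>real j - 2 * real n * (1 - q)\<bar> + \<bar>real (K - 2 - j) - 2 * real n * (1 - q)\<bar>)) / sqrt n"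
    using sn by (intro divide_right_mono) auto
  also have "\<dots> \<le> 2 + (\<bar>real j - 2 * real n * (1 - q)\<bar> / sqrt n + \<bar>real (K - 2 - j) - 2 * real n * (1 - q)\<bar> / sqrt n)"
    unfolding add_divide_distrib using divide_left_mono[OF sn, of 2] sn by simp
  finally show ?thesis
    unfolding tilt2_def tilt_def exp_add[symmetric] by simp
qed

text \<open>72 is 10 * 4 for the diagonal and near pairs plus 2 * 4 * 4 for the far pairs, where one
  factor 4 is from \<open>K \<le> 4 * n\<close> and the others are from the double sums in
  \<open>sum_tilt_sqr\<close>.\<close>

definition l2_const :: real where
  "l2_const = exp 2 * 72 * \<kappa> * sqr_const\<^sup>2"

lemma l2_const_pos: "l2_const > 0"
  using \<kappa>_pos sqr_const_pos by (simp add: l2_const_def)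

lemma sum_tilt_sqr:
  assumes n: "n = Suc m" "n \<ge> 100"
  shows "(\<Sum>K\<le>4 * n. tilt2 n K * (\<Sum>s\<in>strs K. (\<Sum>j<K - 1. trm m s j)\<^sup>2 / wt s)) \<le> l2_const / n\<^sup>2"
proof -
  define T where "T = strs_le (4 * n)"
  have T: "finite T" by (simp add: T_def)
  define W where "W t = wt t * tilt n (length t)" for t
  have W: "0 \<le> W t" for t using wt_pos[of t] by (simp add: W_def tilt_def)
  define C where "C = sqr_const"
  have C: "0 < C" using sqr_const_pos by (simp add: C_def)
  have n0: "0 < real n" using n by simp
  define DD where "DD a b = (\<Sum>t\<in>strs a. \<Sum>u\<in>strs b. wt t * wt u * (Del m t u)\<^sup>2)" for a b
  have DD: "0 \<le> DD a b" for a b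
    unfolding DD_def using wt_pos by (intro sum_nonneg mult_nonneg_nonneg) (auto simp: less_imp_le)
  have t0: "0 \<le> tilt n k" for k by (simp add: tilt_def)
  have conv: "(\<Sum>a\<le>4 * n. \<Sum>b\<le>4 * n. tilt n a * tilt n b * (\<Sum>t\<in>strs a. \<Sum>u\<in>strs b. wt t * wt u * g t u)) =
      (\<Sum>t\<in>T. \<Sum>u\<in>T. W t * W u * g t u)" for g
  proof -
    have "(\<Sum>a\<le>4 * n. \<Sum>b\<le>4 * n. tilt n a * tilt n b * (\<Sum>t\<in>strs a. \<Sum>u\<in>strs b. wt t * wt u * g t u)) =
      (\<Sum>a\<le>4 * n. \<Sum>b\<le>4 * n. \<Sum>t\<in>strs a. \<Sum>u\<in>strs b. W t * W u * g t u)"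
      unfolding sum_distrib_left by (intro sum.cong refl) (simp add: W_def length_strs)
    also have "\<dots> = (\<Sum>a\<le>4 * n. \<Sum>t\<in>strs a. \<Sum>b\<le>4 * n. \<Sum>u\<in>strs b. W t * W u * g t u)"
      by (intro sum.cong refl sum.swap)
    finally show ?thesis by (simp only: T_def sum_strs_le)
  qed
  let ?A = "\<Sum>t\<in>T. W t * (bin (Suc m + rises t) (length t))\<^sup>2"
  let ?B = "\<Sum>t\<in>T. W t * (bin1 (m + rises t) (length t))\<^sup>2"
  let ?B' = "\<Sum>t\<in>T. W t * (bin1 (Suc m + rises t) (length t))\<^sup>2"
  let ?D = "\<Sum>t\<in>T. W t * (bin2 (m + rises t) (length t))\<^sup>2"
  have S: "?A \<le> C / sqrt n" "?B \<le> C / sqrt n / n" "?B' \<le> C / sqrt n / n" "?D \<le> C / sqrt n / n\<^sup>2"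
    unfolding W_def C_def by (rule sum_bin_sqr[OF n T])+
  have Snn: "0 \<le> ?A" "0 \<le> ?B" "0 \<le> ?B'" "0 \<le> ?D"
    using W by (auto intro!: sum_nonneg)
  have nn: "sqrt n * sqrt n = n" by simp
  have sumDD: "(\<Sum>a\<le>4 * n. \<Sum>b\<le>4 * n. tilt n a * tilt n b * DD a b) \<le> 4 * C\<^sup>2 / n\<^sup>2"
  proof -
    have "(\<Sum>a\<le>4 * n. \<Sum>b\<le>4 * n. tilt n a * tilt n b * DD a b) = (\<Sum>t\<in>T. \<Sum>u\<in>T. W t * W u * (Del m t u)\<^sup>2)"
      unfolding DD_def conv ..
    also have "\<dots> = (\<Sum>t\<in>T. \<Sum>u\<in>T. W t * W u * (bin (Suc m + rises t) (length t) * bin1 (m + rises u) (length u)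
        - bin1 (m + rises t) (length t) * bin (Suc m + rises u) (length u))\<^sup>2)"
      by (simp add: Del_def bin1_def algebra_simps)
    also have "\<dots> \<le> 2 * (?A * ?B + ?B * ?A)"
      by (rule sum_sqr_diff_prod_le[OF W])
    also have "\<dots> \<le> 2 * (C / sqrt n * (C / sqrt n / n) + C / sqrt n / n * (C / sqrt n))"
      using S Snn C by (intro mult_left_mono add_mono mult_mono) auto
    also have "\<dots> = 4 * C\<^sup>2 / n\<^sup>2"
      by (simp add: power2_eq_square nn)
    finally show ?thesis .
  qed
  have sumPsi_sum: "(\<Sum>a\<le>4 * n. \<Sum>b\<le>4 * n. tilt n a * tilt n b * Psi_sum m a b) \<le> 4 * C\<^sup>2 / n ^ 3"
  proof -
    have "(\<Sum>a\<le>4 * n. \<Sum>b\<le>4 * n. tilt n a * tilt n b * Psi_sum m a b) = (\<Sum>t\<in>T. \<Sum>u\<in>T. W t * W u * Psi m t u)"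
      unfolding Psi_sum_def conv ..
    also have "\<dots> \<le> 2 * (?A * ?D + ?B * ?B')"
      unfolding Psi_def by (rule sum_sqr_diff_prod_le[OF W])
    also have "\<dots> \<le> 2 * (C / sqrt n * (C / sqrt n / n\<^sup>2) + C / sqrt n / n * (C / sqrt n / n))"
      using S Snn C by (intro mult_left_mono add_mono mult_mono) auto
    also have "\<dots> = 4 * C\<^sup>2 / n ^ 3"
      by (simp add: power2_eq_square power3_eq_cube nn)
    finally show ?thesis .
  qed
  have inner: "tilt2 n K * (\<Sum>s\<in>strs K. (\<Sum>j<K - 1. trm m s j)\<^sup>2 / wt s) \<le>
     10 * \<kappa> * exp 2 * (\<Sum>j<K - 1. tilt n j * tilt n (K - 2 - j) * DD j (K - 2 - j)) +
     2 * \<kappa> * (4 * n) * exp 2 * (\<Sum>j<K - 1. tilt n j * tilt n (K - 2 - j) * Psi_sum m j (K - 2 - j))"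
    if K: "K \<le> 4 * n" for K
  proof -
    have "tilt2 n K * (\<Sum>s\<in>strs K. (\<Sum>j<K - 1. trm m s j)\<^sup>2 / wt s) \<le>
      tilt2 n K * (10 * \<kappa> * (\<Sum>j<K - 1. DD j (K - 2 - j)) + 2 * \<kappa> * K * (\<Sum>j<K - 1. Psi_sum m j (K - 2 - j)))"
      unfolding DD_def by (intro mult_left_mono sum_sqr_strs) (simp add: tilt2_def)
    also have "\<dots> = 10 * \<kappa> * (\<Sum>j<K - 1. tilt2 n K * DD j (K - 2 - j)) +
       2 * \<kappa> * K * (\<Sum>j<K - 1. tilt2 n K * Psi_sum m j (K - 2 - j))"
      by (simp add: sum_distrib_left[symmetric] algebra_simps)
    also have "\<dots> \<le> 10 * \<kappa> * (\<Sum>j<K - 1. exp 2 * (tilt n j * tilt n (K - 2 - j)) * DD j (K - 2 - j)) +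
       2 * \<kappa> * (4 * n) * (\<Sum>j<K - 1. exp 2 * (tilt n j * tilt n (K - 2 - j)) * Psi_sum m j (K - 2 - j))"
      using \<kappa>_pos K n DD Psi_sum_nonneg t0
      by (intro add_mono mult_mono sum_mono tilt2_le sum_nonneg mult_right_mono)
        (auto simp: tilt2_def)
    also have "\<dots> = 10 * \<kappa> * exp 2 * (\<Sum>j<K - 1. tilt n j * tilt n (K - 2 - j) * DD j (K - 2 - j)) +
     2 * \<kappa> * (4 * n) * exp 2 * (\<Sum>j<K - 1. tilt n j * tilt n (K - 2 - j) * Psi_sum m j (K - 2 - j))"
      by (simp only: sum_distrib_left[symmetric] mult.assoc)
    finally show ?thesis .
  qed
  have "(\<Sum>K\<le>4 * n. tilt2 n K * (\<Sum>s\<in>strs K. (\<Sum>j<K - 1. trm m s j)\<^sup>2 / wt s)) \<le>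
     10 * \<kappa> * exp 2 * (\<Sum>K\<le>4 * n. \<Sum>j<K - 1. tilt n j * tilt n (K - 2 - j) * DD j (K - 2 - j)) +
     2 * \<kappa> * (4 * n) * exp 2 * (\<Sum>K\<le>4 * n. \<Sum>j<K - 1. tilt n j * tilt n (K - 2 - j) * Psi_sum m j (K - 2 - j))"
    (is "_ \<le> ?c1 * sum ?f _ + ?c2 * sum ?g _")
  proof -
    have "(\<Sum>K\<le>4 * n. tilt2 n K * (\<Sum>s\<in>strs K. (\<Sum>j<K - 1. trm m s j)\<^sup>2 / wt s)) \<le>
        (\<Sum>K\<le>4 * n. ?c1 * ?f K + ?c2 * ?g K)"
      by (intro sum_mono inner) (simp only: atMost_iff)
    then show ?thesis by (simp only: sum.distrib sum_distrib_left[symmetric])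
  qed
  also have "\<dots> \<le> 10 * \<kappa> * exp 2 * (4 * C\<^sup>2 / n\<^sup>2) + 2 * \<kappa> * (4 * n) * exp 2 * (4 * C\<^sup>2 / n ^ 3)"
    using \<kappa>_pos t0 DD Psi_sum_nonneg
    by (intro add_mono mult_left_mono order_trans[OF sum_triangle_le sumDD] order_trans[OF sum_triangle_le sumPsi_sum])
      auto
  also have "\<dots> = l2_const / n\<^sup>2"
    using n0 by (simp add: l2_const_def C_def power2_eq_square power3_eq_cube)
  finally show ?thesis .
qed

end

section \<open>The flip statistic\<close>

text \<open>The position \<open>k\<close> and the previous bit \<open>b\<close> are carried along so
  that the statistic of a suffix is the same function with other arguments.\<close>

fun flips :: "real \<Rightarrow> (nat \<Rightarrow> real) \<Rightarrow> nat \<Rightarrow> bool \<Rightarrow> bool list \<Rightarrow> real" where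
  "flips \<theta> g k b [] = 0"
| "flips \<theta> g k b (c # s) = g k * (of_bool (c \<noteq> b) - \<theta>) + flips \<theta> g (Suc k) c s"

lemma flips_append:
  "flips \<theta> g k b (s @ u) = flips \<theta> g k b s + flips \<theta> g (k + length s) (last (b # s)) u"
  by (induction s arbitrary: k b) auto

lemma sum_geometric_le:
  fixes r :: real
  assumes "0 \<le> r" "r < 1"
  shows "(\<Sum>i<k. r ^ i) \<le> 1 / (1 - r)"
  using assms by (simp add: sum_gp_strict divide_right_mono)

text \<open>There is a geometric series on either side of \<open>c\<close>, with ratio exp (-1/S)
  and sum at most 2 S.\<close>

lemma sum_exp_abs_le:
  fixes c S :: real
  assumes c: "0 \<le> c" and S: "1 \<le> S"
  shows "(\<Sum>K\<le>N. exp (- (\<bar>real K - c\<bar> / S))) \<le> 4 * S"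
proof -
  define r where "r = exp (- (1 / S))"
  define c0 where "c0 = nat \<lfloor>c\<rfloor>"
  have c0: "real c0 \<le> c" "c < real c0 + 1" using c by (auto simp: c0_def)
  have r: "0 < r" "r < 1" using S by (auto simp: r_def)
  have "r \<le> 1 / (1 + 1 / S)"
    using exp_ge_add_one_self[of "1 / S"] S unfolding r_def exp_minus
    by (simp add: inverse_eq_divide frac_le add_pos_pos)
  also have "\<dots> \<le> 1 - 1 / (2 * S)"
    using S by (simp add: field_simps)
  finally have "1 / (2 * S) \<le> 1 - r" by simp
  then have geo: "1 / (1 - r) \<le> 2 * S"
    using S r by (simp add: field_simps)
  have pw: "exp (- (\<bar>real K - c\<bar> / S)) \<le> r ^ j" if "real j \<le> \<bar>real K - c\<bar>" for K j :: nat
  proof -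
    have "real j / S \<le> \<bar>real K - c\<bar> / S" using that S by (intro divide_right_mono) auto
    then show ?thesis by (simp add: r_def exp_of_nat_mult[symmetric])
  qed
  have "(\<Sum>K\<le>N. exp (- (\<bar>real K - c\<bar> / S))) \<le>
      (\<Sum>K\<in>{..c0} \<union> {Suc c0..<Suc c0 + N}. exp (- (\<bar>real K - c\<bar> / S)))"
    by (intro sum_mono2) auto
  also have "\<dots> = (\<Sum>K\<le>c0. exp (- (\<bar>real K - c\<bar> / S))) + (\<Sum>K\<in>{Suc c0..<Suc c0 + N}. exp (- (\<bar>real K - c\<bar> / S)))"
    by (intro sum.union_disjoint) auto
  also have "(\<Sum>K\<le>c0. exp (- (\<bar>real K - c\<bar> / S))) \<le> (\<Sum>K\<le>c0. r ^ (c0 - K))"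
    using c0 by (intro sum_mono pw) (auto simp: of_nat_diff)
  also have "(\<Sum>K\<le>c0. r ^ (c0 - K)) = (\<Sum>i<Suc c0. r ^ i)"
    using sum.nat_diff_reindex[of "\<lambda>i. r ^ i" "Suc c0"] by (simp add: lessThan_Suc_atMost)
  also have "\<dots> \<le> 2 * S"
    using sum_geometric_le[of r "Suc c0"] r geo by simp
  also have "(\<Sum>K\<in>{Suc c0..<Suc c0 + N}. exp (- (\<bar>real K - c\<bar> / S))) =
      (\<Sum>i<N. exp (- (\<bar>real (Suc c0 + i) - c\<bar> / S)))"
    by (rule sum.reindex_bij_witness[of _ "\<lambda>i. Suc c0 + i" "\<lambda>K. K - Suc c0"]) auto
  also have "\<dots> \<le> (\<Sum>i<N. r ^ i)"
    using c0 by (intro sum_mono pw) auto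
  also have "\<dots> \<le> 2 * S"
    using sum_geometric_le[of r N] r geo by simp
  finally show ?thesis by simp
qed

section \<open>The Markov measure, moments of the statistic, and Cauchy-Schwarz\<close>

context deletion
begin

text \<open>A Doob transform: the function of the last bit is harmonic for the transition weights of
  \<open>wt\<close>, so they become probabilities. The empty string counts as ending in 1.\<close>

definition mu :: "bool list \<Rightarrow> real" where
  "mu s = wt s * (if last (True # s) then 1 else 1 / q)"

lemma wt_le_mu: "wt s \<le> mu s"
  using wt_pos[of s] q_pos q_less_1 by (auto simp: mu_def field_simps mult_left_le)

lemma mu_nonneg: "0 \<le> mu s"
  using wt_le_mu[of s] wt_pos[of s] by simp

text \<open>Under \<^const>\<open>mu\<close> the flips, counted from a virtual initial one, are independent of
  probability \<open>1 / (1 + q)\<close>.\<close>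

lemma sum_mu_Suc:
  "(\<Sum>s\<in>strs (Suc k). mu s * F s) = (\<Sum>s\<in>strs k. mu s *
     (1 / (1 + q) * F (s @ [\<not> last (True # s)]) + (1 - 1 / (1 + q)) * F (s @ [last (True # s)])))"
proof -
  have s1: "strs (Suc 0) = {[True], [False]}"
    by (auto simp: strs_def length_Suc_conv)
  have q1: "1 - 1 / (1 + q) = q / (1 + q)" using q_pos by (simp add: field_simps)
  have "mu (s @ [True]) * F (s @ [True]) + mu (s @ [False]) * F (s @ [False]) =
      mu s * (1 / (1 + q) * F (s @ [\<not> last (True # s)]) + q / (1 + q) * F (s @ [last (True # s)]))" for s
  proof (cases "last (True # s)")
    case True
    then have "\<not> (s \<noteq> [] \<and> \<not> last s)" by (simp split: if_splits)
    then have "mu (s @ [True]) = mu s * (q / (1 + q))" "mu (s @ [False]) = mu s * (1 / (1 + q))"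
      using True q_pos by (auto simp: mu_def wt_snoc)
    then show ?thesis using True by (simp add: algebra_simps)
  next
    case False
    then have "s \<noteq> []" "\<not> last s" by (auto split: if_splits)
    then have "mu (s @ [True]) = mu s * (1 / (1 + q))" "mu (s @ [False]) = mu s * (q / (1 + q))"
      using q_pos by (auto simp: mu_def wt_snoc power2_eq_square)
    then show ?thesis using False by (simp add: algebra_simps)
  qed
  then show ?thesis
    using sum_strs_append[of "\<lambda>s. mu s * F s" k "Suc 0"] by (simp add: s1 q1)
qed

definition stat :: "(nat \<Rightarrow> real) \<Rightarrow> bool list \<Rightarrow> real" where
  "stat g s = flips (1 / (1 + q)) g 0 True s"

lemma stat_snoc:
  "stat g (s @ [c]) = stat g s + g (length s) * (of_bool (c \<noteq> last (True # s)) - 1 / (1 + q))"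
  by (simp add: stat_def flips_append)

lemma sum_mu: "(\<Sum>s\<in>strs k. mu s) = 1"
proof (induction k)
  case 0
  have "strs 0 = {[]}" by (auto simp: strs_def)
  then show ?case by (simp add: mu_def wt_def)
next
  case (Suc k)
  then show ?case using sum_mu_Suc[of "\<lambda>_. 1" k] by simp
qed

text \<open>\<open>stat\<close> is a sum of independent centred terms. The bound on the fourth
  moment has a form that reproduces itself when a square is added to \<open>V\<close>.\<close>

lemma stat_moments:
  fixes g :: "nat \<Rightarrow> real"
  assumes g: "\<And>j. \<bar>g j\<bar> \<le> 1"
  defines "V \<equiv> \<lambda>k. \<Sum>j<k. (g j)\<^sup>2"
  shows "(\<Sum>s\<in>strs k. mu s * stat g s) = 0"
    and "(\<Sum>s\<in>strs k. mu s * (stat g s)\<^sup>2) \<le> V k"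
    and "(\<Sum>s\<in>strs k. mu s * (stat g s) ^ 4) \<le> 3 * (V k)\<^sup>2 + V k"
proof -
  define \<theta> where "\<theta> = 1 / (1 + q)"
  have th: "0 \<le> \<theta>" "\<theta> \<le> 1" using q_pos by (auto simp: \<theta>_def)
  have step: "(\<Sum>s\<in>strs (Suc k). mu s * f (stat g s)) =
    (\<Sum>s\<in>strs k. mu s * (\<theta> * f (stat g s + g k * (1 - \<theta>)) + (1 - \<theta>) * f (stat g s - g k * \<theta>)))" for f k
    unfolding sum_mu_Suc by (intro sum.cong refl) (simp add: stat_snoc length_strs \<theta>_def)
  have st0: "strs 0 = {[]}" by (auto simp: strs_def)
  have mean: "(\<Sum>s\<in>strs k. mu s * stat g s) = 0" for k
  proof (induction k)
    case (Suc k)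
    have "\<theta> * (x + g k * (1 - \<theta>)) + (1 - \<theta>) * (x - g k * \<theta>) = x" for x
      by (simp add: algebra_simps)
    then show ?case using step[of "\<lambda>x. x" k] Suc by simp
  qed (simp add: st0 stat_def)
  then show "(\<Sum>s\<in>strs k. mu s * stat g s) = 0" .
  \<comment> \<open>Central moments of a Bernoulli variable with parameter \<open>\<theta>\<close>;
    in the fourth moment the third one multiplies the mean of \<open>stat\<close>, which
    vanishes.\<close>
  define m2 where "m2 = \<theta> * (1 - \<theta>)"
  define m3 where "m3 = \<theta> * (1 - \<theta>) ^ 3 - (1 - \<theta>) * \<theta> ^ 3"
  define m4 where "m4 = \<theta> * (1 - \<theta>) ^ 4 + (1 - \<theta>) * \<theta> ^ 4"
  have m2: "0 \<le> m2" "m2 \<le> 1" using th by (auto simp: m2_def mult_le_one)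
  have m4: "0 \<le> m4" "m4 \<le> 1"
  proof -
    have "\<theta> * (1 - \<theta>) ^ 4 + (1 - \<theta>) * \<theta> ^ 4 \<le> \<theta> * 1 + (1 - \<theta>) * 1"
      using th by (intro add_mono mult_left_mono power_le_one) auto
    then show "m4 \<le> 1" by (simp add: m4_def)
    show "0 \<le> m4" using th by (simp add: m4_def)
  qed
  have g2: "(g k)\<^sup>2 \<le> 1" for k using g[of k] by (simp add: abs_square_le_1)
  have var: "(\<Sum>s\<in>strs k. mu s * (stat g s)\<^sup>2) \<le> V k" for k
  proof (induction k)
    case (Suc k)
    have "\<theta> * (x + g k * (1 - \<theta>))\<^sup>2 + (1 - \<theta>) * (x - g k * \<theta>)\<^sup>2 = x\<^sup>2 + (g k)\<^sup>2 * m2" for x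
      by (simp add: m2_def power2_eq_square algebra_simps)
    then have "(\<Sum>s\<in>strs (Suc k). mu s * (stat g s)\<^sup>2) = (\<Sum>s\<in>strs k. mu s * (stat g s)\<^sup>2) + (g k)\<^sup>2 * m2"
      using step[of "\<lambda>x. x\<^sup>2" k]
      by (simp add: distrib_left sum.distrib sum_distrib_right[symmetric] sum_mu)
    also have "\<dots> \<le> V k + (g k)\<^sup>2 * 1"
      using Suc m2 by (intro add_mono mult_left_mono) auto
    finally show ?case by (simp add: V_def)
  qed (simp add: st0 stat_def V_def)
  then show "(\<Sum>s\<in>strs k. mu s * (stat g s)\<^sup>2) \<le> V k" .
  show "(\<Sum>s\<in>strs k. mu s * (stat g s) ^ 4) \<le> 3 * (V k)\<^sup>2 + V k"
  proof (induction k)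
    case (Suc k)
    have "\<theta> * (x + g k * (1 - \<theta>)) ^ 4 + (1 - \<theta>) * (x - g k * \<theta>) ^ 4 =
       x ^ 4 + x\<^sup>2 * (6 * (g k)\<^sup>2 * m2) + x * (4 * (g k) ^ 3 * m3) + (g k) ^ 4 * m4" for x
      by (simp add: m2_def m3_def m4_def power2_eq_square power3_eq_cube power4_eq_xxxx algebra_simps)
    then have "(\<Sum>s\<in>strs (Suc k). mu s * (stat g s) ^ 4) =
       (\<Sum>s\<in>strs k. mu s * (stat g s) ^ 4 + mu s * (stat g s)\<^sup>2 * (6 * (g k)\<^sup>2 * m2)
         + mu s * stat g s * (4 * (g k) ^ 3 * m3) + mu s * ((g k) ^ 4 * m4))"
      using step[of "\<lambda>x. x ^ 4" k] by (simp add: distrib_left mult.assoc)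
    also have "\<dots> = (\<Sum>s\<in>strs k. mu s * (stat g s) ^ 4) + (\<Sum>s\<in>strs k. mu s * (stat g s)\<^sup>2) * (6 * (g k)\<^sup>2 * m2)
         + (g k) ^ 4 * m4"
      by (simp only: sum.distrib sum_distrib_right[symmetric] mean sum_mu mult_zero_left add_0_right mult_1)
    also have "\<dots> \<le> (3 * (V k)\<^sup>2 + V k) + V k * (6 * (g k)\<^sup>2 * 1) + (g k)\<^sup>2 * 1"
    proof (intro add_mono mult_mono mult_left_mono var Suc m2 m4)
      have "(g k) ^ 4 = (g k)\<^sup>2 * (g k)\<^sup>2" by (simp flip: power_add)
      also have "\<dots> \<le> (g k)\<^sup>2" by (rule mult_left_le[OF g2]) simp
      finally show "(g k) ^ 4 \<le> (g k)\<^sup>2" .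
    qed (use m2 m4 in \<open>auto simp: V_def intro!: sum_nonneg\<close>)
    also have "\<dots> \<le> 3 * (V k + (g k)\<^sup>2)\<^sup>2 + (V k + (g k)\<^sup>2)"
      using zero_le_square[of "g k * g k"] by (simp add: power2_eq_square algebra_simps)
    finally show ?case by (simp add: V_def)
  qed (simp add: st0 stat_def V_def)
qed

definition trm_sum :: "nat \<Rightarrow> bool list \<Rightarrow> real" where
  "trm_sum m s = (\<Sum>j<length s - 1. trm m s j)"

text \<open>Cauchy-Schwarz with density \<open>tilt2\<close> over \<open>wt\<close>: one factor is
  the second moment of the difference, and in the other the tilt now restricts the lengths.\<close>

lemma sum_trm_mult_le:
  assumes n: "n = Suc m" "n \<ge> 100"
  shows "(\<Sum>s\<in>strs_le (4 * n). \<bar>trm_sum m s\<bar> * \<bar>F s\<bar>) \<le>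
    sqrt l2_const / n * sqrt (\<Sum>K\<le>4 * n. (\<Sum>s\<in>strs K. wt s * (F s)\<^sup>2) / tilt2 n K)"
proof -
  have tp: "0 < tilt2 n K" for K by (simp add: tilt2_def)
  define w where "w s = sqrt (tilt2 n (length s) / wt s)" for s
  have w: "0 < w s" for s using tp wt_pos by (simp add: w_def)
  have w2: "(w s)\<^sup>2 = tilt2 n (length s) / wt s" for s
    using tp wt_pos by (simp add: w_def less_imp_le)
  have "(\<Sum>s\<in>strs_le (4 * n). \<bar>trm_sum m s\<bar> * \<bar>F s\<bar>) =
      (\<Sum>s\<in>strs_le (4 * n). \<bar>trm_sum m s * w s\<bar> * \<bar>F s / w s\<bar>)"
    using w[THEN less_imp_neq, THEN not_sym] by (intro sum.cong refl) (simp add: abs_mult)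
  also have "\<dots> \<le> L2_set (\<lambda>s. trm_sum m s * w s) (strs_le (4 * n)) * L2_set (\<lambda>s. F s / w s) (strs_le (4 * n))"
    by (rule L2_set_mult_ineq)
  also have "L2_set (\<lambda>s. trm_sum m s * w s) (strs_le (4 * n)) =
      sqrt (\<Sum>K\<le>4 * n. tilt2 n K * (\<Sum>s\<in>strs K. (\<Sum>j<K - 1. trm m s j)\<^sup>2 / wt s))"
    unfolding L2_set_def sum_strs_le sum_distrib_left
    by (intro arg_cong[of _ _ sqrt] sum.cong refl)
      (simp add: power_mult_distrib w2 trm_sum_def length_strs)
  also have "\<dots> \<le> sqrt (l2_const / n\<^sup>2)"
    by (intro real_sqrt_le_mono sum_tilt_sqr n)
  also have "sqrt (l2_const / n\<^sup>2) = sqrt l2_const / n"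
    by (simp add: real_sqrt_divide)
  also have "L2_set (\<lambda>s. F s / w s) (strs_le (4 * n)) =
      sqrt (\<Sum>K\<le>4 * n. (\<Sum>s\<in>strs K. wt s * (F s)\<^sup>2) / tilt2 n K)"
    unfolding L2_set_def sum_strs_le sum_divide_distrib
    by (intro arg_cong[of _ _ sqrt] sum.cong refl)
      (simp add: power_divide w2 length_strs mult.commute)
  finally show ?thesis
    by (simp add: L2_set_nonneg mult_right_mono sum_nonneg)
qed

lemma sum_inverse_tilt2:
  assumes "n \<ge> 1"
  shows "(\<Sum>K\<le>N. 1 / tilt2 n K) \<le> 4 * sqrt n"
proof -
  have "(\<Sum>K\<le>N. 1 / tilt2 n K) = (\<Sum>K\<le>N. exp (- (\<bar>real K - 4 * real n * (1 - q)\<bar> / sqrt n)))"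
    by (simp add: tilt2_def exp_minus inverse_eq_divide)
  also have "\<dots> \<le> 4 * sqrt n"
    using assms q_less_1 by (intro sum_exp_abs_le) auto
  finally show ?thesis .
qed

text \<open>On each length \<open>wt\<close> is dominated by the probability measure
  \<open>mu\<close>, so only the summable reciprocal tilt counts the lengths.\<close>

lemma sum_wt_div_tilt2:
  assumes n: "n \<ge> 1" and F: "\<And>K. (\<Sum>s\<in>strs K. mu s * (F s)\<^sup>2) \<le> B"
  shows "(\<Sum>K\<le>N. (\<Sum>s\<in>strs K. wt s * (F s)\<^sup>2) / tilt2 n K) \<le> 4 * B * sqrt n"
proof -
  have "(\<Sum>K\<le>N. (\<Sum>s\<in>strs K. wt s * (F s)\<^sup>2) / tilt2 n K) \<le> (\<Sum>K\<le>N. B / tilt2 n K)"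
  proof (intro sum_mono divide_right_mono)
    fix K
    have "(\<Sum>s\<in>strs K. wt s * (F s)\<^sup>2) \<le> (\<Sum>s\<in>strs K. mu s * (F s)\<^sup>2)"
      by (intro sum_mono mult_right_mono wt_le_mu) simp
    also note F
    finally show "(\<Sum>s\<in>strs K. wt s * (F s)\<^sup>2) \<le> B" .
  qed (simp add: tilt2_def)
  also have "\<dots> = B * (\<Sum>K\<le>N. 1 / tilt2 n K)"
    by (simp add: sum_distrib_left)
  also have "\<dots> \<le> B * (4 * sqrt n)"
  proof (intro mult_left_mono sum_inverse_tilt2 n)
    have "0 \<le> (\<Sum>s\<in>strs 0. mu s * (F s)\<^sup>2)" using mu_nonneg by (intro sum_nonneg) auto
    then show "0 \<le> B" using F[of 0] by simp
  qed
  finally show ?thesis by simp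
qed

lemma sum_abs_trm_le:
  assumes n: "n = Suc m" "n \<ge> 100"
  shows "(\<Sum>s\<in>strs_le (4 * n). \<bar>trm_sum m s\<bar>) \<le> 2 * sqrt l2_const * n powr (- (3 / 4))"
proof -
  have n0: "0 < real n" using n by simp
  have "(\<Sum>s\<in>strs_le (4 * n). \<bar>trm_sum m s\<bar>) \<le> sqrt l2_const / n * sqrt (4 * 1 * sqrt n)"
    using l2_const_pos n sum_trm_mult_le[OF n, of "\<lambda>_. 1"]
    by (intro order_trans[OF _ mult_left_mono[OF real_sqrt_le_mono[OF sum_wt_div_tilt2[of n "\<lambda>_. 1" 1 "4 * n"]]]])
      (auto simp: sum_mu)
  also have "\<dots> = 2 * sqrt l2_const * (sqrt (sqrt n) / n)"
    by (simp add: real_sqrt_mult)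
  also have "sqrt (sqrt n) / n = n powr (- (3 / 4))"
    using n0 powr_diff[of "real n" "1 / 4" 1] by (simp add: powr_half_sqrt[symmetric] powr_powr)
  finally show ?thesis .
qed

lemma sum_abs_trm_stat_le:
  assumes n: "n = Suc m" "n \<ge> 100" and A: "1 \<le> A"
    and g: "\<And>j. \<bar>g j\<bar> \<le> 1" "\<And>k. (\<Sum>j<k. (g j)\<^sup>2) \<le> A * sqrt n"
  shows "(\<Sum>s\<in>strs_le (4 * n). \<bar>trm_sum m s\<bar> * (stat g s)\<^sup>2) \<le> 4 * A * sqrt l2_const * n powr (- (1 / 4))"
proof -
  have n0: "0 < real n" using n by simp
  have sn: "1 \<le> sqrt n" using n by simp
  have B: "(\<Sum>s\<in>strs K. mu s * ((stat g s)\<^sup>2)\<^sup>2) \<le> 4 * A\<^sup>2 * n" for K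
  proof -
    define V where "V = (\<Sum>j<K. (g j)\<^sup>2)"
    have V: "0 \<le> V" "V \<le> A * sqrt n" using g(2)[of K] by (auto simp: V_def intro: sum_nonneg)
    have As: "1 \<le> A * sqrt n" using mult_mono[of 1 A 1 "sqrt n"] A sn by simp
    have "(\<Sum>s\<in>strs K. mu s * ((stat g s)\<^sup>2)\<^sup>2) \<le> 3 * V\<^sup>2 + V"
      using stat_moments(3)[of g K, OF g(1)] by (simp add: V_def power_mult[symmetric])
    \<comment> \<open>The linear term is absorbed into the quadratic one, since
      \<open>A * sqrt n\<close> is at least 1.\<close>
    also have "\<dots> \<le> 3 * (A * sqrt n)\<^sup>2 + (A * sqrt n)\<^sup>2"
    proof (intro add_mono mult_left_mono power_mono)
      have "V \<le> A * sqrt n * 1" using V by simp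
      also have "\<dots> \<le> A * sqrt n * (A * sqrt n)" using As by (intro mult_left_mono) auto
      finally show "V \<le> (A * sqrt n)\<^sup>2" by (simp add: power2_eq_square)
    qed (use V in auto)
    also have "\<dots> = 4 * A\<^sup>2 * n" by (simp add: power_mult_distrib)
    finally show ?thesis .
  qed
  have "(\<Sum>s\<in>strs_le (4 * n). \<bar>trm_sum m s\<bar> * (stat g s)\<^sup>2) \<le> sqrt l2_const / n * sqrt (4 * (4 * A\<^sup>2 * n) * sqrt n)"
    using l2_const_pos n sum_trm_mult_le[OF n, of "\<lambda>s. (stat g s)\<^sup>2"]
    by (intro order_trans[OF _ mult_left_mono[OF real_sqrt_le_mono[OF sum_wt_div_tilt2[OF _ B]]]])
      auto
  also have "\<dots> = sqrt l2_const / n * (4 * A * (sqrt n * sqrt (sqrt n)))"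
    using A by (simp add: real_sqrt_mult)
  also have "\<dots> = 4 * A * sqrt l2_const * (sqrt n * sqrt (sqrt n) / n)"
    by simp
  also have "sqrt n * sqrt (sqrt n) / n = n powr (- (1 / 4))"
    using n0 powr_diff[of "real n" "3 / 4" 1]
    by (simp add: powr_half_sqrt[symmetric] powr_powr powr_add[symmetric])
  finally show ?thesis .
qed

end

section \<open>Signal of the flip statistic\<close>

lemma trace_exp_pair:
  assumes q: "0 \<le> q" "q \<le> 1"
  shows "trace_exp q [a, b] F =
    q\<^sup>2 * F [] + q * (1 - q) * F [a] + q * (1 - q) * F [b] + (1 - q)\<^sup>2 * F [a, b]"
proof -
  have 1: "trace_exp q [a] G = q * G [] + (1 - q) * G [a]" for G
    using trace_exp_snoc[OF q, of "[]" a G] by simp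
  have "trace_exp q [a, b] F = trace_exp q [a] (\<lambda>t. q * F t + (1 - q) * F (t @ [b]))"
    using trace_exp_snoc[OF q, of "[a]" b F] by simp
  then show ?thesis unfolding 1 by (simp add: power2_eq_square algebra_simps)
qed

lemma trace_exp_swap:
  assumes q: "0 \<le> q" "q \<le> 1"
  shows "trace_exp q (xs @ [True, False] @ ys) F - trace_exp q (xs @ [False, True] @ ys) F =
    (1 - q)\<^sup>2 * trace_exp q xs (\<lambda>t. trace_exp q ys (\<lambda>u. F (t @ [True, False] @ u) - F (t @ [False, True] @ u)))"
proof -
  have "trace_exp q ([True, False] @ ys) G - trace_exp q ([False, True] @ ys) G =
    (1 - q)\<^sup>2 * trace_exp q ys (\<lambda>u. G ([True, False] @ u) - G ([False, True] @ u))" for G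
    unfolding trace_exp_append[OF q] trace_exp_pair[OF q] trace_exp_diff
    by (simp add: algebra_simps)
  then show ?thesis
    unfolding trace_exp_append[OF q, of xs] trace_exp_diff[symmetric] trace_exp_cmult[symmetric]
    by simp
qed

lemma trace_exp_eq_sum:
  assumes "length xs \<le> N"
  shows "trace_exp q xs F = (\<Sum>s\<in>strs_le N. pmf (trace_law q xs) s * F s)"
proof -
  have "t \<in> strs_le N" if "t \<in> set_pmf (trace_law q xs)" for t
    using assms length_le_of_trace[OF that] by (simp add: strs_le_def)
  then show ?thesis
    unfolding trace_exp_def by (subst integral_measure_pmf[of "strs_le N"]) auto
qed

text \<open>The empty prefix ends in 1, in accordance with the virtual initial bit of
  \<open>stat\<close>.\<close>

definition last_sign :: "bool list \<Rightarrow> real" where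
  "last_sign t = (if last (True # t) then 1 else - 1)"

definition first_sign :: "bool list \<Rightarrow> real" where
  "first_sign u = (case u of [] \<Rightarrow> 0 | d # _ \<Rightarrow> if d then 1 else - 1)"

lemma first_sign_simps [simp]:
  "first_sign [] = 0" "first_sign (d # u) = (if d then 1 else - 1)"
  by (simp_all add: first_sign_def)

context deletion
begin

text \<open>Both pairs flip inside, so only the flips into and out of the pair change.\<close>

lemma stat_swap:
  "stat g (t @ [True, False] @ u) - stat g (t @ [False, True] @ u) =
     - (g (length t) * last_sign t) + g (length t + 2) * first_sign u"
  by (cases u) (auto simp: stat_def flips_append last_sign_def algebra_simps)

text \<open>The trace is empty with probability q^(2k); otherwise its first bit is 0 with
  probability 1/(1+q).\<close>

lemma trace_exp_first_sign:
  "trace_exp q (alt k) first_sign = - ((1 - q) / (1 + q) * (1 - (q\<^sup>2) ^ k))"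
proof (induction k)
  case 0
  then show ?case by (simp add: str_power_def)
next
  case (Suc k)
  define z where "z = 1 / (1 + q)"
  have z: "z * (1 + q) = 1" using q_pos by (simp add: z_def)
  have "trace_exp q (alt (Suc k)) first_sign = q\<^sup>2 * trace_exp q (alt k) first_sign - (1 - q)\<^sup>2"
    unfolding alt_Suc_Cons trace_exp_append[OF q_bounds] trace_exp_pair[OF q_bounds]
    by (simp add: trace_exp_const power2_eq_square algebra_simps)
  also have "\<dots> = - ((1 - q) * z * (1 - q\<^sup>2 * (q\<^sup>2) ^ k))"
  proof -
    have "(1 - q) * z * (1 - q\<^sup>2) = (1 - q) * ((1 - q) * (z * (1 + q)))"
      by (simp add: power2_eq_square algebra_simps)
    then have zz: "(1 - q)\<^sup>2 = (1 - q) * z * (1 - q\<^sup>2)" 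
      unfolding z by (simp only: power2_eq_square[of "1 - q"] mult_1_right)
    have dz: "(1 - q) / (1 + q) = (1 - q) * z" by (simp add: z_def)
    show ?thesis unfolding Suc zz dz by (simp add: algebra_simps)
  qed
  finally show ?case by (simp add: z_def)
qed

lemma trace_exp_length_sqr:
  fixes c :: real
  shows "trace_exp q (alt k) (\<lambda>t. (length t - c)\<^sup>2) =
    2 * real k * (1 - q) * q + (2 * real k * (1 - q) - c)\<^sup>2"
proof (induction k arbitrary: c)
  case 0
  then show ?case by (simp add: str_power_def)
next
  case (Suc k)
  have "trace_exp q (alt (Suc k)) (\<lambda>t. (length t - c)\<^sup>2) =
    q\<^sup>2 * trace_exp q (alt k) (\<lambda>t. (length t - c)\<^sup>2) +
    2 * q * (1 - q) * trace_exp q (alt k) (\<lambda>t. (length t - (c - 1))\<^sup>2) +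
    (1 - q)\<^sup>2 * trace_exp q (alt k) (\<lambda>t. (length t - (c - 2))\<^sup>2)"
    unfolding trace_exp_alt_Suc trace_exp_cmult[symmetric] trace_exp_add[symmetric]
    by (intro arg_cong[of _ _ "trace_exp q (alt k)"] ext) (simp add: algebra_simps)
  also have "\<dots> = 2 * real (Suc k) * (1 - q) * q + (2 * real (Suc k) * (1 - q) - c)\<^sup>2"
    unfolding Suc by (simp add: power2_eq_square algebra_simps)
  finally show ?case .
qed

text \<open>The defect is expected near 2 n (1 - q), the midpoint of the rising edge. The edge
  extends 10 sqrt n to either side, far enough for a Chebyshev bound, and has slope 1 / (20 sqrt
  n).\<close>

definition tent :: "nat \<Rightarrow> real \<Rightarrow> real" where
  "tent n x = max 0 (1 - \<bar>x - (2 * real n * (1 - q) + 10 * sqrt n)\<bar> / (20 * sqrt n))"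

lemma tent_bounds: "0 \<le> tent n x" "tent n x \<le> 1"
  by (simp_all add: tent_def)

lemma sum_tent_sqr:
  assumes "n \<ge> 1"
  shows "(\<Sum>j<k. (tent n (real j))\<^sup>2) \<le> 80 * sqrt n"
proof -
  let ?c = "2 * real n * (1 - q) + 10 * sqrt n"
  have "(tent n x)\<^sup>2 \<le> exp (- (\<bar>x - ?c\<bar> / (20 * sqrt n)))" for x
  proof -
    have "(tent n x)\<^sup>2 \<le> tent n x"
      using tent_bounds[of n x] by (simp add: power2_eq_square mult_left_le)
    also have "\<dots> \<le> exp (- (\<bar>x - ?c\<bar> / (20 * sqrt n)))"
      using exp_ge_add_one_self[of "- (\<bar>x - ?c\<bar> / (20 * sqrt n))"] by (auto simp: tent_def)
    finally show ?thesis .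
  qed
  then have "(\<Sum>j<k. (tent n (real j))\<^sup>2) \<le> (\<Sum>j\<le>k. exp (- (\<bar>real j - ?c\<bar> / (20 * sqrt n))))"
    by (intro order_trans[OF sum_mono[where g = "\<lambda>j. exp (- (\<bar>real j - ?c\<bar> / (20 * sqrt n)))"] sum_mono2]) auto
  also have "\<dots> \<le> 4 * (20 * sqrt n)"
  proof (rule sum_exp_abs_le)
    have "1 \<le> sqrt n" using assms by simp
    then show "1 \<le> 20 * sqrt n" by linarith
  qed (use q_less_1 in simp)
  finally show ?thesis by simp
qed

lemma tent_lipschitz:
  assumes "n \<ge> 1" "0 \<le> h"
  shows "tent n x - h / (20 * sqrt n) \<le> tent n (x + h)"
proof -
  let ?c = "2 * real n * (1 - q) + 10 * sqrt n"
  have "\<bar>x + h - ?c\<bar> / (20 * sqrt n) \<le> (\<bar>x - ?c\<bar> + h) / (20 * sqrt n)"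
    using assms by (intro divide_right_mono) auto
  then have "1 - \<bar>x - ?c\<bar> / (20 * sqrt n) - h / (20 * sqrt n) \<le> 1 - \<bar>x + h - ?c\<bar> / (20 * sqrt n)"
    by (simp add: add_divide_distrib)
  moreover have "0 \<le> h / (20 * sqrt n)" using assms by simp
  ultimately show ?thesis unfolding tent_def by (auto simp: max_def)
qed

text \<open>On the rising edge the mean increment over one block is twice \<open>1 - q\<close> times
  the slope, elsewhere at least the negative of this. The quadratic lies below both cases, so that a
  second moment will suffice. The -2 in \<open>\<rho>\<close> keeps a step of two bits on the
  edge.\<close>

lemma tent_increment:
  assumes n: "n \<ge> 100"
  defines "\<rho> \<equiv> 10 * sqrt n - 2"
  shows "2 * (1 - q) / (20 * sqrt n) * (1 - 2 * (x - 2 * real n * (1 - q))\<^sup>2 / \<rho>\<^sup>2) \<le>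
    q\<^sup>2 * tent n x + q * (1 - q) * tent n (x + 1) + q * (1 - q) * tent n (x + 1)
      + (1 - q)\<^sup>2 * tent n (x + 2) - tent n x"
    (is "?L \<le> ?R")
proof -
  define \<sigma> where "\<sigma> = 1 / (20 * sqrt n)"
  define p where "p = 1 - q"
  define e where "e = 2 * real n * (1 - q)"
  have sn: "10 \<le> sqrt n" using n by (intro real_le_rsqrt) simp
  have s: "0 < \<sigma>" using sn n by (simp add: \<sigma>_def)
  have p: "0 < p" "q = 1 - p" "p < 1" using q_less_1 q_pos by (auto simp: p_def)
  have \<rho>: "0 < \<rho>" using sn by (simp add: \<rho>_def)
  have tot: "q\<^sup>2 * a + q * p * (a + h) + q * p * (a + h) + p\<^sup>2 * (a + 2 * h) - a = 2 * p * h" for a h :: real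
    unfolding p(2) by (simp add: power2_eq_square algebra_simps)
  have L: "?L = 2 * p * \<sigma> * (1 - 2 * (x - e)\<^sup>2 / \<rho>\<^sup>2)"
    by (simp add: p_def \<sigma>_def e_def)
  show ?thesis
  proof (cases "e - 10 * sqrt n \<le> x \<and> x \<le> e + 10 * sqrt n - 2")
    case True
    have t: "tent n y = \<sigma> * (y - e + 10 * sqrt n)" if "e - 10 * sqrt n \<le> y" "y \<le> e + 10 * sqrt n" for y
    proof -
      have "1 - \<bar>y - (e + 10 * sqrt n)\<bar> / (20 * sqrt n) = \<sigma> * (y - e + 10 * sqrt n)"
        using that n by (simp add: \<sigma>_def field_simps)
      moreover have "0 \<le> \<sigma> * (y - e + 10 * sqrt n)" using that s by simp
      ultimately show ?thesis by (simp add: tent_def e_def)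
    qed
    have "tent n (x + 1) = tent n x + \<sigma>" "tent n (x + 2) = tent n x + 2 * \<sigma>"
      using True by (auto simp: t algebra_simps)
    then have "?R = 2 * p * \<sigma>"
      using tot[of "tent n x" \<sigma>] by (simp add: p_def)
    moreover have "?L \<le> 2 * p * \<sigma> * 1"
      unfolding L using p s by (intro mult_left_mono) auto
    ultimately show ?thesis by simp
  next
    case False
    have "\<rho> \<le> \<bar>x - e\<bar>" using False by (auto simp: \<rho>_def)
    then have "\<rho>\<^sup>2 \<le> (x - e)\<^sup>2" using \<rho> by (simp add: abs_le_square_iff[symmetric])
    then have "1 \<le> (x - e)\<^sup>2 / \<rho>\<^sup>2" using \<rho> by simp
    then have "?L \<le> 2 * p * \<sigma> * (- 1)"
      unfolding L using p s by (intro mult_left_mono) auto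
    also have "\<dots> = q\<^sup>2 * tent n x + q * p * (tent n x + (- \<sigma>)) + q * p * (tent n x + (- \<sigma>))
        + p\<^sup>2 * (tent n x + 2 * (- \<sigma>)) - tent n x"
      unfolding tot by simp
    also have "\<dots> \<le> ?R"
      unfolding p_def[symmetric]
      using tent_lipschitz[of n 1 x] tent_lipschitz[of n 2 x] n p q_pos
      by (intro diff_right_mono add_mono mult_left_mono) (auto simp: \<sigma>_def)
    finally show ?thesis .
  qed
qed

text \<open>The shift by 2 leads past the swapped pair, to the weight of the flip out of it.\<close>

definition tent_exp :: "nat \<Rightarrow> nat \<Rightarrow> real" where
  "tent_exp n k = trace_exp q (alt k) (\<lambda>t. tent n (real (length t) + 2))"

lemma tent_exp_bounds: "0 \<le> tent_exp n k" "tent_exp n k \<le> 1"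
proof -
  have "trace_exp q (alt k) (\<lambda>_. 0) \<le> tent_exp n k"
    unfolding tent_exp_def by (intro trace_exp_mono tent_bounds)
  then show "0 \<le> tent_exp n k" by (simp add: trace_exp_const)
  have "tent_exp n k \<le> trace_exp q (alt k) (\<lambda>_. 1)"
    unfolding tent_exp_def by (intro trace_exp_mono tent_bounds)
  then show "tent_exp n k \<le> 1" by (simp add: trace_exp_const)
qed

lemma tent_exp_increment:
  assumes n: "n \<ge> 100" and k: "k \<le> n" "real n - real k \<le> sqrt n"
  shows "(1 - q) / (20 * sqrt n) \<le> tent_exp n (Suc k) - tent_exp n k"
proof -
  define \<rho> where "\<rho> = 10 * sqrt n - 2"
  define \<sigma> where "\<sigma> = 1 / (20 * sqrt n)"
  \<comment> \<open>The -2 compensates the shift by 2 in \<open>tent_exp\<close>.\<close>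
  define c where "c = 2 * real n * (1 - q) - 2"
  have sn: "10 \<le> sqrt n" using n by (intro real_le_rsqrt) simp
  have "(9 * sqrt n)\<^sup>2 \<le> \<rho>\<^sup>2" using sn by (intro power_mono) (auto simp: \<rho>_def)
  then have \<rho>: "81 * real n \<le> \<rho>\<^sup>2" by (simp add: power_mult_distrib)
  have \<rho>0: "0 < \<rho>" using sn by (simp add: \<rho>_def)
  define E where "E = trace_exp q (alt k) (\<lambda>t. (length t - c)\<^sup>2)"
  \<comment> \<open>The squared bias contributes 16 n and the variance 2 n. As
    \<open>\<rho>\<^sup>2\<close> is at least 81 n, at most half of the slope is lost.\<close>
  have E: "E \<le> 18 * n"
  proof -
    have "\<bar>2 * real k * (1 - q) - c\<bar> \<le> 4 * sqrt n"
    proof -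
      define y where "y = (1 - q) * (real n - real k)"
      have "2 * real k * (1 - q) - c = 2 - 2 * y" by (simp add: y_def c_def algebra_simps)
      moreover have "0 \<le> y" using k q_less_1 by (simp add: y_def)
      moreover have "y \<le> 1 * sqrt n"
        unfolding y_def using k q_pos q_less_1 by (intro mult_mono) auto
      ultimately show ?thesis using sn by (simp add: abs_le_iff)
    qed
    then have "(2 * real k * (1 - q) - c)\<^sup>2 \<le> (4 * sqrt n)\<^sup>2"
      by (metis abs_ge_zero power2_abs power_mono)
    moreover have "(1 - q) * q \<le> 1" using q_pos q_less_1 by (simp add: mult_le_one)
    then have "2 * real k * ((1 - q) * q) \<le> 2 * real n * 1"
      using k q_pos q_less_1 by (intro mult_mono) auto
    ultimately show ?thesis
      unfolding E_def trace_exp_length_sqr by (simp add: power_mult_distrib mult.assoc)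
  qed
  have "E * 4 \<le> \<rho>\<^sup>2" using E \<rho> by linarith
  then have "2 * E / \<rho>\<^sup>2 \<le> 1 / 2" using \<rho>0 by (simp add: field_simps)
  then have "2 * (1 - q) * \<sigma> * (1 / 2) \<le> 2 * (1 - q) * \<sigma> * (1 - 2 * E / \<rho>\<^sup>2)"
    using q_less_1 sn by (intro mult_left_mono) (auto simp: \<sigma>_def)
  also have "\<dots> = trace_exp q (alt k) (\<lambda>t. 2 * (1 - q) * \<sigma> * (1 - 2 * ((length t - c)\<^sup>2) / \<rho>\<^sup>2))"
  proof -
    have "trace_exp q (alt k) (\<lambda>t. A * (1 - 2 * F t / B)) = A * (1 - 2 * trace_exp q (alt k) F / B)" for A B F
    proof -
      have "A * (1 - 2 * x / B) = A - A * 2 / B * x" for x by (simp add: right_diff_distrib)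
      then show ?thesis by (simp only: trace_exp_diff trace_exp_const trace_exp_cmult)
    qed
    then show ?thesis unfolding E_def by simp
  qed
  also have "\<dots> \<le> trace_exp q (alt k) (\<lambda>t. q\<^sup>2 * tent n (real (length t) + 2)
      + q * (1 - q) * tent n (real (length t) + 2 + 1) + q * (1 - q) * tent n (real (length t) + 2 + 1)
      + (1 - q)\<^sup>2 * tent n (real (length t) + 2 + 2) - tent n (real (length t) + 2))"
  proof (rule trace_exp_mono)
    fix t :: "bool list"
    show "2 * (1 - q) * \<sigma> * (1 - 2 * ((length t - c)\<^sup>2) / \<rho>\<^sup>2) \<le> q\<^sup>2 * tent n (real (length t) + 2)
      + q * (1 - q) * tent n (real (length t) + 2 + 1) + q * (1 - q) * tent n (real (length t) + 2 + 1)
      + (1 - q)\<^sup>2 * tent n (real (length t) + 2 + 2) - tent n (real (length t) + 2)"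
      using tent_increment[OF n, of "real (length t) + 2"] by (simp add: \<sigma>_def c_def \<rho>_def algebra_simps)
  qed
  also have "\<dots> = tent_exp n (Suc k) - tent_exp n k"
    unfolding tent_exp_def trace_exp_alt_Suc trace_exp_diff by (simp add: add_ac)
  finally have "2 * (1 - q) * \<sigma> * (1 / 2) \<le> tent_exp n (Suc k) - tent_exp n k" .
  moreover have "2 * (1 - q) * \<sigma> * (1 / 2) = (1 - q) / (20 * sqrt n)"
  proof -
    have "2 * a * \<sigma> * (1 / 2) = a * \<sigma>" for a by simp
    then show ?thesis by (simp only: \<sigma>_def times_divide_eq_right mult_1_right)
  qed
  ultimately show ?thesis by (simp only:)
qed

definition tent_last :: "nat \<Rightarrow> nat \<Rightarrow> real" where
  "tent_last n k = trace_exp q (alt k) (\<lambda>t. tent n (real (length t)) * last_sign t)"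

text \<open>If exactly one bit of the last block is kept, the signs cancel: 0 and 1 are equally
  likely and sit at the same position. If both are kept, the sign is 1 and the position is shifted
  by two.\<close>

lemma tent_last_Suc: "tent_last n (Suc k) = q\<^sup>2 * tent_last n k + (1 - q)\<^sup>2 * tent_exp n k"
  unfolding tent_last_def tent_exp_def trace_exp_alt_Suc trace_exp_cmult[symmetric] trace_exp_add[symmetric]
  by (intro arg_cong[of _ _ "trace_exp q (alt k)"] ext) (simp add: last_sign_def add_ac)

lemma tent_last_bound: "\<bar>tent_last n k\<bar> \<le> 1"
proof -
  have b: "\<bar>tent n x * last_sign t\<bar> \<le> 1" for x t
    using tent_bounds[of n x] by (simp add: last_sign_def)
  have "tent_last n k \<le> trace_exp q (alt k) (\<lambda>_. 1)" "trace_exp q (alt k) (\<lambda>_. - 1) \<le> tent_last n k"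
    unfolding tent_last_def using b by (auto intro!: trace_exp_mono simp: abs_le_iff minus_le_iff)
  then show ?thesis by (simp add: trace_exp_const)
qed

text \<open>By the recursion each increment is q^2 times the previous one plus a multiple of an
  increment of \<open>tent_exp\<close>, nonnegative within sqrt n blocks of the end. A negative
  increment, at least -2, thus decays geometrically over \<open>I\<close> steps.\<close>

lemma tent_last_increment:
  assumes n: "n \<ge> 100" and I: "real (Suc I) \<le> sqrt n" and m: "n = Suc m"
  shows "- 2 * (q\<^sup>2) ^ I \<le> tent_last n n - tent_last n m"
proof -
  define \<delta> where "\<delta> k = tent_last n (Suc k) - tent_last n k" for k
  have "sqrt n \<le> real n" using n by (intro real_le_lsqrt) (auto simp: power2_eq_square)
  then have Im: "I \<le> m" using I m by simp
  have "(q\<^sup>2) ^ i * \<delta> (m - I) \<le> \<delta> (m - I + i)" if "i \<le> I" for i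
    using that
  proof (induction i)
    case (Suc i)
    define k where "k = m - I + i"
    have k: "k \<le> n" "real n - real k \<le> sqrt n"
      using Suc.prems Im I m by (auto simp: k_def of_nat_diff)
    have "0 \<le> (1 - q) / (20 * sqrt n)" using q_less_1 by simp
    also note tent_exp_increment[OF n k]
    finally have d: "0 \<le> tent_exp n (Suc k) - tent_exp n k" .
    have "(q\<^sup>2) ^ Suc i * \<delta> (m - I) = q\<^sup>2 * ((q\<^sup>2) ^ i * \<delta> (m - I))" by simp
    also have "\<dots> \<le> q\<^sup>2 * \<delta> k"
      using Suc by (intro mult_left_mono) (auto simp: k_def)
    also have "\<dots> \<le> q\<^sup>2 * \<delta> k + (1 - q)\<^sup>2 * (tent_exp n (Suc k) - tent_exp n k)"
      using d by simp
    also have "\<dots> = \<delta> (Suc k)"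
      by (simp add: \<delta>_def tent_last_Suc[of n "Suc k"] tent_last_Suc[of n k] algebra_simps)
    finally show ?case by (simp add: k_def)
  qed simp
  from this[of I] Im have "(q\<^sup>2) ^ I * \<delta> (m - I) \<le> \<delta> m" by simp
  moreover have "(q\<^sup>2) ^ I * (- 2) \<le> (q\<^sup>2) ^ I * \<delta> (m - I)"
    using tent_last_bound[of n "Suc (m - I)"] tent_last_bound[of n "m - I"]
    by (intro mult_left_mono) (auto simp: \<delta>_def)
  ultimately show ?thesis by (simp add: \<delta>_def m)
qed

text \<open>The signal is the growth of \<open>tent_exp\<close> over one block times the bias of the
  first bit behind the defect. The error collects 2 q^(2I) from the flip into the pair and q^(2I)
  from the possibility that nothing is retained behind it.\<close>

lemma tent_signal:
  assumes n: "n \<ge> 100" and I: "real (Suc I) \<le> sqrt n" and m: "n = Suc m"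
  defines "g \<equiv> \<lambda>j. tent n (real j)"
  shows "(1 - q)\<^sup>2 * ((1 - q) / (1 + q) * ((1 - q) / (20 * sqrt n)) - 3 * (q\<^sup>2) ^ I) \<le>
    trace_exp q (x_str n) (stat g) - trace_exp q (y_str n) (stat g)"
proof -
  define z where "z = (1 - q) / (1 + q)"
  have z: "0 \<le> z" "z \<le> 1" using q_pos q_less_1 by (auto simp: z_def)
  have sq: "trace_exp q (xs @ [True, False] @ ys) (stat g) - trace_exp q (xs @ [False, True] @ ys) (stat g) =
      (1 - q)\<^sup>2 * (- trace_exp q xs (\<lambda>t. g (length t) * last_sign t)
        + trace_exp q xs (\<lambda>t. g (length t + 2)) * trace_exp q ys first_sign)" for xs ys
  proof -
    have inner: "trace_exp q ys (\<lambda>u. a + b * first_sign u) = a + b * trace_exp q ys first_sign" for a b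
      by (simp only: trace_exp_add trace_exp_const trace_exp_cmult)
    show ?thesis
      unfolding trace_exp_swap[OF q_bounds] stat_swap inner
      by (simp only: trace_exp_add trace_exp_minus trace_exp_multc)
  qed
  have "trace_exp q (x_str n) (stat g) - trace_exp q (y_str n) (stat g) =
     (trace_exp q (alt m @ [True, False] @ alt n) (stat g) - trace_exp q (alt m @ [False, True] @ alt n) (stat g))
     - (trace_exp q (alt n @ [True, False] @ alt m) (stat g) - trace_exp q (alt n @ [False, True] @ alt m) (stat g))"
    by (simp only: x_str_def y_str_def m alt_swap diff_Suc_1)
  also have "\<dots> = (1 - q)\<^sup>2 * ((tent_last n n - tent_last n m) + z * (tent_exp n n - tent_exp n m)
      - z * (tent_exp n n * (q\<^sup>2) ^ m) + z * (tent_exp n m * (q\<^sup>2) ^ n))"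
    unfolding sq unfolding trace_exp_first_sign tent_last_def tent_exp_def g_def z_def[symmetric]
    by (simp add: algebra_simps)
  also have "\<dots> \<ge> (1 - q)\<^sup>2 * (- 2 * (q\<^sup>2) ^ I + z * ((1 - q) / (20 * sqrt n)) - (q\<^sup>2) ^ I + 0)"
  proof (intro mult_left_mono add_mono diff_mono)
    show "- 2 * (q\<^sup>2) ^ I \<le> tent_last n n - tent_last n m"
      by (rule tent_last_increment[OF n I m])
    have "1 \<le> sqrt n" using n by simp
    then show "(1 - q) / (20 * sqrt n) \<le> tent_exp n n - tent_exp n m"
      using tent_exp_increment[OF n, of m] m by simp
    have "sqrt n \<le> real n" using n by (intro real_le_lsqrt) (auto simp: power2_eq_square)
    then have Im: "I \<le> m" using I m by simp
    have "z * (tent_exp n n * (q\<^sup>2) ^ m) \<le> 1 * (1 * (q\<^sup>2) ^ I)"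
      using z tent_exp_bounds[of n n] Im q2 by (intro mult_mono power_decreasing) auto
    then show "z * (tent_exp n n * (q\<^sup>2) ^ m) \<le> (q\<^sup>2) ^ I" by simp
    show "0 \<le> z * (tent_exp n m * (q\<^sup>2) ^ n)"
      using z tent_exp_bounds[of n m] by simp
  qed (use z in auto)
  finally show ?thesis by (simp add: z_def)
qed

end

section \<open>Conclusion\<close>

lemma tv_dist_eq_sum:
  assumes "finite A" "\<And>s. s \<notin> A \<Longrightarrow> pmf M s = 0 \<and> pmf N s = 0"
  shows "tv_dist M N = 1 / 2 * (\<Sum>s\<in>A. \<bar>pmf M s - pmf N s\<bar>)"
proof -
  have "(\<Sum>\<^sub>\<infinity>s. \<bar>pmf M s - pmf N s\<bar>) = (\<Sum>\<^sub>\<infinity>s\<in>A. \<bar>pmf M s - pmf N s\<bar>)"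
    using assms(2) by (intro infsum_cong_neutral) auto
  then show ?thesis using assms(1) by (simp add: tv_dist_def)
qed

context deletion
begin

abbreviation tv :: "nat \<Rightarrow> real" where
  "tv n \<equiv> tv_dist (trace_law q (x_str n)) (trace_law q (y_str n))"

lemma tv_eq_sum:
  assumes "n \<ge> 1"
  shows "tv n = 1 / 2 * (\<Sum>s\<in>strs_le (4 * n). \<bar>pmf (trace_law q (x_str n)) s - pmf (trace_law q (y_str n)) s\<bar>)"
proof (rule tv_dist_eq_sum)
  fix s assume "s \<notin> strs_le (4 * n)"
  then have "4 * n < length s" by (simp add: strs_le_def)
  then show "pmf (trace_law q (x_str n)) s = 0 \<and> pmf (trace_law q (y_str n)) s = 0"
    using assms by (auto simp: pmf_trace_law_full[OF q_bounds] length_x_str length_y_str)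
qed simp

lemma tv_eq_sum_trm:
  assumes "n = Suc m"
  shows "tv n = (1 - q)\<^sup>2 / 2 * (\<Sum>s\<in>strs_le (4 * n). \<bar>trm_sum m s\<bar>)"
  using tv_eq_sum[of n] unfolding assms pmf_x_y_diff trm_sum_def[symmetric]
  by (simp add: abs_mult sum_distrib_left)

lemma tv_le_1:
  assumes "n \<ge> 1"
  shows "tv n \<le> 1"
proof -
  have "(\<Sum>s\<in>strs_le (4 * n). \<bar>pmf (trace_law q (x_str n)) s - pmf (trace_law q (y_str n)) s\<bar>) \<le>
      (\<Sum>s\<in>strs_le (4 * n). pmf (trace_law q (x_str n)) s * 1 + pmf (trace_law q (y_str n)) s * 1)"
    by (intro sum_mono) (simp add: abs_le_iff add_increasing add_increasing2 order_trans[OF _ add_increasing])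
  also have "\<dots> \<le> 1 + 1"
    unfolding sum.distrib using sum_pmf_le_trace_exp[of "strs_le (4 * n)" "\<lambda>_. 1" q]
    by (intro add_mono) (auto simp: trace_exp_const)
  finally show ?thesis using tv_eq_sum[OF assms] by simp
qed

lemma tv_pos:
  assumes n: "n \<ge> 1"
  shows "0 < tv n"
proof -
  obtain m where m: "n = Suc m" using n by (cases n) auto
  \<comment> \<open>At this index \<open>x_str\<close> has the 1 of its defect, whereas
    \<open>y_str\<close> still has the 0 of a block.\<close>
  have "x_str n ! (2 * m) \<noteq> y_str n ! (2 * m)"
    by (simp add: x_str_def y_str_def m alt_Suc nth_append length_str_power)
  then have ne: "x_str n \<noteq> y_str n" by auto
  have "0 < (1 - q) ^ length (x_str n)" using q_less_1 by simp
  also have "\<dots> = \<bar>pmf (trace_law q (x_str n)) (x_str n) - pmf (trace_law q (y_str n)) (x_str n)\<bar>"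
    using n ne q_less_1 by (simp add: pmf_trace_law_full[OF q_bounds] length_x_str length_y_str)
  also have "\<dots> \<le> (\<Sum>s\<in>strs_le (4 * n). \<bar>pmf (trace_law q (x_str n)) s - pmf (trace_law q (y_str n)) s\<bar>)"
  proof (rule member_le_sum)
    show "x_str n \<in> strs_le (4 * n)" using n by (simp add: strs_le_def length_x_str)
  qed auto
  finally show ?thesis using tv_eq_sum[OF n] by simp
qed

lemma tv_upper:
  assumes n: "n \<ge> 100"
  shows "tv n \<le> sqrt l2_const * n powr (- (3 / 4))"
proof -
  obtain m where m: "n = Suc m" using n by (cases n) auto
  have "(1 - q)\<^sup>2 \<le> 1" using q_pos q_less_1 by (simp add: power_le_one)
  then have "tv n \<le> 1 / 2 * (2 * sqrt l2_const * n powr (- (3 / 4)))"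
    unfolding tv_eq_sum_trm[OF m] by (intro mult_mono sum_abs_trm_le[OF m n]) (auto intro: sum_nonneg)
  then show ?thesis by simp
qed

lemma sum_trm_stat:
  assumes n: "n = Suc m"
  shows "trace_exp q (x_str n) F - trace_exp q (y_str n) F = (1 - q)\<^sup>2 * (\<Sum>s\<in>strs_le (4 * n). trm_sum m s * F s)"
proof -
  have "trace_exp q (x_str n) F - trace_exp q (y_str n) F =
    (\<Sum>s\<in>strs_le (4 * n). (pmf (trace_law q (x_str n)) s - pmf (trace_law q (y_str n)) s) * F s)"
    using n by (simp add: trace_exp_eq_sum[of _ "4 * n"] length_x_str length_y_str sum_subtractf left_diff_distrib)
  then show ?thesis
    unfolding n pmf_x_y_diff trm_sum_def[symmetric] by (simp add: sum_distrib_left mult.assoc)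
qed

lemma signal_lower:
  obtains d n1 where "0 < d" "100 \<le> n1"
    "\<And>n m. n1 \<le> n \<Longrightarrow> n = Suc m \<Longrightarrow>
       d / sqrt n \<le> (\<Sum>s\<in>strs_le (4 * n). trm_sum m s * stat (\<lambda>j. tent n (real j)) s)"
proof -
  \<comment> \<open>The main term of \<open>tent_signal\<close> without its factor (1 - q)^2 is 2 d
    / sqrt n; half of it is given up to the geometric error with \<open>I\<close> close to sqrt
    n.\<close>
  define d where "d = (1 - q) / (1 + q) * (1 - q) / 40"
  have d: "0 < d" using q_pos q_less_1 by (simp add: d_def)
  have "(\<lambda>k. real k * (q\<^sup>2) ^ k) \<longlonglongrightarrow> 0"
    using powser_times_n_limit_0[of "q\<^sup>2"] q2 by simp
  then have "\<forall>\<^sub>F k in sequentially. real k * (q\<^sup>2) ^ k < d / 9"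
    using d by (intro order_tendstoD(2)) auto
  then obtain K0 where K0: "\<And>k. K0 \<le> k \<Longrightarrow> real k * (q\<^sup>2) ^ k < d / 9"
    unfolding eventually_sequentially by blast
  \<comment> \<open>With \<open>I\<close> one less than the integer part of sqrt n, this gives
    \<open>I \<ge> K0\<close>, and \<open>I \<ge> 2\<close>, whence
    \<open>I \<ge> sqrt n / 3\<close>.\<close>
  define n1 where "n1 = max 100 ((K0 + 3)\<^sup>2)"
  have main: "d / sqrt n \<le> (\<Sum>s\<in>strs_le (4 * n). trm_sum m s * stat (\<lambda>j. tent n (real j)) s)"
    if n: "n1 \<le> n" and m: "n = Suc m" for n m
  proof -
    have n100: "100 \<le> n" using n by (simp add: n1_def)
    define f where "f = nat \<lfloor>sqrt n\<rfloor>"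
    have f: "real f \<le> sqrt n" "sqrt n < real f + 1" by (auto simp: f_def)
    have "(K0 + 3)\<^sup>2 \<le> n" using n by (simp add: n1_def)
    then have "real ((K0 + 3)\<^sup>2) \<le> real n" by (rule of_nat_mono)
    then have "real (K0 + 3) \<le> sqrt n" by (intro real_le_rsqrt) (simp add: of_nat_power)
    then have fK: "K0 + 3 \<le> f" using f by simp
    define I where "I = f - 1"
    have I: "real (Suc I) \<le> sqrt n" "K0 \<le> I" "2 \<le> I" "sqrt n \<le> real I + 2"
      using f fK by (auto simp: I_def of_nat_diff)
    have sn: "0 < sqrt n" using n100 by simp
    have "real I * (q\<^sup>2) ^ I \<le> d / 9" using K0[OF I(2)] by simp
    then have "(q\<^sup>2) ^ I \<le> d / 9 / real I" using I(3) by (simp add: pos_le_divide_eq mult_ac)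
    also have "\<dots> \<le> d / 9 / (sqrt n / 3)"
      using I d sn by (intro divide_left_mono) auto
    finally have "3 * (q\<^sup>2) ^ I \<le> d / sqrt n" by simp
    moreover have "(1 - q) / (1 + q) * ((1 - q) / (20 * sqrt n)) = 2 * (d / sqrt n)"
    proof -
      have "a * (b / (20 * s)) = 2 * (a * b / 40 / s)" for a b s :: real by simp
      then show ?thesis unfolding d_def .
    qed
    ultimately have "d / sqrt n \<le> (1 - q) / (1 + q) * ((1 - q) / (20 * sqrt n)) - 3 * (q\<^sup>2) ^ I" by simp
    then have "(1 - q)\<^sup>2 * (d / sqrt n) \<le> (1 - q)\<^sup>2 * ((1 - q) / (1 + q) * ((1 - q) / (20 * sqrt n)) - 3 * (q\<^sup>2) ^ I)"
      by (intro mult_left_mono) auto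
    also note tent_signal[OF n100 I(1) m]
    finally show ?thesis
      unfolding sum_trm_stat[OF m] by (rule mult_left_le_imp_le) (use q_less_1 in simp)
  qed
  have "100 \<le> n1" by (simp add: n1_def)
  with d show ?thesis using main by (rule that)
qed

text \<open>The linear pairing with the test statistic is turned into a lower bound for the total
  variation via \<open>\<bar>x\<bar> \<le> L + x\<^sup>2 / L\<close> with \<open>L\<close> of order \<open>n\<^bsup>1/4\<^esup>\<close>.\<close>

lemma tv_lower:
  obtains c n1 where "0 < c" "100 \<le> n1" "\<And>n. n1 \<le> n \<Longrightarrow> c * n powr (- (3 / 4)) \<le> tv n"
proof -
  obtain d n1 where d: "0 < d" and n1: "100 \<le> n1"
    and sig: "\<And>n m. n1 \<le> n \<Longrightarrow> n = Suc m \<Longrightarrow>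
       d / sqrt n \<le> (\<Sum>s\<in>strs_le (4 * n). trm_sum m s * stat (\<lambda>j. tent n (real j)) s)"
    using signal_lower by blast
  define M where "M = 4 * 80 * sqrt l2_const"
  have M: "0 < M" using l2_const_pos by (simp add: M_def)
  \<comment> \<open>This choice lets the quadratic term consume exactly half of the signal.\<close>
  define B where "B = 2 * M / d"
  have B: "0 < B" using M d by (simp add: B_def)
  have main: "(1 - q)\<^sup>2 / 2 * (d / (2 * B)) * n powr (- (3 / 4)) \<le> tv n" if n: "n1 \<le> n" for n
  proof -
    obtain m where m: "n = Suc m" using n n1 by (cases n) auto
    have n100: "100 \<le> n" and n0: "0 < real n" using n n1 by auto
    define T where "T = stat (\<lambda>j. tent n (real j))"
    define L where "L = B * n powr (1 / 4)"
    have L: "0 < L" using B n0 by (simp add: L_def)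
    let ?A = "\<Sum>s\<in>strs_le (4 * n). \<bar>trm_sum m s\<bar>"
    have "(\<Sum>s\<in>strs_le (4 * n). \<bar>trm_sum m s\<bar> * (T s)\<^sup>2) \<le> M * n powr (- (1 / 4))"
      unfolding M_def T_def
      using sum_abs_trm_stat_le[OF m n100, of 80] sum_tent_sqr[of n] tent_bounds n100 by simp
    then have "1 / L * (\<Sum>s\<in>strs_le (4 * n). \<bar>trm_sum m s\<bar> * (T s)\<^sup>2) \<le> 1 / L * (M * n powr (- (1 / 4)))"
      using L by (intro mult_left_mono) auto
    also have "\<dots> = d / 2 * (n powr (- (1 / 4)) / n powr (1 / 4))"
      using M d by (simp add: L_def B_def)
    also have "n powr (- (1 / 4)) / n powr (1 / 4) = n powr (- (1 / 2))"
      by (simp add: powr_diff[symmetric])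
    finally have rest: "1 / L * (\<Sum>s\<in>strs_le (4 * n). \<bar>trm_sum m s\<bar> * (T s)\<^sup>2) \<le> d / 2 * n powr (- (1 / 2))" .
    have "d * n powr (- (1 / 2)) = d / sqrt n"
      unfolding powr_minus_divide powr_half_sqrt[OF less_imp_le[OF n0]] by simp
    also have "\<dots> \<le> (\<Sum>s\<in>strs_le (4 * n). trm_sum m s * T s)"
      unfolding T_def by (rule sig[OF n m])
    also have "\<dots> \<le> (\<Sum>s\<in>strs_le (4 * n). \<bar>trm_sum m s\<bar> * L + 1 / L * (\<bar>trm_sum m s\<bar> * (T s)\<^sup>2))"
    proof (intro sum_mono)
      fix s
      have "2 * (\<bar>T s\<bar> * L) \<le> L * L + (T s)\<^sup>2"
        using sum_squares_bound[of "\<bar>T s\<bar>" L] by (simp add: mult.assoc power2_eq_square[of L])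
      moreover have "0 \<le> \<bar>T s\<bar> * L" using L by simp
      ultimately have "\<bar>T s\<bar> * L \<le> L * L + (T s)\<^sup>2" by linarith
      then have "\<bar>T s\<bar> \<le> (L * L + (T s)\<^sup>2) / L"
        using L by (simp only: pos_le_divide_eq)
      also have "\<dots> = L + (T s)\<^sup>2 / L" using L by (simp add: add_divide_distrib)
      finally have "\<bar>T s\<bar> \<le> L + (T s)\<^sup>2 / L" .
      then have "\<bar>trm_sum m s\<bar> * \<bar>T s\<bar> \<le> \<bar>trm_sum m s\<bar> * (L + (T s)\<^sup>2 / L)"
        by (intro mult_left_mono) auto
      moreover have "trm_sum m s * T s \<le> \<bar>trm_sum m s\<bar> * \<bar>T s\<bar>"
        by (metis abs_ge_self abs_mult)
      ultimately show "trm_sum m s * T s \<le> \<bar>trm_sum m s\<bar> * L + 1 / L * (\<bar>trm_sum m s\<bar> * (T s)\<^sup>2)"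
        by (simp add: distrib_left)
    qed
    also have "\<dots> = ?A * L + 1 / L * (\<Sum>s\<in>strs_le (4 * n). \<bar>trm_sum m s\<bar> * (T s)\<^sup>2)"
      by (simp only: sum.distrib sum_distrib_left sum_distrib_right)
    also note rest
    finally have "d / 2 * n powr (- (1 / 2)) \<le> ?A * L" by simp
    then have "d / 2 * n powr (- (1 / 2)) / L \<le> ?A" using L by (simp add: pos_divide_le_eq)
    also have "d / 2 * n powr (- (1 / 2)) / L = d / (2 * B) * (n powr (- (1 / 2)) / n powr (1 / 4))"
      by (simp add: L_def)
    also have "n powr (- (1 / 2)) / n powr (1 / 4) = n powr (- (3 / 4))"
      by (simp add: powr_diff[symmetric])
    finally have "(1 - q)\<^sup>2 / 2 * (d / (2 * B) * n powr (- (3 / 4))) \<le> (1 - q)\<^sup>2 / 2 * ?A"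
      by (intro mult_left_mono) auto
    then show ?thesis unfolding tv_eq_sum_trm[OF m] by (simp only: mult.assoc)
  qed
  have "0 < (1 - q)\<^sup>2 / 2 * (d / (2 * B))" using d B q_less_1 by simp
  then show ?thesis using n1 main by (rule that)
qed

lemma tv_two_sided:
  "\<exists>C>0. \<forall>n\<ge>2. inverse C * real n powr (- (3 / 4)) * ln (real n) powr (- (1 / 2)) \<le> tv n \<and>
     tv n \<le> C * real n powr (- (3 / 4))"
proof -
  obtain c1 n1 where c1: "0 < c1" and n1: "100 \<le> n1"
    and low: "\<And>n. n1 \<le> n \<Longrightarrow> c1 * n powr (- (3 / 4)) \<le> tv n"
    using tv_lower by blast
  \<comment> \<open>Below the threshold there are finitely many values of \<open>n\<close>, each
    with positive distance.\<close>
  define c where "c = Min (insert c1 (tv ` {2..<n1}))"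
  have "0 < x" if "x \<in> insert c1 (tv ` {2..<n1})" for x
    using that c1 tv_pos by auto
  then have "0 < c" unfolding c_def by (subst Min_gr_iff) auto
  moreover have "c \<le> x" if "x \<in> insert c1 (tv ` {2..<n1})" for x
    unfolding c_def using that by (intro Min_le) auto
  ultimately have c: "0 < c" "c \<le> c1" and ctv: "\<And>n. 2 \<le> n \<Longrightarrow> n < n1 \<Longrightarrow> c \<le> tv n"
    by auto
  \<comment> \<open>For \<open>n \<ge> 2\<close> the logarithmic factor is at most its value at 2,
    so it only weakens the lower bound.\<close>
  define l where "l = ln (2::real) powr (- (1 / 2))"
  have l: "0 < l" by (simp add: l_def)
  \<comment> \<open>The summands serve the upper bound for large \<open>n\<close>, the upper bound
    for \<open>n < n1\<close> through \<open>tv n \<le> 1\<close>, and the lower bound.\<close>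
  define C where "C = sqrt l2_const + n1 + l / c"
  have C: "0 < C" "sqrt l2_const \<le> C" "real n1 \<le> C" "l / c \<le> C"
    using l2_const_pos l c n1 by (auto simp: C_def add_pos_nonneg)
  have "inverse C * real n powr (- (3 / 4)) * ln (real n) powr (- (1 / 2)) \<le> tv n \<and>
     tv n \<le> C * real n powr (- (3 / 4))" if n: "2 \<le> n" for n
  proof
    have p0: "0 \<le> real n powr (- (3 / 4))" by simp
    have "real n powr (- (3 / 4)) \<le> real n powr 0" using n by (intro powr_mono) auto
    then have p1: "real n powr (- (3 / 4)) \<le> 1" using n by simp
    have "c * real n powr (- (3 / 4)) \<le> tv n"
    proof (cases "n < n1")
      case True
      have "c * real n powr (- (3 / 4)) \<le> c * 1" using c p1 by (intro mult_left_mono) auto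
      then show ?thesis using ctv[OF n True] by simp
    next
      case False
      have "c * real n powr (- (3 / 4)) \<le> c1 * real n powr (- (3 / 4))"
        using c by (intro mult_right_mono) auto
      then show ?thesis using low[of n] False by simp
    qed
    moreover have "inverse C * ln (real n) powr (- (1 / 2)) \<le> c"
    proof -
      have "ln (real n) powr (- (1 / 2)) \<le> l"
        unfolding l_def using n by (intro powr_mono2') auto
      then have "inverse C * ln (real n) powr (- (1 / 2)) \<le> inverse C * l"
        using C by (intro mult_left_mono) auto
      also have "\<dots> \<le> c" using C c by (simp add: field_simps)
      finally show ?thesis .
    qed
    then have "inverse C * ln (real n) powr (- (1 / 2)) * real n powr (- (3 / 4)) \<le> c * real n powr (- (3 / 4))"
      by (intro mult_right_mono) auto
    ultimately show "inverse C * real n powr (- (3 / 4)) * ln (real n) powr (- (1 / 2)) \<le> tv n"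
      by (simp add: mult_ac)
    show "tv n \<le> C * real n powr (- (3 / 4))"
    proof (cases "n < n1")
      case True
      have "1 \<le> C * (1 / real n)" using True C(3) n by (simp add: field_simps)
      also have "1 / real n = real n powr (- 1)" using n by (simp add: powr_minus_divide)
      also have "C * real n powr (- 1) \<le> C * real n powr (- (3 / 4))"
        using C n by (intro mult_left_mono powr_mono) auto
      finally show ?thesis using tv_le_1[of n] n by simp
    next
      case False
      have "tv n \<le> sqrt l2_const * real n powr (- (3 / 4))"
        using False n1 by (intro tv_upper) simp
      also have "\<dots> \<le> C * real n powr (- (3 / 4))" using C by (intro mult_right_mono) auto
      finally show ?thesis .
    qed
  qed
  then show ?thesis using C(1) by blast
qed

end

theorem proposition1p4:
  fixes q :: real
  assumes "0 < q" and "q < 1"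
  shows "\<exists>C::real. C > 0 \<and> (\<forall>n::nat. n \<ge> 2 \<longrightarrow>
           inverse C * real n powr (- (3 / 4)) * ln (real n) powr (- (1 / 2))
             \<le> tv_dist (trace_law q (x_str n)) (trace_law q (y_str n)) \<and>
           tv_dist (trace_law q (x_str n)) (trace_law q (y_str n))
             \<le> C * real n powr (- (3 / 4)))"
proof -
  interpret deletion q using assms by unfold_locales
  show ?thesis by (rule tv_two_sided)
qed

end
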